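(* Let $(\psi,\bar\psi)$ be a specification of a non-degenerate homogeneous two-spin system, and let $G_n$ be a uniformly sparse sequence of random graphs converging locally to the $d$-regular tree $\mathbb{T}_d$ ($d\ge 3$ fixed). (a) If the system is ferromagnetic, then the limit $\phi=\lim_{n\to\infty}\frac1n\mathbb{E}_n[\log Z_{G_n}]$ exists and equals $\Phi_{\{\mathbb T\}}=\sup\{\Phi_1(h): h\in\Delta,\ \mathsf F(h)=h\}$. Moreover, letting $h^+$ (resp. $h^-$) be the fixed point of $\mathsf F$ in $\Delta$ maximizing (resp. minimizing) $h(+)$, one has $\Phi_{\{\mathbb T\}}=\Phi_1(h^+)$ if $\psi(+,+)\bar\psi(+)^{2/d}\ge\psi(-,-)\bar\psi(-)^{2/d}$ and $\Phi_{\{\mathbb T\}}=\Phi_1(h^-)$ otherwise. (b) If the system is anti-ferromagnetic and the $G_n$ are moreover nearly bipartite, then $\phi$ exists and equals $\Phi_{\{\mathbb T_\pm\}}=\sup\{\Phi_2(h_+,h_-): h_+=\mathsf F(h_-),\ h_-=\mathsf F(h_+)\}$; moreover $\Phi_{\{\mathbb T_\pm\}}=\Phi_2(h^+)=\Phi_2(h^-)$, where $h^+$ (resp. $h^-$) is the fixed pair $(h_+,h_-)$ maximizing $h_+(+)$ (resp. maximizing $h_-(+)$).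
   Context: Spins take values in $\{+1,-1\}$ (written $\pm$). A specification is a pair $(\psi,\bar\psi)$ with $\psi:\{\pm\}^2\to[0,\infty)$ symmetric and $\bar\psi:\{\pm\}\to(0,\infty)$; on a finite graph $G=(V,E)$ the partition function is $Z_G=\sum_{\sigma\in\{\pm\}^V}\prod_{(ij)\in E}\psi(\sigma_i,\sigma_j)\prod_{i\in V}\bar\psi(\sigma_i)$. Following the paper's classification, the system is non-degenerate if $\psi(+,-)>0$ and $\max(\psi(+,+),\psi(-,-))>0$; it is ferromagnetic if $\psi(+,+)\psi(-,-)\ge\psi(+,-)^2$ and anti-ferromagnetic if $\psi(+,+)\psi(-,-)<\psi(+,-)^2$ (non-degenerate systems reduce to Ising models, or to the hard-core model in the anti-ferromagnetic case). Graph sequences: $G_n$ is a random graph on vertex set $[n]$ with law $\mathbb P_n$ (expectation $\mathbb E_n$), and $I_n$ is a uniformly random vertex. $B_t(v)$ is the subgraph induced by vertices within graph distance $t$ of $v$. $G_n$ converges locally to $\mathbb T_d$ if for every $t\ge0$, $\mathbb P_n(B_t(I_n)\cong\mathbb T_d^t)\to1$, where $\mathbb T_d^t$ is the depth-$t$ ball around the root $o$ of the infinite $d$-regular tree. It is uniformly sparse if $\lim_{L\to\infty}\limsup_n\mathbb E_n[|\partial I_n|\mathbf 1\{|\partial I_n|\ge L\}]=0$. Let $\mathbb T_+$ be $\mathbb T_d$ with vertices colored $+$ or $-$ according to whether their distance from $o$ is even or odd, and $\mathbb T_-$ the same with colors reversed. $G_n$ is nearly bipartite if there exist (not necessarily proper)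 colorings $\tau:[n]\to\{\pm\}$ such that for every $t$, the colored rooted ball $B_t(I_n)$ converges in distribution to the colored depth-$t$ ball of $\mathbf T$, where $\mathbf T$ equals $\mathbb T_+$ or $\mathbb T_-$ with probability $1/2$ each. Bethe quantities: $\Delta$ is the set of probability measures on $\{\pm\}$. Define $\mathsf F:\Delta\to\Delta$ by $\mathsf F(h)(\sigma)\propto\bar\psi(\sigma)\big(\sum_{\sigma'}\psi(\sigma,\sigma')h(\sigma')\big)^{d-1}$. For $h\in\Delta$, $\Phi_1(h)=\log\sum_\sigma\bar\psi(\sigma)\big(\sum_{\sigma'}\psi(\sigma,\sigma')h(\sigma')\big)^d-\frac d2\log\sum_{\sigma,\sigma'}h(\sigma)\psi(\sigma,\sigma')h(\sigma')$. For $h_+,h_-\in\Delta$, $\Phi_2(h_+,h_-)=\frac12\log\sum_\sigma\bar\psi(\sigma)\big(\sum_{\sigma'}\psi(\sigma,\sigma')h_-(\sigma')\big)^d+\frac12\log\sum_\sigma\bar\psi(\sigma)\big(\sum_{\sigma'}\psi(\sigma,\sigma')h_+(\sigma')\big)^d-\frac d2\log\sum_{\sigma,\sigma'}h_+(\sigma)\psi(\sigma,\sigma')h_-(\sigma')$. *)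

theory Defs
  imports "HOL-Probability.Probability"
begin

text \<open>Spin +1 is encoded as True, spin -1 as False.
  A (simple, undirected) graph on vertex set [n] = {0..<n} is encoded by its adjacency
  relation G :: nat => nat => bool.\<close>

type_synonym graph = "nat \<Rightarrow> nat \<Rightarrow> bool"

definition simple_graph_on :: "nat \<Rightarrow> graph \<Rightarrow> bool" where
  "simple_graph_on n G \<longleftrightarrow>
     (\<forall>i j. G i j \<longrightarrow> i < n \<and> j < n) \<and> (\<forall>i j. G i j \<longleftrightarrow> G j i) \<and> (\<forall>i. \<not> G i i)"

definition two_spin_spec :: "(bool \<Rightarrow> bool \<Rightarrow> real) \<Rightarrow> (bool \<Rightarrow> real) \<Rightarrow> bool" where
  "two_spin_spec \<psi> \<psi>b \<longleftrightarrow> (\<forall>s s'. \<psi> s s' \<ge> 0) \<and> (\<forall>s s'. \<psi> s s' = \<psi> s' s) \<and> (\<forall>s. \<psi>b s > 0)"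

definition non_degenerate :: "(bool \<Rightarrow> bool \<Rightarrow> real) \<Rightarrow> bool" where
  "non_degenerate \<psi> \<longleftrightarrow> \<psi> True False > 0 \<and> max (\<psi> True True) (\<psi> False False) > 0"

definition ferromagnetic :: "(bool \<Rightarrow> bool \<Rightarrow> real) \<Rightarrow> bool" where
  "ferromagnetic \<psi> \<longleftrightarrow> \<psi> True True * \<psi> False False \<ge> (\<psi> True False)\<^sup>2"

definition antiferromagnetic :: "(bool \<Rightarrow> bool \<Rightarrow> real) \<Rightarrow> bool" where
  "antiferromagnetic \<psi> \<longleftrightarrow> \<psi> True True * \<psi> False False < (\<psi> True False)\<^sup>2"

definition partition_fn :: "(bool \<Rightarrow> bool \<Rightarrow> real) \<Rightarrow> (bool \<Rightarrow> real) \<Rightarrow> nat \<Rightarrow> graph \<Rightarrow> real" where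
  "partition_fn \<psi> \<psi>b n G =
     (\<Sum>\<sigma>\<in>{0..<n} \<rightarrow>\<^sub>E (UNIV :: bool set).
        (\<Prod>e\<in>{(i,j). i < j \<and> j < n \<and> G i j}. \<psi> (\<sigma> (fst e)) (\<sigma> (snd e))) *
        (\<Prod>i\<in>{0..<n}. \<psi>b (\<sigma> i)))"

fun dist_le :: "graph \<Rightarrow> nat \<Rightarrow> nat \<Rightarrow> nat \<Rightarrow> bool" where
  "dist_le G 0 v u \<longleftrightarrow> u = v"
| "dist_le G (Suc k) v u \<longleftrightarrow> dist_le G k v u \<or> (\<exists>w. dist_le G k v w \<and> G w u)"

definition ball :: "graph \<Rightarrow> nat \<Rightarrow> nat \<Rightarrow> nat set" where
  "ball G t v = {u. dist_le G t v u}"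

text \<open>The depth-t ball T_d^t of the infinite d-regular tree rooted at o = []:
  vertices are words; the root has children 0..d-1, every other vertex has
  children 0..d-2 (plus its parent), so every vertex of T_d has degree d.
  Parity of the word length is the distance from the root.\<close>

definition tree_ball :: "nat \<Rightarrow> nat \<Rightarrow> nat list set" where
  "tree_ball d t = {xs. length xs \<le> t \<and> (\<forall>i<length xs. xs ! i < (if i = 0 then d else d - 1))}"

definition tree_adj :: "nat list \<Rightarrow> nat list \<Rightarrow> bool" where
  "tree_adj xs ys \<longleftrightarrow> (\<exists>a. ys = xs @ [a]) \<or> (\<exists>a. xs = ys @ [a])"

definition ball_iso :: "nat \<Rightarrow> nat \<Rightarrow> graph \<Rightarrow> nat \<Rightarrow> (nat \<Rightarrow> nat list) \<Rightarrow> bool" where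
  "ball_iso d t G v f \<longleftrightarrow>
     bij_betw f (ball G t v) (tree_ball d t) \<and> f v = [] \<and>
     (\<forall>x\<in>ball G t v. \<forall>y\<in>ball G t v. G x y \<longleftrightarrow> tree_adj (f x) (f y))"

definition ball_is_tree :: "nat \<Rightarrow> nat \<Rightarrow> graph \<Rightarrow> nat \<Rightarrow> bool" where
  "ball_is_tree d t G v \<longleftrightarrow> (\<exists>f. ball_iso d t G v f)"

definition ball_is_Tplus :: "nat \<Rightarrow> nat \<Rightarrow> graph \<Rightarrow> (nat \<Rightarrow> bool) \<Rightarrow> nat \<Rightarrow> bool" where
  "ball_is_Tplus d t G \<tau> v \<longleftrightarrow>
     (\<exists>f. ball_iso d t G v f \<and> (\<forall>x\<in>ball G t v. \<tau> x = even (length (f x))))"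

definition ball_is_Tminus :: "nat \<Rightarrow> nat \<Rightarrow> graph \<Rightarrow> (nat \<Rightarrow> bool) \<Rightarrow> nat \<Rightarrow> bool" where
  "ball_is_Tminus d t G \<tau> v \<longleftrightarrow>
     (\<exists>f. ball_iso d t G v f \<and> (\<forall>x\<in>ball G t v. \<tau> x = odd (length (f x))))"

definition rooted :: "(nat \<Rightarrow> graph pmf) \<Rightarrow> nat \<Rightarrow> (graph \<times> nat) pmf" where
  "rooted P n = P n \<bind> (\<lambda>G. map_pmf (\<lambda>v. (G, v)) (pmf_of_set {0..<n}))"

definition random_graph_seq :: "(nat \<Rightarrow> graph pmf) \<Rightarrow> bool" where
  "random_graph_seq P \<longleftrightarrow> (\<forall>n. \<forall>G\<in>set_pmf (P n). simple_graph_on n G)"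

definition converges_locally :: "(nat \<Rightarrow> graph pmf) \<Rightarrow> nat \<Rightarrow> bool" where
  "converges_locally P d \<longleftrightarrow>
     (\<forall>t. (\<lambda>n. measure_pmf.prob (rooted P n) {(G, v). ball_is_tree d t G v}) \<longlonglongrightarrow> 1)"

definition degree :: "graph \<Rightarrow> nat \<Rightarrow> nat" where
  "degree G v = card {u. G v u}"

definition uniformly_sparse :: "(nat \<Rightarrow> graph pmf) \<Rightarrow> bool" where
  "uniformly_sparse P \<longleftrightarrow>
     ((\<lambda>L::nat. limsup (\<lambda>n. ereal (measure_pmf.expectation (rooted P n)
         (\<lambda>(G, v). real (degree G v) * (if degree G v \<ge> L then 1 else 0))))) \<longlonglongrightarrow> 0)"

text \<open>Nearly bipartite: there are colorings tau n G : [n] -> {+,-} (of the realization G of G_n)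
  such that the colored rooted ball converges in distribution to that of T, T = T_+ or T_-
  with probability 1/2 each. The colored balls live in a countable discrete space and the limit
  law is supported on the two (distinct) classes of T_+^t and T_-^t, so convergence in
  distribution means exactly that both probabilities tend to 1/2.\<close>

definition nearly_bipartite :: "(nat \<Rightarrow> graph pmf) \<Rightarrow> nat \<Rightarrow> bool" where
  "nearly_bipartite P d \<longleftrightarrow>
     (\<exists>\<tau> :: nat \<Rightarrow> graph \<Rightarrow> nat \<Rightarrow> bool.
        \<forall>t. (\<lambda>n. measure_pmf.prob (rooted P n) {(G, v). ball_is_Tplus d t G (\<tau> n G) v}) \<longlonglongrightarrow> 1/2
          \<and> (\<lambda>n. measure_pmf.prob (rooted P n) {(G, v). ball_is_Tminus d t G (\<tau> n G) v}) \<longlonglongrightarrow> 1/2)"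

definition free_energy_seq :: "(bool \<Rightarrow> bool \<Rightarrow> real) \<Rightarrow> (bool \<Rightarrow> real) \<Rightarrow> (nat \<Rightarrow> graph pmf) \<Rightarrow> nat \<Rightarrow> real" where
  "free_energy_seq \<psi> \<psi>b P n = measure_pmf.expectation (P n) (\<lambda>G. ln (partition_fn \<psi> \<psi>b n G)) / real n"

definition Delta :: "(bool \<Rightarrow> real) set" where
  "Delta = {h. (\<forall>s. h s \<ge> 0) \<and> h True + h False = 1}"

definition BP :: "(bool \<Rightarrow> bool \<Rightarrow> real) \<Rightarrow> (bool \<Rightarrow> real) \<Rightarrow> nat \<Rightarrow> (bool \<Rightarrow> real) \<Rightarrow> (bool \<Rightarrow> real)" where
  "BP \<psi> \<psi>b d h = (\<lambda>s. \<psi>b s * (\<Sum>s'\<in>UNIV. \<psi> s s' * h s') ^ (d - 1) /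
      (\<Sum>r\<in>UNIV. \<psi>b r * (\<Sum>s'\<in>UNIV. \<psi> r s' * h s') ^ (d - 1)))"

definition Phi1 :: "(bool \<Rightarrow> bool \<Rightarrow> real) \<Rightarrow> (bool \<Rightarrow> real) \<Rightarrow> nat \<Rightarrow> (bool \<Rightarrow> real) \<Rightarrow> real" where
  "Phi1 \<psi> \<psi>b d h =
     ln (\<Sum>s\<in>UNIV. \<psi>b s * (\<Sum>s'\<in>UNIV. \<psi> s s' * h s') ^ d)
     - real d / 2 * ln (\<Sum>s\<in>UNIV. \<Sum>s'\<in>UNIV. h s * \<psi> s s' * h s')"

definition Phi2 :: "(bool \<Rightarrow> bool \<Rightarrow> real) \<Rightarrow> (bool \<Rightarrow> real) \<Rightarrow> nat \<Rightarrow> (bool \<Rightarrow> real) \<Rightarrow> (bool \<Rightarrow> real) \<Rightarrow> real" where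
  "Phi2 \<psi> \<psi>b d hp hm =
     ln (\<Sum>s\<in>UNIV. \<psi>b s * (\<Sum>s'\<in>UNIV. \<psi> s s' * hm s') ^ d) / 2
     + ln (\<Sum>s\<in>UNIV. \<psi>b s * (\<Sum>s'\<in>UNIV. \<psi> s s' * hp s') ^ d) / 2
     - real d / 2 * ln (\<Sum>s\<in>UNIV. \<Sum>s'\<in>UNIV. hp s * \<psi> s s' * hm s')"

definition fixed_points :: "(bool \<Rightarrow> bool \<Rightarrow> real) \<Rightarrow> (bool \<Rightarrow> real) \<Rightarrow> nat \<Rightarrow> (bool \<Rightarrow> real) set" where
  "fixed_points \<psi> \<psi>b d = {h\<in>Delta. BP \<psi> \<psi>b d h = h}"

definition fixed_pairs :: "(bool \<Rightarrow> bool \<Rightarrow> real) \<Rightarrow> (bool \<Rightarrow> real) \<Rightarrow> nat \<Rightarrow> ((bool \<Rightarrow> real) \<times> (bool \<Rightarrow> real)) set" where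
  "fixed_pairs \<psi> \<psi>b d = {(hp, hm). hp \<in> Delta \<and> hm \<in> Delta \<and> hp = BP \<psi> \<psi>b d hm \<and> hm = BP \<psi> \<psi>b d hp}"

definition Phi_T :: "(bool \<Rightarrow> bool \<Rightarrow> real) \<Rightarrow> (bool \<Rightarrow> real) \<Rightarrow> nat \<Rightarrow> real" where
  "Phi_T \<psi> \<psi>b d = Sup (Phi1 \<psi> \<psi>b d ` fixed_points \<psi> \<psi>b d)"

definition Phi_Tpm :: "(bool \<Rightarrow> bool \<Rightarrow> real) \<Rightarrow> (bool \<Rightarrow> real) \<Rightarrow> nat \<Rightarrow> real" where
  "Phi_Tpm \<psi> \<psi>b d = Sup ((\<lambda>(hp, hm). Phi2 \<psi> \<psi>b d hp hm) ` fixed_pairs \<psi> \<psi>b d)"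

end

theory Submission
  imports Defs
begin

text \<open>
  Every non-degenerate two-spin matrix can be written as
  \<open>\<psi> s s' = w s * w s' * (1 + T * \<zeta> s * \<zeta> s')\<close> with \<open>T \<ge> 0\<close>; in the anti-ferromagnetic case the
  gauge \<open>(w, \<zeta>)\<close> depends on the colour of the vertex. Replace \<open>T\<close> by \<open>t\<close> and let \<open>t\<close> run from
  \<open>0\<close>, where the vertices are independent, to \<open>T\<close>. Each edge contributes
  \<open>z * z' / (1 + t * z * z')\<close> to the derivative of \<open>ln Z\<close>, where \<open>z\<close> and \<open>z'\<close> are the messages across the
  edge. As the balls are trees, messages are sandwiched between those produced by extremal boundary conditions.

  Lower bound: in the gauge at the extremal fixed point (pair) the endpoint \<open>t = 0\<close> already gives the
  claimed value, and all limiting messages are nonpositive, so the derivative is asymptotically nonnegative.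

  Upper bound: in the symmetric (Ising) gauge for ferromagnets, and in the gauge at the symmetric fixed
  point for anti-ferromagnets, the product of the two messages on an edge is at most the product of the
  extremal ones. The Bethe functional on the extremal branch grows at least at the corresponding rate,
  because the two-step recursion has no unstable fixed point between \<open>0\<close> and the extremal one:
  the multiplier of a nontrivial two-cycle is below \<open>1\<close>, an instance of
  \<open>D * sinh s < sinh (D * s)\<close>.
\<close>

section \<open>The message recursion in a gauge\<close>

text \<open>In the gauge at a fixed pair the recursion fixes the coordinates \<open>(0, 0)\<close>
  for every \<open>t\<close>, and the Bethe functional there does not depend on \<open>t\<close>.
  This is why the independent model at \<open>t = 0\<close> already knows the value at
  \<open>T\<close>. That gauge gives no upper bound: the other messages lie on its negative side,
  and two negative messages have a positive product that the favoured side does not control. A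
  symmetric gauge controls both signs at once, but there the value at \<open>T\<close> has to be
  followed along a moving branch. The specification may contain a zero (the hard-core model), so
  factors \<open>1 + t * z * z'\<close> can vanish and weights cannot be compared configuration by
  configuration. Some spin is compatible with both spins, and resetting a vertex to it bounds every
  local change of the graph by a constant factor. The edge estimates are stated as linear
  inequalities between \<open>Z\<close> and its derivative, since these can be summed over boundary
  spins. Uniform sparsity controls the vertices whose balls are not trees: cutting one off changes
  \<open>ln Z\<close> by at most a multiple of its degree plus one.\<close>

lemma weighted_mean_mono:
  fixes a g P Q P' Q' :: real
  assumes "0 \<le> P" "P \<le> P'" "0 \<le> Q'" "Q' \<le> Q" "P + Q > 0" "P' + Q' > 0" "a + g \<ge> 0"
  shows "(a * P - g * Q) / (P + Q) \<le> (a * P' - g * Q') / (P' + Q')"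
proof -
  have "P * Q' \<le> P' * Q" using assms by (intro mult_mono) auto
  hence "(a + g) * (P * Q') \<le> (a + g) * (P' * Q)" using assms by (intro mult_left_mono) auto
  hence "(a * P - g * Q) * (P' + Q') \<le> (a * P' - g * Q') * (P + Q)" by (simp add: algebra_simps)
  thus ?thesis using assms by (simp add: divide_le_eq pos_le_divide_eq field_simps)
qed

text \<open>\<open>c\<close> is the colour of a vertex; \<open>a c\<close> and \<open>- g c\<close> are the coordinates of its favoured and of its other spin,
  and \<open>p c\<close>, \<open>q c\<close> are the vertex weights of these spins.\<close>

locale gauge =
  fixes d :: nat and T :: real and a g p q :: "bool \<Rightarrow> real"
  assumes d3: "d \<ge> 3" and T0: "T \<ge> 0"
    and a0: "\<And>c. a c > 0" and g0: "\<And>c. g c > 0"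
    and p0: "\<And>c. p c > 0" and q0: "\<And>c. q c > 0"
    and Tag: "\<And>c. T * a c * g (\<not> c) \<le> 1"
begin

definition den :: "bool \<Rightarrow> real \<Rightarrow> real" where
  "den c y = p c * (1 + a c * y) ^ (d - 1) + q c * (1 - g c * y) ^ (d - 1)"

text \<open>Belief propagation in one real coordinate: the mean of the spin coordinate at a vertex
  of colour \<open>c\<close> that receives \<open>d - 1\<close> messages of coordinate
  \<open>z\<close>, where \<open>y = t * z\<close>. The interpolation parameter enters only through
  this product.\<close>

definition A :: "bool \<Rightarrow> real \<Rightarrow> real" where
  "A c y = (a c * (p c * (1 + a c * y) ^ (d - 1)) - g c * (q c * (1 - g c * y) ^ (d - 1))) / den c y"

definition L :: "bool \<Rightarrow> real \<Rightarrow> real" where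
  "L c y = ln (p c * (1 + a c * y) ^ d + q c * (1 - g c * y) ^ d)"

text \<open>The inequalities are weak, since a zero of the specification makes one of the factors
  vanish.\<close>

definition adm :: "bool \<Rightarrow> real \<Rightarrow> bool" where
  "adm c y \<longleftrightarrow> 0 \<le> 1 + a c * y \<and> 0 \<le> 1 - g c * y"

lemma Tga: "T * g c * a (\<not> c) \<le> 1"
  using Tag[of "\<not> c"] by (simp add: mult.commute mult.left_commute)

lemma adm_box:
  assumes "0 \<le> t" "t \<le> T" "- g (\<not> c) \<le> z" "z \<le> a (\<not> c)"
  shows "adm c (t * z)"
proof -
  have g: "g (\<not> c) > 0" "a (\<not> c) > 0" "a c > 0" "g c > 0" using a0 g0 by auto
  have "t * a c * (- z) \<le> T * a c * g (\<not> c)"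
  proof (cases "z \<le> 0")
    case True thus ?thesis using assms g T0 by (intro mult_mono) auto
  next
    case False
    hence "t * a c * (- z) \<le> 0" using assms g by (auto simp: mult_nonneg_nonpos)
    also have "0 \<le> T * a c * g (\<not> c)" using T0 g by simp
    finally show ?thesis .
  qed
  hence 1: "0 \<le> 1 + a c * (t * z)" using Tag[of c] by (simp add: algebra_simps)
  have "t * g c * z \<le> T * g c * a (\<not> c)"
  proof (cases "z \<ge> 0")
    case True thus ?thesis using assms g T0 by (intro mult_mono) auto
  next
    case False
    hence "t * g c * z \<le> 0" using assms g by (auto simp: mult_nonneg_nonpos)
    also have "0 \<le> T * g c * a (\<not> c)" using T0 g by simp
    finally show ?thesis .
  qed
  hence "0 \<le> 1 - g c * (t * z)" using Tga[of c] by (simp add: algebra_simps)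
  thus ?thesis using 1 by (simp add: adm_def)
qed

text \<open>The two factors cannot vanish together: one zero requires \<open>y < 0\<close> and the
  other \<open>y > 0\<close>.\<close>

lemma powsum_pos:
  assumes "adm c y" shows "p c * (1 + a c * y) ^ n + q c * (1 - g c * y) ^ n > 0"
proof -
  have "1 + a c * y > 0 \<or> 1 - g c * y > 0"
  proof (rule ccontr)
    assume "\<not> ?thesis"
    hence "a c * y \<le> -1" "g c * y \<ge> 1" by auto
    hence "y < 0" "y > 0" using a0[of c] g0[of c]
      by (metis mult_nonneg_nonneg less_eq_real_def not_le neg_less_0_iff_less zero_less_one order.strict_trans2)
         (metis \<open>1 \<le> g c * y\<close> g0 less_le_trans zero_less_mult_pos zero_less_one)
    thus False by simp
  qed
  thus ?thesis using assms p0[of c] q0[of c] unfolding adm_def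
    by (metis add_nonneg_pos add_pos_nonneg mult_pos_pos mult_nonneg_nonneg zero_le_power zero_less_power less_imp_le)
qed

lemma den_pos: "adm c y \<Longrightarrow> den c y > 0"
  unfolding den_def by (rule powsum_pos)

lemma A_le: assumes "adm c y" shows "A c y \<le> a c"
proof -
  have "g c * (q c * (1 - g c * y) ^ (d - 1)) \<ge> 0" "a c * (q c * (1 - g c * y) ^ (d - 1)) \<ge> 0"
    using assms a0[of c] g0[of c] q0[of c] by (auto simp: adm_def)
  thus ?thesis using den_pos[OF assms] unfolding A_def by (simp add: divide_le_eq den_def algebra_simps)
qed

lemma A_ge: assumes "adm c y" shows "- g c \<le> A c y"
proof -
  have "a c * (p c * (1 + a c * y) ^ (d - 1)) \<ge> 0" "g c * (p c * (1 + a c * y) ^ (d - 1)) \<ge> 0"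
    using assms a0[of c] g0[of c] p0[of c] by (auto simp: adm_def)
  thus ?thesis using den_pos[OF assms] unfolding A_def by (simp add: le_divide_eq den_def algebra_simps)
qed

text \<open>\<open>A c y\<close> is a weighted mean of \<open>a c\<close> and \<open>- g c\<close>,
  and the ratio of the two weights grows with \<open>y\<close>.\<close>

lemma A_mono: assumes "adm c y" "adm c y'" "y \<le> y'" shows "A c y \<le> A c y'"
  unfolding A_def den_def
proof (rule weighted_mean_mono)
  show "p c * (1 + a c * y) ^ (d - 1) + q c * (1 - g c * y) ^ (d - 1) > 0"
       "p c * (1 + a c * y') ^ (d - 1) + q c * (1 - g c * y') ^ (d - 1) > 0"
    using powsum_pos assms by auto
qed (use assms a0[of c] g0[of c] p0[of c] q0[of c] in \<open>auto simp: adm_def intro!: power_mono\<close>)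

text \<open>One of the \<open>d\<close> factors is split off: \<open>d\<close> messages meeting at a
  vertex are \<open>d - 1\<close> messages that produce an outgoing one, followed by one edge. This
  makes the derivative of \<open>L\<close> an edge term.\<close>

lemma L_arg_eq:
  assumes "adm c y"
  shows "p c * (1 + a c * y) ^ d + q c * (1 - g c * y) ^ d = den c y * (1 + y * A c y)"
proof -
  have d: "d = Suc (d - 1)" using d3 by simp
  have "den c y * (1 + y * A c y) = den c y + y * (A c y * den c y)" by (simp add: algebra_simps)
  also have "A c y * den c y = a c * (p c * (1 + a c * y) ^ (d - 1)) - g c * (q c * (1 - g c * y) ^ (d - 1))"
    using den_pos[OF assms] by (simp add: A_def)
  also have "den c y + y * \<dots> = p c * (1 + a c * y) ^ Suc (d - 1) + q c * (1 - g c * y) ^ Suc (d - 1)"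
    by (simp add: den_def algebra_simps)
  finally show ?thesis using d by metis
qed

lemma one_plus_A_pos: assumes "adm c y" shows "1 + y * A c y > 0"
  using L_arg_eq[OF assms] powsum_pos[OF assms, of d] den_pos[OF assms] by (simp add: zero_less_mult_iff)

lemma L_deriv: assumes "adm c y"
  shows "(L c has_real_derivative real d * A c y / (1 + y * A c y)) (at y)"
proof -
  have 1: "real d * A c y / (1 + y * A c y)
     = (p c * (real d * (1 + a c * y) ^ (d - 1) * a c) - q c * (real d * (1 - g c * y) ^ (d - 1) * g c))
       / (p c * (1 + a c * y) ^ d + q c * (1 - g c * y) ^ d)"
    unfolding L_arg_eq[OF assms] using den_pos[OF assms] one_plus_A_pos[OF assms]
    by (simp add: A_def field_simps)
  show ?thesis unfolding L_def 1
    by (rule derivative_eq_intros refl powsum_pos[OF assms] | simp add: field_simps)+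
qed

lemma A_deriv: assumes "adm c y"
  shows "(A c has_real_derivative
     real (d - 1) * (a c + g c)\<^sup>2 * (p c * q c) * ((1 + a c * y) * (1 - g c * y)) ^ (d - 2) / (den c y)\<^sup>2) (at y)"
proof -
  obtain m where m: "d - 1 = Suc m" "d - 2 = m" using d3 by (metis Suc_diff_le Suc_1 diff_Suc_Suc
     One_nat_def add_2_eq_Suc le_add_diff_inverse numeral_3_eq_3 plus_nat.simps(2) diff_Suc_1 Suc_le_mono)
  have dp: "p c * (1 + a c * y) ^ Suc m + q c * (1 - g c * y) ^ Suc m \<noteq> 0"
    using den_pos[OF assms] unfolding den_def m by simp
  define X Y where "X = (1 + a c * y) ^ m" and "Y = (1 - g c * y) ^ m"
  \<comment> \<open>In the quotient rule the terms with equal weights cancel. The mixed terms in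
    \<open>p c * q c\<close> add up to a single product, and this makes the multiplier of a cycle
    computable.\<close>
  have alg: "(a c * (p c * ((1 + real m) * a c * X)) + g c * (q c * ((1 + real m) * g c * Y)))
        * (p c * ((1 + a c * y) * X) + q c * ((1 - g c * y) * Y))
      - (a c * (p c * ((1 + a c * y) * X)) - g c * (q c * ((1 - g c * y) * Y)))
        * (p c * ((1 + real m) * a c * X) - q c * ((1 + real m) * g c * Y))
      = (1 + real m) * (a c + g c)\<^sup>2 * (p c * q c) * (X * Y)"
    by algebra
  have d1: "((\<lambda>y. (1 + a c * y) ^ Suc m) has_real_derivative (1 + real m) * a c * X) (at y)"
    unfolding X_def by (rule derivative_eq_intros refl | simp)+
  have d2: "((\<lambda>y. (1 - g c * y) ^ Suc m) has_real_derivative - ((1 + real m) * g c * Y)) (at y)"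
    unfolding Y_def by (rule derivative_eq_intros refl | simp)+
  have n: "((\<lambda>y. a c * (p c * (1 + a c * y) ^ Suc m) - g c * (q c * (1 - g c * y) ^ Suc m)) has_real_derivative
      a c * (p c * ((1 + real m) * a c * X)) + g c * (q c * ((1 + real m) * g c * Y))) (at y)"
    using DERIV_diff[OF DERIV_cmult[OF DERIV_cmult[OF d1, of "p c"], of "a c"] DERIV_cmult[OF DERIV_cmult[OF d2, of "q c"], of "g c"]]
    by simp
  have e: "((\<lambda>y. p c * (1 + a c * y) ^ Suc m + q c * (1 - g c * y) ^ Suc m) has_real_derivative
      p c * ((1 + real m) * a c * X) - q c * ((1 + real m) * g c * Y)) (at y)"
    using DERIV_add[OF DERIV_cmult[OF d1, of "p c"] DERIV_cmult[OF d2, of "q c"]] by simp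
  have "(A c has_real_derivative
     (1 + real m) * (a c + g c)\<^sup>2 * (p c * q c) * (X * Y) / (den c y)\<^sup>2) (at y)"
    unfolding A_def den_def m alg[symmetric]
    using DERIV_divide[OF n e dp] by (simp add: X_def Y_def power2_eq_square)
  moreover have "1 + real m = real (d - 1)" using m(1) by simp
  ultimately show ?thesis unfolding m(2) X_def Y_def power_mult_distrib by metis
qed

end

text \<open>Division by \<open>s ^ (n + 2)\<close> and \<open>s = exp x\<close> turn this into
  \<open>D * sinh x < sinh (D * x)\<close> with \<open>D = n + 2\<close>. In the applications
  \<open>D = d - 1\<close>, which is at least 2.\<close>

lemma times_pow_diff_less:
  fixes s :: real
  assumes "s > 1"
  shows "real (n + 2) * (s\<^sup>2 - 1) * s ^ (n + 1) < s ^ (2 * (n + 2)) - 1"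
proof (induction n)
  case 0
  have "s ^ 4 - 1 - 2 * (s\<^sup>2 - 1) * s = (s\<^sup>2 - 1) * (s - 1)\<^sup>2"
    by (simp add: power2_eq_square power4_eq_xxxx algebra_simps)
  moreover have "(s\<^sup>2 - 1) * (s - 1)\<^sup>2 > 0" using assms by (simp add: one_less_power)
  ultimately show ?case by simp
next
  case (Suc n)
  have s2: "s\<^sup>2 - 1 > 0" using assms by (simp add: one_less_power)
  \<comment> \<open>Weighted means: \<open>s ^ (n + 2)\<close> is the geometric mean of
    \<open>s ^ (n + 3)\<close> and \<open>1\<close> with weights proportional to
    \<open>n + 2\<close> and \<open>1\<close>. Bernoulli's inequality is applied to
    \<open>1 / s\<close>.\<close>
  have bern: "real (n + 3) * s ^ (n + 2) \<le> real (n + 2) * s ^ (n + 3) + 1"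
  proof -
    have "1 + real (n + 2) * (1 / s - 1) \<le> (1 + (1 / s - 1)) ^ (n + 2)"
      using assms by (intro Bernoulli_inequality) (simp add: field_simps)
    hence "s ^ (n + 2) * (1 + real (n + 2) * (1 / s - 1)) \<le> s ^ (n + 2) * (1 / s) ^ (n + 2)"
      using assms by (intro mult_left_mono) auto
    also have "\<dots> = 1" using assms by (simp add: power_divide)
    finally have b: "s ^ (n + 2) * (1 + real (n + 2) * (1 / s - 1)) \<le> 1" .
    have "1 + real (n + 2) * (1 - s) \<le> 1 + real (n + 2) * (1 / s - 1)"
    proof -
      have "1 / s - 1 - (1 - s) = (s - 1)\<^sup>2 / s" using assms by (simp add: field_simps power2_eq_square)
      also have "\<dots> \<ge> 0" using assms by simp
      finally have "1 - s \<le> 1 / s - 1" by simp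
      hence "real (n + 2) * (1 - s) \<le> real (n + 2) * (1 / s - 1)" by (intro mult_left_mono) auto
      thus ?thesis by simp
    qed
    hence "s ^ (n + 2) * (1 + real (n + 2) * (1 - s)) \<le> s ^ (n + 2) * (1 + real (n + 2) * (1 / s - 1))"
      using assms by (intro mult_left_mono) auto
    with b have "s ^ (n + 2) * (1 + real (n + 2) * (1 - s)) \<le> 1" by linarith
    thus ?thesis by (simp add: algebra_simps eval_nat_numeral)
  qed
  have "real (n + 3) * (s\<^sup>2 - 1) * s ^ (n + 2) = (s\<^sup>2 - 1) * (real (n + 3) * s ^ (n + 2))" by simp
  also have "\<dots> \<le> (s\<^sup>2 - 1) * (real (n + 2) * s ^ (n + 3) + 1)"
    using bern s2 by (intro mult_left_mono) auto
  also have "\<dots> = s\<^sup>2 * (real (n + 2) * (s\<^sup>2 - 1) * s ^ (n + 1)) + (s\<^sup>2 - 1)"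
    by (simp add: algebra_simps eval_nat_numeral)
  also have "\<dots> < s\<^sup>2 * (s ^ (2 * (n + 2)) - 1) + (s\<^sup>2 - 1)"
    using Suc assms by (intro add_strict_right_mono mult_strict_left_mono) auto
  also have "\<dots> = s ^ (2 * (n + 3)) - 1" by (simp add: algebra_simps eval_nat_numeral)
  finally show ?case by (simp only: numeral_3_eq_3 numeral_2_eq_2 add_Suc add_Suc_right add_0_right One_nat_def)
qed

lemma times_pow_diff_less_hom:
  fixes P Q :: real
  assumes "P > Q" "Q > 0"
  shows "real (n + 2) * (P\<^sup>2 - Q\<^sup>2) * (P * Q) ^ (n + 1) < P ^ (2 * (n + 2)) - Q ^ (2 * (n + 2))"
proof -
  define s where "s = P / Q"
  have s: "s > 1" "P = Q * s" using assms by (auto simp: s_def)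
  have lt: "Q ^ (2 * (n + 2)) * (real (n + 2) * (s\<^sup>2 - 1) * s ^ (n + 1)) < Q ^ (2 * (n + 2)) * (s ^ (2 * (n + 2)) - 1)"
    using times_pow_diff_less[OF s(1)] assms by (intro mult_strict_left_mono) auto
  have e1: "Q ^ (2 * (n + 2)) * (real (n + 2) * (s\<^sup>2 - 1) * s ^ (n + 1))
     = real (n + 2) * (P\<^sup>2 - Q\<^sup>2) * (P * Q) ^ (n + 1)"
  proof -
    have "2 * (n + 2) = 2 + (n + 1) + (n + 1)" by simp
    hence 1: "Q ^ (2 * (n + 2)) = Q\<^sup>2 * Q ^ (n + 1) * Q ^ (n + 1)" by (metis power_add)
    have 2: "(Q * s * Q) ^ (n + 1) = Q ^ (n + 1) * s ^ (n + 1) * Q ^ (n + 1)" by (simp only: power_mult_distrib)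
    have "Q\<^sup>2 * K * K * (N * (s\<^sup>2 - 1) * S) = N * ((Q * s)\<^sup>2 - Q\<^sup>2) * (K * S * K)" for K N S :: real
      by algebra
    thus ?thesis unfolding s(2) 1 2 .
  qed
  have e2: "Q ^ (2 * (n + 2)) * (s ^ (2 * (n + 2)) - 1) = P ^ (2 * (n + 2)) - Q ^ (2 * (n + 2))"
    unfolding s(2) power_mult_distrib right_diff_distrib mult_1_right ..
  show ?thesis using lt unfolding e1 e2 .
qed

text \<open>The multiplier of a two-cycle is a product of two slopes, so the inequality is needed in
  squared form. Applying it to \<open>sqrt X\<close> and \<open>sqrt Y\<close> turns the inner
  squares into \<open>X\<close> and \<open>Y\<close>.\<close>

lemma two_cycle_ineq:
  fixes X Y :: real
  assumes "X > Y" "Y > 0"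
  shows "(real (n + 2) * (X - Y))\<^sup>2 * (X * Y) ^ (n + 1) < (X ^ (n + 2) - Y ^ (n + 2))\<^sup>2"
proof -
  define P Q where "P = sqrt X" and "Q = sqrt Y"
  have PQ: "P > Q" "Q > 0" "X = P\<^sup>2" "Y = Q\<^sup>2" using assms by (auto simp: P_def Q_def)
  have e: "P ^ (2 * (n + 2)) = X ^ (n + 2)" "Q ^ (2 * (n + 2)) = Y ^ (n + 2)"
    unfolding PQ by (simp_all only: power_mult)
  have "(real (n + 2) * (P\<^sup>2 - Q\<^sup>2) * (P * Q) ^ (n + 1))\<^sup>2 < (P ^ (2 * (n + 2)) - Q ^ (2 * (n + 2)))\<^sup>2"
  proof (rule power_strict_mono[OF times_pow_diff_less_hom])
    show "0 \<le> real (n + 2) * (P\<^sup>2 - Q\<^sup>2) * (P * Q) ^ (n + 1)" using PQ assms by auto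
  qed (use PQ in auto)
  moreover have "(real (n + 2) * (P\<^sup>2 - Q\<^sup>2) * (P * Q) ^ (n + 1))\<^sup>2 = (real (n + 2) * (X - Y))\<^sup>2 * (X * Y) ^ (n + 1)"
    unfolding PQ by (simp add: power_mult_distrib power2_eq_square algebra_simps)
  ultimately show ?thesis unfolding e by simp
qed

text \<open>At each zero \<open>h\<close> crosses strictly downwards, and between two downward
  crossings there would have to be an upward one. The interval is open at \<open>0\<close> because
  the fixed point \<open>0\<close> itself may be unstable.\<close>

lemma nonneg_before_stable_zero:
  fixes h :: "real \<Rightarrow> real"
  assumes der: "\<And>x. 0 < x \<Longrightarrow> x \<le> b \<Longrightarrow> (h has_real_derivative h' x) (at x)"
    and stable: "\<And>x. 0 < x \<Longrightarrow> x \<le> b \<Longrightarrow> h x = 0 \<Longrightarrow> h' x < 0"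
    and b: "h b = 0" and x: "0 < x" "x \<le> b"
  shows "h x \<ge> 0"
proof (rule ccontr)
  assume neg: "\<not> h x \<ge> 0"
  hence "x < b" using b x by (cases "x = b") auto
  have "b > 0" using x by simp
  then obtain e where e: "e > 0" "\<And>k. k > 0 \<Longrightarrow> k < e \<Longrightarrow> h b < h (b - k)"
    using has_real_derivative_neg_dec_left[OF der[of b], of ] stable[of b] b by auto
  define k where "k = min (e / 2) ((b - x) / 2)"
  have k: "k > 0" "k < e" "k < b - x" using e(1) \<open>x < b\<close> by (auto simp: k_def min_less_iff_disj)
  \<comment> \<open>A point to the right of \<open>x\<close> where \<open>h\<close> is positive; it
    exists because \<open>h\<close> has negative slope at its zero \<open>b\<close>.\<close>
  define y where "y = b - k"
  have y: "x < y" "y \<le> b" "h y > 0" using e(2)[OF k(1,2)] k b by (auto simp: y_def)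
  have cont: "continuous_on {x..y} h"
    using x y by (intro continuous_at_imp_continuous_on ballI DERIV_isCont[OF der]) auto
  have "closed ({x..y} \<inter> h -` {..0})"
    by (rule continuous_closed_preimage[OF cont]) auto
  hence "compact ({x..y} \<inter> h -` {..0})"
    by (metis compact_Icc compact_Int_closed Int_absorb Int_assoc)
  moreover have "x \<in> {x..y} \<inter> h -` {..0}" using neg y by auto
  \<comment> \<open>\<open>m\<close> is the last point of \<open>{x..y}\<close> where
    \<open>h\<close> is nonpositive. It is a zero, and the negative slope there produces a later
    such point.\<close>
  ultimately obtain m where m: "m \<in> {x..y}" "h m \<le> 0"
    and mx: "\<And>u. u \<in> {x..y} \<Longrightarrow> h u \<le> 0 \<Longrightarrow> u \<le> m"
    using compact_attains_sup[of "{x..y} \<inter> h -` {..0}"] by fastforce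
  have "\<exists>u. m \<le> u \<and> u \<le> y \<and> h u = 0"
    using m y cont by (intro IVT') (auto intro: continuous_on_subset)
  then obtain u where "m \<le> u" "u \<le> y" "h u = 0" by auto
  with mx[of u] m have hm: "h m = 0" by (cases "u = m") auto
  have "m < y" using y hm m by (cases "m = y") auto
  obtain e' where e': "e' > 0" "\<And>k. k > 0 \<Longrightarrow> k < e' \<Longrightarrow> h (m + k) < h m"
    using has_real_derivative_neg_dec_right[OF der[of m]] stable[of m] hm m x y by auto
  define j where "j = min (e' / 2) (y - m)"
  have j: "j > 0" "j < e'" "j \<le> y - m" using e'(1) \<open>m < y\<close> by (auto simp: j_def)
  have "m + j \<le> m" using e'(2)[OF j(1,2)] hm m j by (intro mx) auto
  with j show False by simp
qed

section \<open>The Bethe functional along the extremal branch\<close>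

text \<open>\<open>x / (1 + t * x)\<close> is the contribution of an edge on which the product of
  the messages is \<open>x\<close>. Both the product and the parameter can thus be replaced by their
  extreme values on an interval.\<close>

lemma mobius_mono:
  fixes x x' t t' :: real
  assumes "0 \<le> x" "x \<le> x'" "0 \<le> t'" "t' \<le> t"
  shows "x / (1 + t * x) \<le> x' / (1 + t' * x')"
proof -
  have "t' * (x * x') \<le> t * (x * x')" using assms by (intro mult_right_mono) auto
  hence "x * (1 + t' * x') \<le> x' * (1 + t * x)" using assms by (simp add: algebra_simps)
  moreover have "1 + t * x > 0" "1 + t' * x' > 0" using assms by (simp_all add: add_pos_nonneg)
  ultimately show ?thesis by (simp add: pos_divide_le_eq pos_le_divide_eq mult.commute)
qed

text \<open>The assumption says exactly that \<open>A c 0 \<ge> 0\<close>. It makes the nonnegative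
  coordinates invariant under the recursion.\<close>

locale pos_gauge = gauge +
  assumes gq_ap: "\<And>c. g c * q c \<le> a c * p c"
begin

lemma adm_0: "adm c 0" by (simp add: adm_def)

lemma A_0: "A c 0 \<ge> 0"
  using gq_ap[of c] p0[of c] q0[of c] by (simp add: A_def den_def)

lemma A_nonneg: "adm c y \<Longrightarrow> y \<ge> 0 \<Longrightarrow> A c y \<ge> 0"
  using A_mono[OF adm_0, of c y] A_0[of c] by linarith

text \<open>The messages at height \<open>k\<close> above the leaves of a tree all of whose leaves carry the favoured spin.\<close>

primrec U :: "real \<Rightarrow> nat \<Rightarrow> bool \<Rightarrow> real" where
  "U t 0 c = a c"
| "U t (Suc k) c = A c (t * U t k (\<not> c))"

lemma adm_nonneg:
  assumes "0 \<le> t" "t \<le> T" "0 \<le> z" "z \<le> a (\<not> c)"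
  shows "adm c (t * z)"
proof (rule adm_box[OF assms(1,2)])
  show "- g (\<not> c) \<le> z" using g0[of "\<not> c"] assms(3) by linarith
qed (rule assms(4))

lemma U_box:
  assumes "0 \<le> t" "t \<le> T"
  shows "0 \<le> U t k c \<and> U t k c \<le> a c"
proof (induction k arbitrary: c)
  case 0 show ?case using a0[of c] by simp
next
  case (Suc k)
  have "adm c (t * U t k (\<not> c))" using Suc assms by (intro adm_nonneg) auto
  thus ?case using Suc[of "\<not> c"] assms A_nonneg A_le by simp
qed

lemma U_adm: assumes "0 \<le> t" "t \<le> T" shows "adm c (t * U t k (\<not> c))"
  using U_box[OF assms] assms by (intro adm_nonneg) auto

lemma U_antimono: assumes t: "0 \<le> t" "t \<le> T" shows "U t (Suc k) c \<le> U t k c"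
proof (induction k arbitrary: c)
  case 0 show ?case using A_le U_adm[OF t, of c 0] by simp
next
  case (Suc k)
  have "A c (t * U t (Suc k) (\<not> c)) \<le> A c (t * U t k (\<not> c))"
    using Suc[of "\<not> c"] t by (intro A_mono U_adm mult_left_mono)
  thus ?case by simp
qed

lemma U_mono_t: assumes t: "0 \<le> t" "t \<le> t'" "t' \<le> T" shows "U t k c \<le> U t' k c"
proof (induction k arbitrary: c)
  case 0 show ?case by simp
next
  case (Suc k)
  have "t * U t k (\<not> c) \<le> t' * U t' k (\<not> c)"
    using Suc t U_box[of t k "\<not> c"] by (intro mult_mono) auto
  hence "A c (t * U t k (\<not> c)) \<le> A c (t' * U t' k (\<not> c))"
    using t by (intro A_mono U_adm) auto
  thus ?case by simp
qed

definition Ulim :: "real \<Rightarrow> bool \<Rightarrow> real" where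
  "Ulim t c = (INF k. U t k c)"

lemma U_tendsto: assumes t: "0 \<le> t" "t \<le> T" shows "(\<lambda>k. U t k c) \<longlonglongrightarrow> Ulim t c"
  unfolding Ulim_def
proof (rule LIMSEQ_decseq_INF)
  show "bdd_below (range (\<lambda>k. U t k c))" using U_box[OF t] by (auto intro!: bdd_belowI[where m=0])
  show "decseq (\<lambda>k. U t k c)" using U_antimono[OF t] by (auto simp: decseq_Suc_iff)
qed

lemma Ulim_box: assumes t: "0 \<le> t" "t \<le> T" shows "0 \<le> Ulim t c" "Ulim t c \<le> a c"
  using LIMSEQ_le_const[OF U_tendsto[OF t], of 0 c] LIMSEQ_le_const2[OF U_tendsto[OF t], of c "a c"] U_box[OF t]
  by auto

lemma Ulim_adm: assumes "0 \<le> t" "t \<le> T" shows "adm c (t * Ulim t (\<not> c))"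
  using Ulim_box[OF assms] assms by (intro adm_nonneg) auto

lemma A_isCont: "adm c y \<Longrightarrow> isCont (A c) y"
  by (rule DERIV_isCont[OF A_deriv])

lemma Ulim_fixed: assumes t: "0 \<le> t" "t \<le> T" shows "Ulim t c = A c (t * Ulim t (\<not> c))"
proof -
  have "(\<lambda>k. A c (t * U t k (\<not> c))) \<longlonglongrightarrow> A c (t * Ulim t (\<not> c))"
    by (intro isCont_tendsto_compose[OF A_isCont[OF Ulim_adm[OF t]]] tendsto_mult_left U_tendsto t)
  hence "(\<lambda>k. U t (Suc k) c) \<longlonglongrightarrow> A c (t * Ulim t (\<not> c))" by simp
  moreover have "(\<lambda>k. U t (Suc k) c) \<longlonglongrightarrow> Ulim t c" by (rule LIMSEQ_Suc[OF U_tendsto[OF t]])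
  ultimately show ?thesis by (rule LIMSEQ_unique[symmetric])
qed

lemma Ulim_mono: assumes t: "0 \<le> t" "t \<le> t'" "t' \<le> T" shows "Ulim t c \<le> Ulim t' c"
  using t by (intro LIMSEQ_le[OF U_tendsto U_tendsto]) (auto intro!: exI[of _ 0] U_mono_t)

text \<open>The iteration \<open>U\<close> starts at the largest coordinate, and monotonicity of the
  recursion keeps every fixed pair below it.\<close>

lemma Ulim_greatest:
  assumes t: "0 \<le> t" "t \<le> T"
    and z: "\<And>c. z c = A c (t * z (\<not> c))" "\<And>c. - g c \<le> z c" "\<And>c. z c \<le> a c"
  shows "z c \<le> Ulim t c"
proof -
  have "z c \<le> U t k c" for k
  proof (induction k arbitrary: c)
    case 0 show ?case using z(3) by simp
  next
    case (Suc k)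
    have "A c (t * z (\<not> c)) \<le> A c (t * U t k (\<not> c))"
      using Suc[of "\<not> c"] t z(2,3) by (intro A_mono U_adm adm_box mult_left_mono)
    thus ?case unfolding U.simps z(1)[of c, symmetric] .
  qed
  thus ?thesis by (intro LIMSEQ_le_const[OF U_tendsto[OF t]]) auto
qed

text \<open>\<open>Phi2\<close> in gauge coordinates and at parameter \<open>t\<close>. The gauge
  weights have cancelled, as \<open>Bethe_functional\<close> shows.\<close>

definition Phi :: "real \<Rightarrow> real \<Rightarrow> real \<Rightarrow> real" where
  "Phi t z z' = L True (t * z') / 2 + L False (t * z) / 2 - real d / 2 * ln (1 + t * z * z')"

text \<open>The Bethe functional with one of the two stationarity equations already solved.\<close>

definition phi :: "real \<Rightarrow> real \<Rightarrow> real" where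
  "phi t x = L True (t * A False x) / 2 + L False x / 2 - real d / 2 * ln (1 + x * A False x)"

text \<open>The variable is \<open>x = t * z\<close>. The property says that no barrier separates
  \<open>0\<close> from the extremal fixed point, and it makes \<open>phi\<close> monotone on the
  way there.\<close>

definition expanding :: "real \<Rightarrow> bool" where
  "expanding t \<longleftrightarrow> (\<forall>x. 0 < x \<and> x \<le> t * Ulim t True \<longrightarrow> x \<le> t * A True (t * A False x))"

lemma adm_between:
  assumes "adm c y" "0 \<le> x" "x \<le> y" shows "adm c x"
proof -
  have "g c * x \<le> g c * y" using assms g0[of c] by (intro mult_left_mono) auto
  moreover have "a c * x \<ge> 0" using assms a0[of c] by simp
  ultimately show ?thesis using assms(1) unfolding adm_def by linarith
qed

text \<open>Since \<open>b = A False y\<close> is the exact answer to \<open>y\<close>, the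
  derivative of \<open>phi\<close> at \<open>y\<close> is a nonnegative multiple of
  \<open>s / (1 + s * b) - y / (1 + y * b)\<close>, where \<open>s\<close> is the image of
  \<open>y\<close> under two steps of the recursion. Its sign is given by
  \<open>expanding\<close>.\<close>

lemma phi_mono:
  assumes t: "0 \<le> t" "t \<le> T" and st: "expanding t"
    and x: "0 \<le> x" "x \<le> x'" "x' \<le> t * Ulim t True"
  shows "phi t x \<le> phi t x'"
proof (rule DERIV_nonneg_imp_increasing_open[OF x(2)])
  have admx: "adm False y" if "0 \<le> y" "y \<le> x'" for y
    using adm_between[OF Ulim_adm[OF t, of False], of y] that x by simp
  have admA: "adm True (t * A False y)" if "0 \<le> y" "y \<le> x'" for y
    using A_le[OF admx[OF that]] A_nonneg[OF admx[OF that] that(1)] t by (intro adm_nonneg) auto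
  have der: "\<exists>D. (phi t has_real_derivative D) (at y) \<and> (0 < y \<longrightarrow> 0 \<le> D)" if y: "0 \<le> y" "y \<le> x'" for y
  proof -
    obtain A' where A': "(A False has_real_derivative A') (at y)" "A' \<ge> 0"
    proof (rule that[OF A_deriv[OF admx[OF y]]])
      show "0 \<le> real (d - 1) * (a False + g False)\<^sup>2 * (p False * q False) *
         ((1 + a False * y) * (1 - g False * y)) ^ (d - 2) / (den False y)\<^sup>2"
        using admx[OF y] p0[of False] q0[of False] by (auto simp: adm_def)
    qed
    define b where "b = A False y"
    define s where "s = t * A True (t * b)"
    have b: "b \<ge> 0" using A_nonneg[OF admx[OF y] y(1)] by (simp add: b_def)
    have s0: "s \<ge> 0" using A_nonneg[OF admA[OF y]] b t by (simp add: s_def b_def)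
    have d1: "((\<lambda>x. L True (t * A False x)) has_real_derivative real d * A True (t * b) / (1 + t * b * A True (t * b)) * (t * A')) (at y)"
      unfolding b_def
      by (rule DERIV_chain2[where f = "L True", OF L_deriv[OF admA[OF y]] DERIV_cmult[OF A'(1)]])
    have d2: "(L False has_real_derivative real d * b / (1 + y * b)) (at y)"
      unfolding b_def by (rule L_deriv[OF admx[OF y]])
    have pos: "1 + y * b > 0" using y b by (simp add: add_pos_nonneg)
    have d3': "((\<lambda>x. ln (1 + x * A False x)) has_real_derivative (b + y * A') / (1 + y * b)) (at y)"
      using pos A' unfolding b_def by (auto intro!: derivative_eq_intros)
    have "(phi t has_real_derivative
        real d * A True (t * b) / (1 + t * b * A True (t * b)) * (t * A') / 2 + real d * b / (1 + y * b) / 2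
        - real d / 2 * ((b + y * A') / (1 + y * b))) (at y)"
      unfolding phi_def by (intro DERIV_diff DERIV_add DERIV_cdivide DERIV_cmult d1 d2 d3')
    also have "real d * A True (t * b) / (1 + t * b * A True (t * b)) * (t * A') / 2 = real d / 2 * A' * (s / (1 + s * b))"
    proof -
      have "1 + t * b * A True (t * b) = 1 + s * b" by (simp add: s_def mult.commute mult.left_commute)
      moreover have "real d * K / M * (t * A') / 2 = real d / 2 * A' * ((t * K) / M)" for K M by (simp add: mult_ac)
      ultimately show ?thesis unfolding s_def by metis
    qed
    also have "real d / 2 * A' * (s / (1 + s * b)) + real d * b / (1 + y * b) / 2 - real d / 2 * ((b + y * A') / (1 + y * b))
        = real d / 2 * A' * (s / (1 + s * b) - y / (1 + y * b))"
      by (simp add: algebra_simps add_divide_distrib)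
    finally have "(phi t has_real_derivative real d / 2 * A' * (s / (1 + s * b) - y / (1 + y * b))) (at y)" .
    moreover have "real d / 2 * A' * (s / (1 + s * b) - y / (1 + y * b)) \<ge> 0" if "y > 0"
    proof -
      have "y \<le> s" using st that y x unfolding expanding_def s_def b_def by auto
      hence "y / (1 + y * b) \<le> s / (1 + s * b)"
        using mobius_mono[of y s b b] y b by (simp add: mult.commute)
      thus ?thesis using A' by simp
    qed
    ultimately show ?thesis by blast
  qed
  show "\<exists>D. (phi t has_real_derivative D) (at y) \<and> 0 \<le> D" if "x < y" "y < x'" for y
    using der[of y] that x by auto
  show "continuous_on {x..x'} (phi t)"
  proof (intro continuous_at_imp_continuous_on ballI)
    fix y assume "y \<in> {x..x'}"
    thus "isCont (phi t) y" using der[of y] x by (auto intro: DERIV_isCont)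
  qed
qed

lemma phi_fixed:
  assumes "z = A True (t * z')" "z' = A False (t * z)"
  shows "phi t (t * z) = Phi t z z'"
  unfolding phi_def Phi_def assms(2)[symmetric] by (simp add: mult.assoc)

text \<open>The branch is compared at two parameters without differentiating \<open>Ulim\<close> in
  \<open>t\<close>. The point \<open>x = t1 * Ulim t1 True\<close> is kept fixed while the parameter
  changes, and \<open>phi_mono\<close> then moves \<open>x\<close> to the new extremal
  point.\<close>

lemma Phi_step:
  assumes t: "0 \<le> t1" "t1 \<le> t2" "t2 \<le> T" and st: "expanding t2"
  defines "P \<equiv> Ulim t1 True * Ulim t1 False"
  shows "Phi t2 (Ulim t2 True) (Ulim t2 False) - Phi t1 (Ulim t1 True) (Ulim t1 False)
    \<ge> real d / 2 * (t2 - t1) * (P / (1 + t2 * P))"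
proof -
  let ?a = "Ulim t1 True" let ?b = "Ulim t1 False"
  have t': "0 \<le> t2" "t1 \<le> T" using t by auto
  note bx = Ulim_box[OF t(1) t'(2)] Ulim_box[OF t'(1) t(3)]
  have P0: "P \<ge> 0" using bx by (simp add: P_def)
  have fx: "?a = A True (t1 * ?b)" "?b = A False (t1 * ?a)"
    using Ulim_fixed[OF t(1) t'(2), of True] Ulim_fixed[OF t(1) t'(2), of False] by auto
  have fx2: "Ulim t2 True = A True (t2 * Ulim t2 False)" "Ulim t2 False = A False (t2 * Ulim t2 True)"
    using Ulim_fixed[OF t'(1) t(3), of True] Ulim_fixed[OF t'(1) t(3), of False] by auto
  have "phi t2 (t1 * ?a) \<le> phi t2 (t2 * Ulim t2 True)"
    using t bx Ulim_mono[OF t, of True] by (intro phi_mono st) (auto intro!: mult_mono)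
  hence 1: "Phi t2 (Ulim t2 True) (Ulim t2 False) \<ge> phi t2 (t1 * ?a)"
    using phi_fixed[OF fx2] by simp
  \<comment> \<open>With \<open>x\<close> fixed, neither the answering message nor the edge term
    changes, so only one vertex term depends on the parameter.\<close>
  have 2: "phi t2 (t1 * ?a) - Phi t1 ?a ?b = (L True (t2 * ?b) - L True (t1 * ?b)) / 2"
    unfolding phi_def Phi_def fx(2)[symmetric] by (simp add: field_simps)
  have "L True (t1 * ?b) - real d * (P / (1 + t2 * P)) * t1 \<le> L True (t2 * ?b) - real d * (P / (1 + t2 * P)) * t2"
  proof (rule DERIV_nonneg_imp_nondecreasing[OF t(2)])
    fix s assume s: "t1 \<le> s" "s \<le> t2"
    have ad: "adm True (s * ?b)" using s t bx by (intro adm_nonneg) auto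
    have ad1: "adm True (t1 * ?b)" using t bx by (intro adm_nonneg) auto
    define e where "e = ?b * A True (s * ?b)"
    have "A True (t1 * ?b) \<le> A True (s * ?b)"
      using s bx by (intro A_mono ad ad1 mult_right_mono)
    hence "?a \<le> A True (s * ?b)" using fx(1) by linarith
    hence Pe: "P \<le> e" unfolding P_def e_def using bx by (metis mult.commute mult_left_mono)
    have der: "((\<lambda>s. L True (s * ?b) - real d * (P / (1 + t2 * P)) * s) has_real_derivative
        real d * A True (s * ?b) / (1 + s * ?b * A True (s * ?b)) * ?b - real d * (P / (1 + t2 * P))) (at s)"
      using DERIV_diff[OF DERIV_chain2[where f = "L True", OF L_deriv[OF ad] DERIV_cmult_right[OF DERIV_ident, of ?b s]]
          DERIV_cmult_Id[of "real d * (P / (1 + t2 * P))"]] by simp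
    have "P / (1 + t2 * P) \<le> e / (1 + s * e)"
      using P0 Pe s t by (intro mobius_mono) auto
    hence "real d * (P / (1 + t2 * P)) \<le> real d * (e / (1 + s * e))" by (intro mult_left_mono) auto
    also have "real d * (e / (1 + s * e)) = real d * A True (s * ?b) / (1 + s * ?b * A True (s * ?b)) * ?b"
      by (simp add: e_def algebra_simps)
    finally show "\<exists>y. ((\<lambda>s. L True (s * ?b) - real d * (P / (1 + t2 * P)) * s) has_real_derivative y) (at s) \<and> 0 \<le> y"
      using der by (intro exI conjI) (assumption, simp)
  qed
  moreover have "l1 - real d * K * t1 \<le> l2 - real d * K * t2 \<Longrightarrow> (l2 - l1) / 2 \<ge> real d / 2 * (t2 - t1) * K"
    for l1 l2 K by (simp add: field_simps)
  ultimately have "(L True (t2 * ?b) - L True (t1 * ?b)) / 2 \<ge> real d / 2 * (t2 - t1) * (P / (1 + t2 * P))"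
    by blast
  thus ?thesis using 1 2 by linarith
qed

text \<open>\<open>Phi_step\<close> gives a lower sum, with the messages at the left end and the
  parameter at the right end of each interval, whereas the graph estimate needs the upper sum. As
  \<open>P\<close> is increasing, the difference telescopes and is of order
  \<open>1 / N\<close>.\<close>

lemma Riemann_sum_le_Phi:
  assumes st: "\<And>t. 0 \<le> t \<Longrightarrow> t \<le> T \<Longrightarrow> expanding t" and N: "N > 0"
  defines "s \<equiv> \<lambda>i. T * real i / real N"
    and "P \<equiv> \<lambda>t. Ulim t True * Ulim t False"
  shows "real d / 2 * (\<Sum>i<N. T / real N * (P (s (Suc i)) / (1 + s i * P (s (Suc i)))))
    \<le> Phi T (Ulim T True) (Ulim T False) - Phi 0 (Ulim 0 True) (Ulim 0 False)
      + real d / 2 * (T / real N) * (P T + P T * P T * T)"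
proof -
  define F where "F t = Phi t (Ulim t True) (Ulim t False)" for t
  have s: "0 \<le> s i" "s i \<le> s (Suc i)" for i using T0 N by (auto simp: s_def divide_right_mono mult_left_mono)
  have sT: "s i \<le> T" if "i \<le> N" for i
    using T0 N that by (simp add: s_def pos_divide_le_eq mult_left_mono)
  have sN: "s N = T" "s 0 = 0" using N by (auto simp: s_def)
  have ds: "s (Suc i) - s i = T / real N" for i by (simp add: s_def diff_divide_distrib[symmetric] algebra_simps)
  have P0: "0 \<le> P t" if "0 \<le> t" "t \<le> T" for t using Ulim_box[OF that] by (simp add: P_def)
  have Pm: "P t \<le> P t'" if "0 \<le> t" "t \<le> t'" "t' \<le> T" for t t'
    unfolding P_def using that Ulim_mono[OF that] Ulim_box[of t] Ulim_box[of t'] by (intro mult_mono) auto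
  have step: "real d / 2 * (T / real N * (P (s (Suc i)) / (1 + s i * P (s (Suc i)))))
     \<le> (F (s (Suc i)) - F (s i)) + real d / 2 * (T / real N) * ((P (s (Suc i)) - P (s i)) + P T * P T * (T / real N))"
    if i: "i < N" for i
  proof -
    let ?u = "s i" let ?v = "s (Suc i)"
    have v: "?v \<le> T" using i by (intro sT) auto
    have u: "?u \<le> T" using i by (intro sT) auto
    have p: "0 \<le> P ?u" "P ?u \<le> P ?v" "P ?v \<le> P T" "P ?u \<le> P T"
      using s v u order_trans[OF s(1) s(2)] by (auto intro!: P0 Pm)
    have e: "F ?v - F ?u \<ge> real d / 2 * (T / real N) * (P ?u / (1 + ?v * P ?u))"
      using Phi_step[OF s(1) s(2) v st[OF order_trans[OF s(1) s(2)] v]] unfolding ds F_def P_def by simp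
    \<comment> \<open>The numerator of this difference separates the increase of \<open>P\<close>,
      which telescopes, from a term proportional to the length of the interval.\<close>
    have "P ?v / (1 + ?u * P ?v) - P ?u / (1 + ?v * P ?u)
        = (P ?v - P ?u + P ?u * P ?v * (?v - ?u)) / ((1 + ?u * P ?v) * (1 + ?v * P ?u))"
    proof -
      have "1 + ?u * P ?v > 0" "1 + ?v * P ?u > 0" using s p order_trans[OF s(1) s(2)]
        by (auto intro!: add_pos_nonneg mult_nonneg_nonneg)
      thus ?thesis by (subst diff_frac_eq) (auto simp: algebra_simps)
    qed
    also have "\<dots> \<le> P ?v - P ?u + P ?u * P ?v * (?v - ?u)"
    proof -
      have "1 \<le> (1 + ?u * P ?v) * (1 + ?v * P ?u)"
        using s p order_trans[OF s(1) s(2)] mult_mono[of 1 "1 + ?u * P ?v" 1 "1 + ?v * P ?u"]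
        by (auto intro!: add_pos_nonneg mult_nonneg_nonneg)
      moreover have "0 \<le> P ?v - P ?u + P ?u * P ?v * (?v - ?u)" using p s[of i] by auto
      ultimately show ?thesis by (simp add: divide_le_eq mult_left_le mult_le_cancel_left1)
    qed
    also have "\<dots> \<le> P ?v - P ?u + P T * P T * (T / real N)"
      unfolding ds using p T0 by (intro add_left_mono mult_right_mono mult_mono) auto
    finally have "P ?v / (1 + ?u * P ?v) \<le> P ?u / (1 + ?v * P ?u) + (P ?v - P ?u + P T * P T * (T / real N))" by simp
    hence "real d / 2 * (T / real N) * (P ?v / (1 + ?u * P ?v))
       \<le> real d / 2 * (T / real N) * (P ?u / (1 + ?v * P ?u) + (P ?v - P ?u + P T * P T * (T / real N)))"
      using T0 by (intro mult_left_mono) auto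
    also have "\<dots> = real d / 2 * (T / real N) * (P ?u / (1 + ?v * P ?u)) + real d / 2 * (T / real N) * (P ?v - P ?u + P T * P T * (T / real N))"
      by (rule distrib_left)
    finally show ?thesis using e unfolding mult.assoc by linarith
  qed
  have "real d / 2 * (\<Sum>i<N. T / real N * (P (s (Suc i)) / (1 + s i * P (s (Suc i)))))
     \<le> (\<Sum>i<N. (F (s (Suc i)) - F (s i)) + real d / 2 * (T / real N) * ((P (s (Suc i)) - P (s i)) + P T * P T * (T / real N)))"
    unfolding sum_distrib_left by (intro sum_mono step) auto
  also have "\<dots> = F (s N) - F (s 0) + real d / 2 * (T / real N) * ((P (s N) - P (s 0)) + real N * (P T * P T * (T / real N)))"
    unfolding sum.distrib sum_distrib_left[symmetric] sum_lessThan_telescope[of "\<lambda>i. F (s i)"]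
      sum_lessThan_telescope[of "\<lambda>i. P (s i)"] by (simp add: mult.assoc)
  also have "\<dots> \<le> F T - F 0 + real d / 2 * (T / real N) * (P T + P T * P T * T)"
  proof -
    have "(P (s N) - P (s 0)) + real N * (P T * P T * (T / real N)) \<le> P T + P T * P T * T"
      unfolding sN using P0[of 0] T0 N by simp
    hence "real d / 2 * (T / real N) * ((P (s N) - P (s 0)) + real N * (P T * P T * (T / real N)))
       \<le> real d / 2 * (T / real N) * (P T + P T * P T * T)" using T0 by (intro mult_left_mono) auto
    thus ?thesis unfolding sN by linarith
  qed
  finally show ?thesis unfolding F_def .
qed

text \<open>The bound on the increments of the free energy that comes from trees of depth \<open>R\<close>.\<close>

definition inc :: "nat \<Rightarrow> nat \<Rightarrow> nat \<Rightarrow> real" where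
  "inc N R i = (let P = U (T * real (Suc i) / real N) R True * U (T * real (Suc i) / real N) R False
     in P / (1 + T * real i / real N * P))"

text \<open>\<open>N\<close> is chosen before the depth \<open>R\<close>: for fixed \<open>N\<close>
  the sum is finite and converges as the depth grows.\<close>

lemma ex_partition:
  assumes st: "\<And>t. 0 \<le> t \<Longrightarrow> t \<le> T \<Longrightarrow> expanding t" and e: "e > 0"
  shows "\<exists>N R. N > 0 \<and> real d / 2 * (\<Sum>i<N. T / real N * inc N R i)
    \<le> Phi T (Ulim T True) (Ulim T False) - Phi 0 (Ulim 0 True) (Ulim 0 False) + e"
proof -
  define P where "P t = Ulim t True * Ulim t False" for t
  define K where "K = real d / 2 * T * (P T + P T * P T * T)"
  have K0: "K \<ge> 0" unfolding K_def P_def using T0 Ulim_box[OF T0 order_refl] by simp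
  \<comment> \<open>\<open>K / real N\<close> is the discretisation error of the Riemann sum; this
    choice puts it below \<open>e / 2\<close>.\<close>
  obtain N :: nat where N: "real N > 2 * K / e" using reals_Archimedean2 by blast
  have "2 * K / e \<ge> 0" using K0 e by simp
  hence N0: "N > 0" using N by (cases N) auto
  have KN: "real d / 2 * (T / real N) * (P T + P T * P T * T) < e / 2"
  proof -
    have "2 * K < real N * e" using N e by (simp add: field_simps)
    hence "K / real N < e / 2" using N0 by (simp add: field_simps)
    thus ?thesis by (simp add: K_def)
  qed
  have sT: "0 \<le> T * real i / real N" "T * real i / real N \<le> T" if "i \<le> N" for i
    using T0 N0 that by (auto simp: pos_divide_le_eq mult_left_mono)
  have "(\<lambda>R. real d / 2 * (\<Sum>i<N. T / real N * inc N R i)) \<longlonglongrightarrow>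
     real d / 2 * (\<Sum>i<N. T / real N * (P (T * real (Suc i) / real N) / (1 + T * real i / real N * P (T * real (Suc i) / real N))))"
    unfolding inc_def Let_def P_def
  proof (intro tendsto_intros U_tendsto)
    fix i assume "i \<in> {..<N}"
    hence i: "Suc i \<le> N" "i \<le> N" by auto
    show "0 \<le> T * real (Suc i) / real N" "T * real (Suc i) / real N \<le> T"
        "0 \<le> T * real (Suc i) / real N" "T * real (Suc i) / real N \<le> T"
        "0 \<le> T * real (Suc i) / real N" "T * real (Suc i) / real N \<le> T"
        "0 \<le> T * real (Suc i) / real N" "T * real (Suc i) / real N \<le> T" using sT[OF i(1)] by auto
    have "0 \<le> T * real i / real N * (Ulim (T * real (Suc i) / real N) True * Ulim (T * real (Suc i) / real N) False)"
      using sT(1)[OF i(2)] Ulim_box[OF sT[OF i(1)]] by (intro mult_nonneg_nonneg) auto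
    thus "1 + T * real i / real N * (Ulim (T * real (Suc i) / real N) True * Ulim (T * real (Suc i) / real N) False) \<noteq> 0"
      by linarith
  qed
  moreover have "real d / 2 * (\<Sum>i<N. T / real N * (P (T * real (Suc i) / real N) / (1 + T * real i / real N * P (T * real (Suc i) / real N))))
     < Phi T (Ulim T True) (Ulim T False) - Phi 0 (Ulim 0 True) (Ulim 0 False) + e"
    using Riemann_sum_le_Phi[OF st N0] KN e unfolding P_def by linarith
  ultimately have "eventually (\<lambda>R. real d / 2 * (\<Sum>i<N. T / real N * inc N R i)
      < Phi T (Ulim T True) (Ulim T False) - Phi 0 (Ulim 0 True) (Ulim 0 False) + e) sequentially"
    by (rule order_tendstoD(2))
  then obtain R where "real d / 2 * (\<Sum>i<N. T / real N * inc N R i)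
      < Phi T (Ulim T True) (Ulim T False) - Phi 0 (Ulim 0 True) (Ulim 0 False) + e"
    unfolding eventually_sequentially by blast
  thus ?thesis using N0 by (intro exI[of _ N] exI[of _ R]) auto
qed

lemma Phi_0: "Phi 0 z z' = (L True 0 + L False 0) / 2"
  by (simp add: Phi_def)

section \<open>No unstable fixed points below the extremal one\<close>

lemma A_less: assumes "adm c y" "1 - g c * y > 0" shows "A c y < a c"
proof -
  have "(a c + g c) * (q c * (1 - g c * y) ^ (d - 1)) > 0"
    using assms a0[of c] g0[of c] q0[of c] by (auto intro!: mult_pos_pos add_pos_pos)
  thus ?thesis using den_pos[OF assms(1)] unfolding A_def by (simp add: divide_less_eq den_def algebra_simps)
qed

text \<open>A nonzero fixed point of the two-step map is a two-cycle of the recursion. All of these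
  are stable, so \<open>nonneg_before_stable_zero\<close> excludes a sign change below the extremal
  point. The symmetry hypotheses describe a gauge in which the two colours exchange the favoured
  spin, as happens at a fixed point common to both colours.\<close>

lemma expanding_antisym:
  assumes sym: "a False = g True" "g False = a True" "p False = q True" "q False = p True"
    and strict: "T * g True * g True < 1 \<or> T * a True * a True < 1"
    and t: "0 \<le> t" "t \<le> T"
  shows "expanding t"
proof -
  define h where "h x = t * A True (t * A False x) - x" for x
  define dA where "dA c y = real (d - 1) * (a c + g c)\<^sup>2 * (p c * q c) * ((1 + a c * y) * (1 - g c * y)) ^ (d - 2) / (den c y)\<^sup>2" for c y
  define h' where "h' x = t * (dA True (t * A False x) * (t * dA False x)) - 1" for x
  have "h x \<ge> 0" if x: "0 < x" "x \<le> t * Ulim t True" for x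
  proof (rule nonneg_before_stable_zero[where h = h and h' = h' and b = "t * Ulim t True"])
    have ad: "adm False x" if "0 < x" "x \<le> t * Ulim t True" for x
      using adm_between[OF Ulim_adm[OF t, of False], of x] that by simp
    have ad2: "adm True (t * A False x)" if "0 < x" "x \<le> t * Ulim t True" for x
      using A_le[OF ad[OF that]] A_nonneg[OF ad[OF that]] that(1) t by (intro adm_nonneg) auto
    show "(h has_real_derivative h' x) (at x)" if "0 < x" "x \<le> t * Ulim t True" for x
    proof -
      have d1: "((\<lambda>x. t * A False x) has_real_derivative t * dA False x) (at x)"
        unfolding dA_def by (intro DERIV_cmult A_deriv[OF ad[OF that]])
      have d2: "(A True has_real_derivative dA True (t * A False x)) (at (t * A False x))"
        unfolding dA_def by (rule A_deriv[OF ad2[OF that]])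
      show ?thesis unfolding h_def h'_def
        by (intro DERIV_diff DERIV_cmult DERIV_ident DERIV_chain2[OF d2 d1])
    qed
    show "h (t * Ulim t True) = 0"
      using Ulim_fixed[OF t, of True] Ulim_fixed[OF t, of False] by (simp add: h_def)
    show "h' x < 0" if xx: "0 < x" "x \<le> t * Ulim t True" and hx: "h x = 0" for x
    proof -
      define y where "y = t * A False x"
      have xy: "x = t * A True y" using hx by (simp add: h_def y_def)
      have y0: "y \<ge> 0" using A_nonneg[OF ad[OF xx]] xx t by (simp add: y_def)
      have t0: "t > 0" using xy xx t by (cases "t = 0") auto
      have ady: "adm True y" using ad2[OF xx] by (simp add: y_def)
      note adx = ad[OF xx]
      define P Q P' Q' where "P = 1 + a True * y" and "Q = 1 - g True * y"
        and "P' = 1 - a True * x" and "Q' = 1 + g True * x"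
      have PQ0: "P > 0" "Q' > 0" using mult_nonneg_nonneg[of "a True" y] mult_pos_pos[of "g True" x] a0[of True] g0[of True] y0 xx(1)
        unfolding P_def Q'_def by linarith+
      have tT: "t * g True * g True \<le> T * g True * g True" "t * a True * a True \<le> T * a True * a True"
        using t g0[of True] a0[of True] by (auto intro!: mult_right_mono)
      have le1: "T * g True * g True \<le> 1" "T * a True * a True \<le> 1"
        using Tag[of False] Tag[of True] sym by (auto simp: mult_ac)
      have yle: "g True * y \<le> t * g True * g True"
        using A_le[OF adx] sym t g0[of True] by (simp add: y_def mult_left_mono mult_ac)
      have xle: "a True * x \<le> t * a True * a True"
        using mult_left_mono[OF mult_left_mono[OF A_le[OF ady] t(1)], of "a True"] a0[of True]
        unfolding xy[symmetric] by (simp add: mult_ac)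
      \<comment> \<open>Positivity of the unfavoured factors. The strict bound gives it at one end
        of the cycle. A message computed from a positive factor is strictly below its maximum, which
        gives it at the other end.\<close>
      have QP: "Q > 0 \<and> P' > 0"
        using strict
      proof
        assume "T * g True * g True < 1"
        hence Q: "Q > 0" using yle tT by (simp add: Q_def)
        hence "A True y < a True" by (intro A_less ady) (simp add: Q_def)
        hence "a True * (t * A True y) < a True * (t * a True)" using t0 a0[of True] by simp
        hence "a True * x < a True * (t * a True)" unfolding xy[symmetric] .
        hence "a True * x < 1" using tT le1 by (simp add: mult_ac)
        thus ?thesis using Q by (simp add: P'_def)
      next
        assume "T * a True * a True < 1"
        hence P': "P' > 0" using xle tT by (simp add: P'_def)
        hence "A False x < a False" by (intro A_less adx) (simp add: P'_def sym)
        hence "g True * (t * A False x) < g True * (t * g True)" using t0 g0[of True] sym by simp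
        hence "g True * y < 1" using tT le1 by (simp add: mult_ac y_def)
        thus ?thesis using P' by (simp add: Q_def)
      qed
      define n where "n = d - 3"
      have n: "d - 1 = n + 2" "d - 2 = n + 1" using d3 by (simp_all add: n_def)
      \<comment> \<open>\<open>X\<close> multiplies the factors of the favoured spins along the
        cycle and \<open>Y\<close> those of the other spins. Then \<open>X - Y\<close> is
        proportional to \<open>x + y\<close>, hence by the cycle equations to
        \<open>X ^ (n + 2) - Y ^ (n + 2)\<close>; the same constant \<open>k\<close> appears in the
        multiplier.\<close>
      define X Y where "X = P * Q'" and "Y = P' * Q"
      have Y0: "Y > 0" using QP by (simp add: Y_def)
      have XY: "X - Y = (a True + g True) * (x + y)"
        unfolding X_def Y_def P_def Q_def P'_def Q'_def by (simp add: algebra_simps)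
      moreover have "(a True + g True) * (x + y) > 0" using a0[of True] g0[of True] xx y0 by simp
      ultimately have XgY: "X > Y" by simp
      define w where "w = p True * q True"
      have w0: "w > 0" using p0 q0 by (simp add: w_def)
      have dT: "den True y = p True * P ^ (n + 2) + q True * Q ^ (n + 2)" unfolding den_def n P_def Q_def ..
      have dF: "den False x = q True * Q' ^ (n + 2) + p True * P' ^ (n + 2)" unfolding den_def n P'_def Q'_def sym ..
      have dTp: "den True y > 0" "den False x > 0" using den_pos ady adx by auto
      define k where "k = t * (a True + g True)\<^sup>2 * w / (den True y * den False x)"
      have sumA: "A True y + A False x = (a True + g True) * w * (X ^ (n + 2) - Y ^ (n + 2)) / (den True y * den False x)"
      proof -
        have "A True y = (a True * (p True * P ^ (n + 2)) - g True * (q True * Q ^ (n + 2))) / den True y"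
          unfolding A_def n P_def Q_def ..
        moreover have "A False x = (g True * (q True * Q' ^ (n + 2)) - a True * (p True * P' ^ (n + 2))) / den False x"
          unfolding A_def n P'_def Q'_def sym ..
        ultimately have "A True y + A False x = ((a True * (p True * P ^ (n + 2)) - g True * (q True * Q ^ (n + 2))) * den False x
            + (g True * (q True * Q' ^ (n + 2)) - a True * (p True * P' ^ (n + 2))) * den True y) / (den True y * den False x)"
          using dTp by (simp add: add_frac_eq)
        also have "(a True * (p True * P ^ (n + 2)) - g True * (q True * Q ^ (n + 2))) * den False x
            + (g True * (q True * Q' ^ (n + 2)) - a True * (p True * P' ^ (n + 2))) * den True y
            = (a True + g True) * w * (X ^ (n + 2) - Y ^ (n + 2))"
          unfolding dT dF w_def X_def Y_def power_mult_distrib by algebra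
        finally show ?thesis .
      qed
      have "X - Y = (a True + g True) * (t * (A True y + A False x))"
        unfolding XY distrib_left[of t] xy[symmetric] y_def[symmetric] ..
      hence XYk: "X - Y = k * (X ^ (n + 2) - Y ^ (n + 2))"
        unfolding sumA k_def by (simp add: power2_eq_square mult_ac)
      define M where "M = X ^ (n + 2) - Y ^ (n + 2)"
      have M0: "M > 0" using power_strict_mono[OF XgY, of "n + 2"] Y0 unfolding M_def by simp
      have "(real (n + 2) * (k * M))\<^sup>2 * (X * Y) ^ (n + 1) < M\<^sup>2"
        using two_cycle_ineq[OF XgY Y0, of n] unfolding XYk M_def[symmetric] .
      hence "((real (n + 2) * k)\<^sup>2 * (X * Y) ^ (n + 1)) * M\<^sup>2 < 1 * M\<^sup>2"
        by (simp add: power_mult_distrib mult_ac)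
      hence lt: "(real (n + 2) * k)\<^sup>2 * (X * Y) ^ (n + 1) < 1" using M0 by (simp add: mult_less_cancel_right)
      have "t * (dA True y * (t * dA False x)) = (real (n + 2) * k)\<^sup>2 * (X * Y) ^ (n + 1)"
      proof -
        have e1: "dA True y = real (n + 2) * (a True + g True)\<^sup>2 * w * (P * Q) ^ (n + 1) / (den True y)\<^sup>2"
          unfolding dA_def n P_def Q_def w_def by simp
        have e2: "dA False x = real (n + 2) * (a True + g True)\<^sup>2 * w * (Q' * P') ^ (n + 1) / (den False x)\<^sup>2"
          unfolding dA_def n P'_def Q'_def w_def sym by (simp add: add.commute mult.commute)
        show ?thesis unfolding e1 e2 k_def X_def Y_def
          by (simp add: power_mult_distrib power_divide mult_ac power2_eq_square)
      qed
      thus ?thesis using lt by (simp add: h'_def y_def)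
    qed
  qed (use x in auto)
  thus ?thesis by (auto simp: expanding_def h_def)
qed

text \<open>Both colours have the same recursion, so a single step is treated first and monotonicity
  doubles it. At a fixed point \<open>x\<close> the slope is bounded by
  \<open>times_pow_diff_less_hom\<close> with \<open>1 + x\<close> and \<open>1 - x\<close>.\<close>

lemma expanding_sym:
  assumes sym: "\<And>c. a c = 1" "\<And>c. g c = 1" "p False = p True" "q False = q True"
    and strict: "T < 1" and t: "0 \<le> t" "t \<le> T"
  shows "\<And>x. 0 < x \<Longrightarrow> x \<le> t * Ulim t True \<Longrightarrow> x \<le> t * A True x" and "expanding t"
proof -
  have AF: "A False = A True" by (rule ext) (simp add: A_def den_def sym)
  have UF: "U t k False = U t k True" for k 
  proof (induction k)
    case 0 show ?case using sym(1)[of True] sym(1)[of False] by simp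
  next
    case (Suc k) thus ?case by (simp add: AF)
  qed
  have UlF: "Ulim t False = Ulim t True" by (simp add: Ulim_def UF)
  have pq: "q True \<le> p True" using gq_ap[of True] sym by simp
  define h where "h x = t * A True x - x" for x
  define dA where "dA y = real (d - 1) * (a True + g True)\<^sup>2 * (p True * q True) * ((1 + a True * y) * (1 - g True * y)) ^ (d - 2) / (den True y)\<^sup>2" for y
  have ad: "adm True x" if "0 < x" "x \<le> t * Ulim t True" for x
    using adm_between[OF Ulim_adm[OF t, of True], of x] that UlF by simp
  have key: "h x \<ge> 0" if x: "0 < x" "x \<le> t * Ulim t True" for x
  proof (rule nonneg_before_stable_zero[where h = h and h' = "\<lambda>x. t * dA x - 1" and b = "t * Ulim t True"])
    show "(h has_real_derivative t * dA x - 1) (at x)" if "0 < x" "x \<le> t * Ulim t True" for x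
      unfolding h_def dA_def by (intro DERIV_diff DERIV_cmult DERIV_ident A_deriv[OF ad[OF that]])
    show "h (t * Ulim t True) = 0"
      using Ulim_fixed[OF t, of True] UlF by (simp add: h_def)
    show "t * dA x - 1 < 0" if xx: "0 < x" "x \<le> t * Ulim t True" and hx: "h x = 0" for x
    proof -
      define P Q where "P = 1 + x" and "Q = 1 - x"
      have xe: "x = t * A True x" using hx by (simp add: h_def)
      have "x \<le> t * 1" using xx Ulim_box(2)[OF t, of True] t sym by (metis mult_left_mono order_trans)
      hence Q0: "Q > 0" "P > Q" using strict t xx by (auto simp: P_def Q_def)
      define n where "n = d - 3"
      have n: "d - 1 = n + 2" "d - 2 = n + 1" using d3 by (simp_all add: n_def)
      define u v where "u = p True * P ^ (n + 2)" and "v = q True * Q ^ (n + 2)"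
      have uv0: "u > 0" "v > 0" using Q0 p0 q0 by (auto simp: u_def v_def)
      have dn: "den True x = u + v" unfolding den_def n P_def Q_def sym u_def v_def by simp
      have Ax: "A True x = (u - v) / (u + v)" unfolding A_def dn n sym unfolding u_def v_def P_def Q_def by simp
      have "P ^ (n + 2) > Q ^ (n + 2)" using Q0 by (intro power_strict_mono) auto
      hence uv: "u > v" unfolding u_def v_def using pq q0[of True] Q0
        by (intro mult_le_less_imp_less) (auto simp: less_imp_le)
      define k where "k = 4 * t / (u + v)"
      have PQk: "P\<^sup>2 - Q\<^sup>2 = k * (u - v)"
      proof -
        have "P\<^sup>2 - Q\<^sup>2 = 4 * x" by (simp add: P_def Q_def power2_eq_square algebra_simps)
        also have "\<dots> = 4 * (t * A True x)" unfolding xe[symmetric] ..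
        finally show ?thesis by (simp add: Ax k_def)
      qed
      define c where "c = real (n + 2) * k * (p True * q True) * (P * Q) ^ (n + 1)"
      have "(p True * q True) * (real (n + 2) * (P\<^sup>2 - Q\<^sup>2) * (P * Q) ^ (n + 1)) < (p True * q True) * (P ^ (2 * (n + 2)) - Q ^ (2 * (n + 2)))"
        using times_pow_diff_less_hom[OF Q0(2,1)] p0 q0 by (intro mult_strict_left_mono) auto
      \<comment> \<open>Here the external field enters: \<open>q True \<le> p True\<close> raises
        the coefficient of the power of \<open>P\<close> and lowers that of the power of
        \<open>Q\<close>.\<close>
      also have "\<dots> \<le> (u - v) * (u + v)"
      proof -
        have e: "P ^ (2 * (n + 2)) = P ^ (n + 2) * P ^ (n + 2)" "Q ^ (2 * (n + 2)) = Q ^ (n + 2) * Q ^ (n + 2)"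
          by (simp_all only: power_add[symmetric] mult_2)
        have "p True * q True * (P ^ (n + 2) * P ^ (n + 2)) \<le> p True * p True * (P ^ (n + 2) * P ^ (n + 2))"
          using pq p0[of True] Q0 by (intro mult_right_mono mult_left_mono) auto
        moreover have "q True * q True * (Q ^ (n + 2) * Q ^ (n + 2)) \<le> p True * q True * (Q ^ (n + 2) * Q ^ (n + 2))"
          using pq q0[of True] Q0 by (intro mult_right_mono) auto
        moreover have "(u - v) * (u + v) = p True * p True * (P ^ (n + 2) * P ^ (n + 2)) - q True * q True * (Q ^ (n + 2) * Q ^ (n + 2))"
          unfolding u_def v_def by algebra
        ultimately show ?thesis unfolding e right_diff_distrib by linarith
      qed
      also have "(p True * q True) * (real (n + 2) * (P\<^sup>2 - Q\<^sup>2) * (P * Q) ^ (n + 1)) = (u - v) * c"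
        unfolding PQk c_def by simp
      finally have "c < u + v" using uv by simp
      hence "c / (u + v) < 1" using uv0 by simp
      moreover have "t * dA x = c / (u + v)"
        unfolding dA_def dn c_def k_def n sym P_def Q_def by (simp add: power2_eq_square mult_ac)
      ultimately show ?thesis by simp
    qed
  qed (use x in auto)
  thus *: "\<And>x. 0 < x \<Longrightarrow> x \<le> t * Ulim t True \<Longrightarrow> x \<le> t * A True x" by (simp add: h_def)
  have "x \<le> t * A True (t * A True x)" if x: "0 < x" "x \<le> t * Ulim t True" for x
  proof -
    have "adm True (t * A True x)"
      using A_le[OF ad[OF x]] A_nonneg[OF ad[OF x]] x(1) t sym by (intro adm_nonneg) auto
    hence "t * A True x \<le> t * A True (t * A True x)"
      using *[OF x] t ad[OF x] by (intro mult_left_mono A_mono) auto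
    thus ?thesis using *[OF x] by linarith
  qed
  thus "expanding t" by (simp add: expanding_def AF)
qed

end

section \<open>Spin sums on trees\<close>

text \<open>A configuration on \<open>A\<close> is encoded by the set of its vertices with spin
  \<open>True\<close>. Sums then range over \<open>Pow A\<close>, and configurations remain total
  functions.\<close>

definition override_set :: "'v set \<Rightarrow> 'v set \<Rightarrow> ('v \<Rightarrow> bool) \<Rightarrow> 'v \<Rightarrow> bool" where
  "override_set A B \<sigma> = (\<lambda>v. if v \<in> A then v \<in> B else \<sigma> v)"

text \<open>Sum over all spins in \<open>A\<close>, the spins outside \<open>A\<close> being those of \<open>\<sigma>\<close>.\<close>

definition spin_sum :: "'v set \<Rightarrow> (('v \<Rightarrow> bool) \<Rightarrow> real) \<Rightarrow> ('v \<Rightarrow> bool) \<Rightarrow> real" where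
  "spin_sum A F \<sigma> = (\<Sum>B\<in>Pow A. F (override_set A B \<sigma>))"

lemma override_set_out: "v \<notin> A \<Longrightarrow> override_set A B \<sigma> v = \<sigma> v"
  by (simp add: override_set_def)

lemma spin_sum_empty [simp]: "spin_sum {} F \<sigma> = F \<sigma>"
  by (simp add: spin_sum_def override_set_def)

lemma spin_sum_Un:
  assumes "finite A" "finite B" "A \<inter> B = {}"
  shows "spin_sum (A \<union> B) F \<sigma> = spin_sum A (spin_sum B F) \<sigma>"
proof -
  have "spin_sum A (spin_sum B F) \<sigma> = (\<Sum>(X, Y)\<in>Pow A \<times> Pow B. F (override_set B Y (override_set A X \<sigma>)))"
    by (simp add: spin_sum_def sum.cartesian_product)
  also have "\<dots> = (\<Sum>Z\<in>Pow (A \<union> B). F (override_set (A \<union> B) Z \<sigma>))"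
  proof (rule sum.reindex_bij_witness[where i = "\<lambda>Z. (Z \<inter> A, Z \<inter> B)" and j = "\<lambda>(X, Y). X \<union> Y"])
    fix XY assume "XY \<in> Pow A \<times> Pow B"
    then obtain X Y where XY: "XY = (X, Y)" "X \<subseteq> A" "Y \<subseteq> B" by auto
    have "override_set (A \<union> B) (X \<union> Y) \<sigma> = override_set B Y (override_set A X \<sigma>)"
      using XY assms(3) by (auto simp: override_set_def fun_eq_iff)
    thus "F (override_set (A \<union> B) (case XY of (X, Y) \<Rightarrow> X \<union> Y) \<sigma>)
        = (case XY of (X, Y) \<Rightarrow> F (override_set B Y (override_set A X \<sigma>)))" by (simp add: XY)
  qed (use assms(3) in auto)
  finally show ?thesis by (simp add: spin_sum_def)
qed

lemma spin_sum_cong: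
  assumes "\<And>\<sigma>'. (\<And>v. v \<notin> A \<Longrightarrow> \<sigma>' v = \<sigma> v) \<Longrightarrow> F \<sigma>' = G \<sigma>'"
  shows "spin_sum A F \<sigma> = spin_sum A G \<sigma>"
  unfolding spin_sum_def by (intro sum.cong refl assms override_set_out)

lemma spin_sum_mono:
  assumes "\<And>\<sigma>'. (\<And>v. v \<notin> A \<Longrightarrow> \<sigma>' v = \<sigma> v) \<Longrightarrow> F \<sigma>' \<le> G \<sigma>'"
  shows "spin_sum A F \<sigma> \<le> spin_sum A G \<sigma>"
  unfolding spin_sum_def by (intro sum_mono assms override_set_out)

lemma spin_sum_factor:
  assumes "\<And>\<sigma>'. (\<And>v. v \<notin> A \<Longrightarrow> \<sigma>' v = \<sigma> v) \<Longrightarrow> K \<sigma>' = k"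
  shows "spin_sum A (\<lambda>\<sigma>. K \<sigma> * F \<sigma>) \<sigma> = k * spin_sum A F \<sigma>"
proof -
  have "K (override_set A B \<sigma>) = k" for B by (rule assms) (rule override_set_out)
  thus ?thesis unfolding spin_sum_def sum_distrib_left by simp
qed

lemma spin_sum_cmult: "spin_sum A (\<lambda>\<sigma>. k * F \<sigma>) \<sigma> = k * spin_sum A F \<sigma>"
  by (simp add: spin_sum_def sum_distrib_left)

lemma spin_sum_add: "spin_sum A (\<lambda>\<sigma>. F \<sigma> + G \<sigma>) \<sigma> = spin_sum A F \<sigma> + spin_sum A G \<sigma>"
  by (simp add: spin_sum_def sum.distrib)

lemma spin_sum_sum: "spin_sum A (\<lambda>\<sigma>. \<Sum>i\<in>I. F i \<sigma>) \<sigma> = (\<Sum>i\<in>I. spin_sum A (F i) \<sigma>)"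
  unfolding spin_sum_def by (rule sum.swap)

lemma spin_sum_single: "spin_sum {v} F \<sigma> = F (\<sigma>(v := True)) + F (\<sigma>(v := False))"
proof -
  have "override_set {v} {} \<sigma> = \<sigma>(v := False)" "override_set {v} {v} \<sigma> = \<sigma>(v := True)"
    by (auto simp: override_set_def)
  moreover have "Pow {v} = {{}, {v}}" by auto
  ultimately show ?thesis by (simp add: spin_sum_def)
qed

lemma spin_sum_insert:
  assumes "finite A" "v \<notin> A"
  shows "spin_sum (insert v A) F \<sigma> = spin_sum A F (\<sigma>(v := True)) + spin_sum A F (\<sigma>(v := False))"
  using spin_sum_Un[of "{v}" A F \<sigma>] assms by (simp add: spin_sum_single)

lemma spin_sum_prod:
  assumes "finite A"
  shows "spin_sum A (\<lambda>\<sigma>. \<Prod>v\<in>A. f v (\<sigma> v)) \<sigma> = (\<Prod>v\<in>A. f v True + f v False)"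
  using assms
proof (induction A arbitrary: \<sigma> rule: finite_induct)
  case empty show ?case by simp
next
  case (insert x A)
  have "spin_sum A (\<lambda>\<sigma>. \<Prod>v\<in>insert x A. f v (\<sigma> v)) (\<sigma>(x := b)) = f x b * (\<Prod>v\<in>A. f v True + f v False)" for b
  proof -
    have "spin_sum A (\<lambda>\<sigma>. f x (\<sigma> x) * (\<Prod>v\<in>A. f v (\<sigma> v))) (\<sigma>(x := b))
       = f x b * spin_sum A (\<lambda>\<sigma>. \<Prod>v\<in>A. f v (\<sigma> v)) (\<sigma>(x := b))"
      using insert by (intro spin_sum_factor) simp
    thus ?thesis using insert by simp
  qed
  thus ?case using insert by (simp add: spin_sum_insert distrib_right)
qed

text \<open>It suffices to compare the two-term sums over the spin of one vertex. A comparison of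
  single configurations fails when weights vanish.\<close>

lemma spin_sum_compare:
  assumes "finite A" "v \<in> A"
    and "\<And>\<sigma>. F (\<sigma>(v := True)) + F (\<sigma>(v := False)) \<le> C * (G (\<sigma>(v := True)) + G (\<sigma>(v := False)))"
  shows "spin_sum A F \<sigma> \<le> C * spin_sum A G \<sigma>"
proof -
  have A: "A = (A - {v}) \<union> {v}" using assms(2) by auto
  have s: "spin_sum A H \<sigma> = spin_sum (A - {v}) (\<lambda>\<sigma>. H (\<sigma>(v := True)) + H (\<sigma>(v := False))) \<sigma>" for H
    by (subst A, subst spin_sum_Un) (use assms(1) in \<open>auto simp: spin_sum_single[abs_def]\<close>)
  show ?thesis unfolding s spin_sum_cmult[symmetric] by (intro spin_sum_mono assms(3))
qed

lemma spin_sum_pos: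
  assumes "finite A" "\<And>\<sigma>. F \<sigma> \<ge> 0" "F \<sigma>1 > 0" "\<And>v. v \<notin> A \<Longrightarrow> \<sigma>1 v = \<sigma> v"
  shows "spin_sum A F \<sigma> > 0"
  unfolding spin_sum_def
proof (rule sum_pos2[where i = "{v\<in>A. \<sigma>1 v}"])
  have "override_set A {v\<in>A. \<sigma>1 v} \<sigma> = \<sigma>1" using assms(4) by (auto simp: override_set_def fun_eq_iff)
  thus "0 < F (override_set A {v\<in>A. \<sigma>1 v} \<sigma>)" using assms by simp
qed (use assms in auto)

lemma sum_PiE_bool:
  assumes "finite A" "\<And>\<sigma> \<sigma>'. (\<And>v. v \<in> A \<Longrightarrow> \<sigma> v = \<sigma>' v) \<Longrightarrow> F \<sigma> = F \<sigma>'"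
  shows "(\<Sum>\<sigma>\<in>A \<rightarrow>\<^sub>E (UNIV :: bool set). F \<sigma>) = spin_sum A F \<sigma>0"
  unfolding spin_sum_def
  by (rule sum.reindex_bij_witness[where i = "\<lambda>B. restrict (\<lambda>v. v \<in> B) A" and j = "\<lambda>\<sigma>. {v\<in>A. \<sigma> v}"])
     (auto simp: override_set_def restrict_def fun_eq_iff PiE_def extensional_def intro!: assms(2))

text \<open>\<open>lev k\<close> is the set of vertices at distance \<open>k\<close> from \<open>root\<close>, and \<open>Bx m v\<close> is an invariant set for the
  messages sent by \<open>v\<close> when the boundary is \<open>m\<close> levels below \<open>v\<close>.\<close>

locale level_tree =
  fixes V :: "nat set" and E :: "(nat \<times> nat) set" and Om ze :: "nat \<Rightarrow> bool \<Rightarrow> real" and t :: real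
    and lev :: "nat \<Rightarrow> nat set" and par :: "nat \<Rightarrow> nat" and root r :: nat and Bx :: "nat \<Rightarrow> nat \<Rightarrow> real set"
  assumes finV: "finite V" and finE: "finite E" and EV: "E \<subseteq> V \<times> V"
    and Om0: "\<And>v s. Om v s > 0"
    and edge_nonneg: "\<And>i j s s'. (i, j) \<in> E \<Longrightarrow> 0 \<le> 1 + t * (ze i s * ze j s')"
    and lev_V: "\<And>k. k \<le> Suc (Suc r) \<Longrightarrow> lev k \<subseteq> V"
    and lev_disj: "\<And>k k'. k < k' \<Longrightarrow> k' \<le> Suc (Suc r) \<Longrightarrow> lev k \<inter> lev k' = {}"
    and lev_0: "lev 0 = {root}"
    and par_lev: "\<And>k v. k \<le> Suc r \<Longrightarrow> v \<in> lev (Suc k) \<Longrightarrow> par v \<in> lev k"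
    and par_edge: "\<And>k v. k \<le> Suc r \<Longrightarrow> v \<in> lev (Suc k) \<Longrightarrow> (min v (par v), max v (par v)) \<in> E"
    and edge_par: "\<And>k v i j. k \<le> Suc r \<Longrightarrow> v \<in> lev k \<Longrightarrow> (i, j) \<in> E \<Longrightarrow> v = i \<or> v = j \<Longrightarrow>
       \<exists>k' v'. k' \<le> Suc r \<and> v' \<in> lev (Suc k') \<and> (i, j) = (min v' (par v'), max v' (par v'))"
    and box_0: "\<And>v s. v \<in> lev (Suc (Suc r)) \<Longrightarrow> ze v s \<in> Bx 0 v"
    and box_step: "\<And>k m v z. k \<le> r \<Longrightarrow> v \<in> lev (Suc k) \<Longrightarrow> (\<And>u. u \<in> lev (Suc (Suc k)) \<Longrightarrow> par u = v \<Longrightarrow> z u \<in> Bx m u) \<Longrightarrow>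
       (\<Sum>s\<in>UNIV. Om v s * (\<Prod>u\<in>{u\<in>lev (Suc (Suc k)). par u = v}. 1 + t * (ze v s * z u))) > 0 \<and>
       (\<Sum>s\<in>UNIV. Om v s * ze v s * (\<Prod>u\<in>{u\<in>lev (Suc (Suc k)). par u = v}. 1 + t * (ze v s * z u))) /
       (\<Sum>s\<in>UNIV. Om v s * (\<Prod>u\<in>{u\<in>lev (Suc (Suc k)). par u = v}. 1 + t * (ze v s * z u))) \<in> Bx (Suc m) v"
    and box_root: "\<And>j z m. j \<in> lev 1 \<Longrightarrow> (\<And>u. u \<in> lev 1 \<Longrightarrow> z u \<in> Bx m u) \<Longrightarrow>
       (\<Sum>s\<in>UNIV. Om root s * (\<Prod>u\<in>lev 1 - {j}. 1 + t * (ze root s * z u))) > 0 \<and>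
       (\<Sum>s\<in>UNIV. Om root s * ze root s * (\<Prod>u\<in>lev 1 - {j}. 1 + t * (ze root s * z u))) /
       (\<Sum>s\<in>UNIV. Om root s * (\<Prod>u\<in>lev 1 - {j}. 1 + t * (ze root s * z u))) \<in> Bx (Suc m) root"
begin

lemma fin_lev: "k \<le> Suc (Suc r) \<Longrightarrow> finite (lev k)"
  using lev_V finV finite_subset by blast

lemma lev_unique: "k \<le> Suc (Suc r) \<Longrightarrow> k' \<le> Suc (Suc r) \<Longrightarrow> v \<in> lev k \<Longrightarrow> v \<in> lev k' \<Longrightarrow> k = k'"
  using lev_disj by (metis disjoint_iff linorder_neqE_nat)

lemma not_in_levels:
  assumes "v \<in> lev k" "k \<le> Suc (Suc r)" "k \<notin> I" "I \<subseteq> {..Suc (Suc r)}"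
  shows "v \<notin> (\<Union>k\<in>I. lev k)"
proof
  assume "v \<in> (\<Union>k\<in>I. lev k)"
  then obtain l where l: "l \<in> I" "v \<in> lev l" by blast
  hence "l = k" using lev_unique[of l k v] assms by auto
  thus False using l assms by simp
qed

text \<open>The endpoints are ordered as in \<open>edges\<close>, where the smaller one comes
  first.\<close>

definition te :: "nat \<Rightarrow> nat \<times> nat" where "te v = (min v (par v), max v (par v))"

definition inner :: "nat set" where "inner = (\<Union>k\<in>{..Suc r}. lev k)"

text \<open>The spins of the outermost level \<open>Suc (Suc r)\<close> are frozen; their vertex
  weights belong to the surroundings and are left out here.\<close>

definition B :: "nat \<Rightarrow> (nat \<Rightarrow> bool) \<Rightarrow> real" where
  "B k \<sigma> = (\<Prod>v\<in>lev k. (if k \<le> Suc r then Om v (\<sigma> v) else 1) * (1 + t * (ze (par v) (\<sigma> (par v)) * ze v (\<sigma> v))))"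

lemma eliminate_levels:
  assumes "m \<le> r"
  shows "\<exists>C z. C > 0 \<and> (\<forall>v\<in>lev (Suc (Suc (r - m))). z v \<in> Bx m v) \<and>
    (\<forall>\<sigma>. (\<forall>v. v \<notin> inner \<longrightarrow> \<sigma> v = \<sigma>0 v) \<longrightarrow>
      spin_sum (\<Union>k\<in>{Suc (Suc (r - m))..Suc r}. lev k) (\<lambda>\<sigma>. \<Prod>k\<in>{Suc (Suc (r - m))..Suc (Suc r)}. B k \<sigma>) \<sigma>
      = C * (\<Prod>v\<in>lev (Suc (Suc (r - m))). 1 + t * (ze (par v) (\<sigma> (par v)) * z v)))"
  using assms
proof (induction m)
  case 0
  have e: "{Suc (Suc r)..Suc r} = {}" by simp
  have ag: "\<sigma> v = \<sigma>0 v" if "\<forall>v. v \<notin> inner \<longrightarrow> \<sigma> v = \<sigma>0 v" "v \<in> lev (Suc (Suc r))" for \<sigma> v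
  proof -
    have "v \<notin> inner"
    proof
      assume "v \<in> inner"
      then obtain k where "k \<le> Suc r" "v \<in> lev k" by (auto simp: inner_def)
      with lev_unique[of k "Suc (Suc r)" v] that(2) show False by simp
    qed
    thus ?thesis using that by auto
  qed
  show ?case
  proof (intro exI[of _ 1] exI[of _ "\<lambda>v. ze v (\<sigma>0 v)"] conjI allI impI ballI)
    fix \<sigma> assume \<sigma>: "\<forall>v. v \<notin> inner \<longrightarrow> \<sigma> v = \<sigma>0 v"
    have "B (Suc (Suc r)) \<sigma> = (\<Prod>v\<in>lev (Suc (Suc r)). 1 + t * (ze (par v) (\<sigma> (par v)) * ze v (\<sigma>0 v)))"
      unfolding B_def by (rule prod.cong) (simp_all add: ag[OF \<sigma>])
    thus "spin_sum (\<Union>k\<in>{Suc (Suc (r - 0))..Suc r}. lev k) (\<lambda>\<sigma>. \<Prod>k\<in>{Suc (Suc (r - 0))..Suc (Suc r)}. B k \<sigma>) \<sigma>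
      = 1 * (\<Prod>v\<in>lev (Suc (Suc (r - 0))). 1 + t * (ze (par v) (\<sigma> (par v)) * ze v (\<sigma>0 v)))"
      by simp
  qed (simp_all add: box_0)
next
  case (Suc m)
  define k where "k = Suc (r - Suc m)"
  have k: "Suc (r - m) = Suc k" "k \<le> r" "Suc k \<le> Suc (Suc r)" "Suc (Suc k) \<le> Suc (Suc r)" "k \<ge> 1"
    using Suc.prems by (auto simp: k_def)
  from Suc obtain C z where C: "C > 0" and z: "\<And>v. v \<in> lev (Suc (Suc k)) \<Longrightarrow> z v \<in> Bx m v"
    and eq: "\<And>\<sigma>. (\<forall>v. v \<notin> inner \<longrightarrow> \<sigma> v = \<sigma>0 v) \<Longrightarrow>
      spin_sum (\<Union>k\<in>{Suc (Suc k)..Suc r}. lev k) (\<lambda>\<sigma>. \<Prod>k\<in>{Suc (Suc k)..Suc (Suc r)}. B k \<sigma>) \<sigma>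
      = C * (\<Prod>v\<in>lev (Suc (Suc k)). 1 + t * (ze (par v) (\<sigma> (par v)) * z v))"
    unfolding k(1) by auto
  define ch where "ch v = {u\<in>lev (Suc (Suc k)). par u = v}" for v
  define N where "N v = (\<Sum>s\<in>UNIV. Om v s * (\<Prod>u\<in>ch v. 1 + t * (ze v s * z u)))" for v
  define M where "M v = (\<Sum>s\<in>UNIV. Om v s * ze v s * (\<Prod>u\<in>ch v. 1 + t * (ze v s * z u)))" for v
  have NM: "N v > 0 \<and> M v / N v \<in> Bx (Suc m) v" if "v \<in> lev (Suc k)" for v
    unfolding N_def M_def ch_def using that k z by (intro box_step) auto
  have fl: "finite (lev (Suc k))" "finite (lev (Suc (Suc k)))" using k by (auto intro: fin_lev)
  show ?case
  proof (intro exI[of _ "C * (\<Prod>v\<in>lev (Suc k). N v)"] exI[of _ "\<lambda>v. M v / N v"] conjI allI impI ballI)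
    show "0 < C * (\<Prod>v\<in>lev (Suc k). N v)" using C NM by (intro mult_pos_pos prod_pos) auto
    show "M v / N v \<in> Bx (Suc m) v" if "v \<in> lev (Suc (Suc (r - Suc m)))" for v
      using NM that by (auto simp: k_def)
    fix \<sigma> assume \<sigma>: "\<forall>v. v \<notin> inner \<longrightarrow> \<sigma> v = \<sigma>0 v"
    let ?hi = "\<Union>k\<in>{Suc (Suc k)..Suc r}. lev k"
    let ?P = "\<lambda>\<sigma>. \<Prod>k\<in>{Suc (Suc k)..Suc (Suc r)}. B k \<sigma>"
    have un: "(\<Union>k\<in>{Suc k..Suc r}. lev k) = lev (Suc k) \<union> ?hi"
    proof -
      have "{Suc k..Suc r} = insert (Suc k) {Suc (Suc k)..Suc r}" using k by auto
      thus ?thesis by auto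
    qed
    have fh: "finite ?hi" by (auto intro!: fin_lev)
    have dj: "lev (Suc k) \<inter> ?hi = {}" using not_in_levels[of _ "Suc k" "{Suc (Suc k)..Suc r}"] k by fastforce
    have pr: "(\<Prod>k\<in>{Suc k..Suc (Suc r)}. B k \<sigma>) = B (Suc k) \<sigma> * ?P \<sigma>" for \<sigma>
      using k by (subst prod.atLeast_Suc_atMost) auto
    have par_out: "par v \<notin> lev (Suc k)" "par v \<notin> ?hi" if "v \<in> lev (Suc k)" for v
    proof -
      have pk: "par v \<in> lev k" using par_lev[of k v] that k by simp
      thus "par v \<notin> lev (Suc k)" using lev_unique[of k "Suc k" "par v"] k by auto
      show "par v \<notin> ?hi" using pk k by (intro not_in_levels[of _ k]) auto
    qed
    have "spin_sum (\<Union>k\<in>{Suc k..Suc r}. lev k) (\<lambda>\<sigma>. \<Prod>k\<in>{Suc k..Suc (Suc r)}. B k \<sigma>) \<sigma>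
       = spin_sum (lev (Suc k)) (spin_sum ?hi (\<lambda>\<sigma>. B (Suc k) \<sigma> * ?P \<sigma>)) \<sigma>"
      unfolding un pr by (rule spin_sum_Un[OF fl(1) fh dj])
    also have "\<dots> = spin_sum (lev (Suc k)) (\<lambda>\<sigma>'. C * (\<Prod>v\<in>lev (Suc k).
        Om v (\<sigma>' v) * (1 + t * (ze (par v) (\<sigma> (par v)) * ze v (\<sigma>' v))) * (\<Prod>u\<in>ch v. 1 + t * (ze v (\<sigma>' v) * z u)))) \<sigma>"
    proof (rule spin_sum_cong)
      fix \<sigma>' assume \<sigma>': "\<And>v. v \<notin> lev (Suc k) \<Longrightarrow> \<sigma>' v = \<sigma> v"
      have in': "\<forall>v. v \<notin> inner \<longrightarrow> \<sigma>' v = \<sigma>0 v" 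
      proof (intro allI impI)
        fix v assume "v \<notin> inner"
        moreover have "lev (Suc k) \<subseteq> inner" using k by (auto simp: inner_def)
        ultimately show "\<sigma>' v = \<sigma>0 v" using \<sigma> \<sigma>' by auto
      qed
      have "spin_sum ?hi (\<lambda>\<sigma>. B (Suc k) \<sigma> * ?P \<sigma>) \<sigma>' = B (Suc k) \<sigma>' * spin_sum ?hi ?P \<sigma>'"
      proof (rule spin_sum_factor)
        fix \<tau> assume \<tau>: "\<And>v. v \<notin> ?hi \<Longrightarrow> \<tau> v = \<sigma>' v"
        have "\<tau> v = \<sigma>' v" "\<tau> (par v) = \<sigma>' (par v)" if "v \<in> lev (Suc k)" for v
          using \<tau> that dj par_out[OF that] by auto
        thus "B (Suc k) \<tau> = B (Suc k) \<sigma>'" unfolding B_def by (intro prod.cong) auto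
      qed
      also have "spin_sum ?hi ?P \<sigma>' = C * (\<Prod>v\<in>lev (Suc (Suc k)). 1 + t * (ze (par v) (\<sigma>' (par v)) * z v))"
        by (rule eq[OF in'])
      also have "(\<Prod>v\<in>lev (Suc (Suc k)). 1 + t * (ze (par v) (\<sigma>' (par v)) * z v))
         = (\<Prod>v\<in>lev (Suc k). \<Prod>u\<in>ch v. 1 + t * (ze (par u) (\<sigma>' (par u)) * z u))"
        unfolding ch_def using par_lev[of "Suc k"] k fl by (intro prod.group[symmetric]) auto
      also have "\<dots> = (\<Prod>v\<in>lev (Suc k). \<Prod>u\<in>ch v. 1 + t * (ze v (\<sigma>' v) * z u))"
        by (intro prod.cong refl) (auto simp: ch_def)
      also have "B (Suc k) \<sigma>' = (\<Prod>v\<in>lev (Suc k). Om v (\<sigma>' v) * (1 + t * (ze (par v) (\<sigma> (par v)) * ze v (\<sigma>' v))))"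
        unfolding B_def using k \<sigma>' par_out by (intro prod.cong) auto
      finally show "spin_sum ?hi (\<lambda>\<sigma>. B (Suc k) \<sigma> * ?P \<sigma>) \<sigma>' = C * (\<Prod>v\<in>lev (Suc k).
        Om v (\<sigma>' v) * (1 + t * (ze (par v) (\<sigma> (par v)) * ze v (\<sigma>' v))) * (\<Prod>u\<in>ch v. 1 + t * (ze v (\<sigma>' v) * z u)))"
        by (simp add: prod.distrib)
    qed
    also have "\<dots> = C * (\<Prod>v\<in>lev (Suc k). \<Sum>s\<in>UNIV.
        Om v s * (1 + t * (ze (par v) (\<sigma> (par v)) * ze v s)) * (\<Prod>u\<in>ch v. 1 + t * (ze v s * z u)))"
      unfolding spin_sum_cmult UNIV_bool
      by (subst spin_sum_prod[OF fl(1), where f = "\<lambda>v s. Om v s * (1 + t * (ze (par v) (\<sigma> (par v)) * ze v s)) * (\<Prod>u\<in>ch v. 1 + t * (ze v s * z u))"])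
         (simp add: add.commute)
    also have "\<dots> = C * (\<Prod>v\<in>lev (Suc k). N v * (1 + t * (ze (par v) (\<sigma> (par v)) * (M v / N v))))"
    proof -
      \<comment> \<open>Summing out the spin of \<open>v\<close> leaves an affine function of the
        parent's coordinate; \<open>M v / N v\<close> is the message that \<open>v\<close>
        sends.\<close>
      have "(\<Sum>s\<in>UNIV. Om v s * (1 + t * (x * ze v s)) * (\<Prod>u\<in>ch v. 1 + t * (ze v s * z u))) = N v + t * (x * M v)" for v x
        unfolding N_def M_def UNIV_bool by (simp add: algebra_simps)
      moreover have "N v + t * (x * M v) = N v * (1 + t * (x * (M v / N v)))" if "v \<in> lev (Suc k)" for v x
        using NM[OF that] by (simp add: field_simps)
      ultimately show ?thesis by simp
    qed
    finally show "spin_sum (\<Union>k\<in>{Suc (Suc (r - Suc m))..Suc r}. lev k) (\<lambda>\<sigma>. \<Prod>k\<in>{Suc (Suc (r - Suc m))..Suc (Suc r)}. B k \<sigma>) \<sigma>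
       = C * (\<Prod>v\<in>lev (Suc k). N v) * (\<Prod>v\<in>lev (Suc (Suc (r - Suc m))). 1 + t * (ze (par v) (\<sigma> (par v)) * (M v / N v)))"
      unfolding k_def[symmetric] by (simp add: prod.distrib)
  qed
qed

definition fac :: "nat \<times> nat \<Rightarrow> (nat \<Rightarrow> bool) \<Rightarrow> real" where
  "fac e \<sigma> = 1 + t * (ze (fst e) (\<sigma> (fst e)) * ze (snd e) (\<sigma> (snd e)))"

lemma fac_te: "fac (te v) \<sigma> = 1 + t * (ze (par v) (\<sigma> (par v)) * ze v (\<sigma> v))"
  by (cases "v \<le> par v") (auto simp: fac_def te_def min_def max_def mult.commute)

text \<open>If two different vertices had the same parent edge, each would be the parent of the
  other, which contradicts their levels.\<close>

lemma te_inj: "inj_on te (\<Union>k\<in>{1..Suc (Suc r)}. lev k)"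
proof (rule inj_onI)
  fix u v assume u: "u \<in> (\<Union>k\<in>{1..Suc (Suc r)}. lev k)" and v: "v \<in> (\<Union>k\<in>{1..Suc (Suc r)}. lev k)" and eq: "te u = te v"
  have ex: "\<exists>k. k \<le> Suc r \<and> w \<in> lev (Suc k)" if w: "w \<in> (\<Union>k\<in>{1..Suc (Suc r)}. lev k)" for w
  proof -
    from w obtain k where "k \<in> {1..Suc (Suc r)}" "w \<in> lev k" by blast
    thus ?thesis by (intro exI[of _ "k - 1"]) auto
  qed
  from ex[OF u] obtain k where k: "k \<le> Suc r" "u \<in> lev (Suc k)" by blast
  from ex[OF v] obtain l where l: "l \<le> Suc r" "v \<in> lev (Suc l)" by blast
  show "u = v"
  proof (rule ccontr)
    assume "u \<noteq> v"
    hence "u = par v" "v = par u" using eq unfolding te_def min_def max_def by (auto split: if_splits)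
    hence "u \<in> lev l" "v \<in> lev k" using par_lev[OF k] par_lev[OF l] by simp_all
    hence "Suc k = l" "Suc l = k" using lev_unique[of "Suc k" l u] lev_unique[of "Suc l" k v] k l by simp_all
    thus False by simp
  qed
qed

text \<open>Given the spins outside the tree, the two sums are a common nonnegative factor times
  \<open>x * y\<close> and \<open>1 + t * (x * y)\<close>, where \<open>x\<close> and
  \<open>y\<close> are the messages across the edge of \<open>j\<close>. The linear inequality
  between them survives summation over the surroundings.\<close>

lemma edge_estimate:
  assumes j: "j \<in> lev 1"
    and pos: "\<And>x y. x \<in> Bx (Suc (Suc r)) root \<Longrightarrow> y \<in> Bx (Suc r) j \<Longrightarrow> 0 \<le> \<alpha> * (x * y) + \<beta> * (1 + t * (x * y))"
  shows "0 \<le> \<alpha> * spin_sum V (\<lambda>\<sigma>. (ze (fst (te j)) (\<sigma> (fst (te j))) * ze (snd (te j)) (\<sigma> (snd (te j))))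
              * (\<Prod>e\<in>E - {te j}. fac e \<sigma>) * (\<Prod>v\<in>V. Om v (\<sigma> v))) \<sigma>0
           + \<beta> * spin_sum V (\<lambda>\<sigma>. (\<Prod>e\<in>E. fac e \<sigma>) * (\<Prod>v\<in>V. Om v (\<sigma> v))) \<sigma>0"
proof -
  define F where "F \<sigma> = \<alpha> * ((ze (fst (te j)) (\<sigma> (fst (te j))) * ze (snd (te j)) (\<sigma> (snd (te j))))
              * (\<Prod>e\<in>E - {te j}. fac e \<sigma>) * (\<Prod>v\<in>V. Om v (\<sigma> v)))
            + \<beta> * ((\<Prod>e\<in>E. fac e \<sigma>) * (\<Prod>v\<in>V. Om v (\<sigma> v)))" for \<sigma>
  \<comment> \<open>The factor of the edge of \<open>j\<close> is replaced by the linear combination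
    in question, so that the whole expression is again a product over the tree.\<close>
  define x where "x v s s' = (if v = j then \<alpha> * (ze root s * ze v s') + \<beta> * (1 + t * (ze root s * ze v s'))
     else 1 + t * (ze root s * ze v s'))" for v s s'
  let ?all = "\<Union>k\<in>{1..Suc (Suc r)}. lev k"
  define K where "K \<sigma> = (\<Prod>e\<in>E - te ` ?all. fac e \<sigma>) * (\<Prod>v\<in>V - inner. Om v (\<sigma> v))" for \<sigma>
  define hd where "hd \<sigma> = Om root (\<sigma> root) * (\<Prod>v\<in>lev 1. Om v (\<sigma> v) * x v (\<sigma> root) (\<sigma> v))" for \<sigma>
  let ?P = "\<lambda>\<sigma>. \<Prod>k\<in>{2..Suc (Suc r)}. B k \<sigma>"
  let ?hi = "\<Union>k\<in>{2..Suc r}. lev k"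
  have fl: "finite (lev k)" if "k \<le> Suc (Suc r)" for k using that by (rule fin_lev)
  have fl1: "finite (lev 1)" by (rule fl) simp
  have par1: "par v = root" if "v \<in> lev 1" for v using par_lev[of 0 v] that lev_0 by simp
  have finall: "finite ?all" by (auto intro!: fl)
  have teE: "te ` ?all \<subseteq> E"
  proof (rule image_subsetI)
    fix v assume "v \<in> ?all"
    then obtain k where "v \<in> lev k" "k \<in> {1..Suc (Suc r)}" by blast
    thus "te v \<in> E" using par_edge[of "k - 1" v] by (cases k) (auto simp: te_def)
  qed
  have lv: "lev k \<inter> lev l = {}" if "k \<noteq> l" "k \<le> Suc (Suc r)" "l \<le> Suc (Suc r)" for k l
    using lev_disj that by (metis Int_commute linorder_neqE_nat)
  have all1: "?all = lev 1 \<union> (\<Union>k\<in>{2..Suc (Suc r)}. lev k)"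
  proof -
    have "{1..Suc (Suc r)} = insert 1 {2..Suc (Suc r)}" by auto
    thus ?thesis by auto
  qed
  have inn: "inner = insert root (lev 1 \<union> ?hi)"
  proof -
    have "{..Suc r} = insert 0 (insert 1 {2..Suc r})" by auto
    thus ?thesis unfolding inner_def using lev_0 by auto
  qed
  have d1: "lev 1 \<inter> (\<Union>k\<in>{2..Suc (Suc r)}. lev k) = {}" using not_in_levels[of _ 1 "{2..Suc (Suc r)}"] by fastforce
  have d21: "root \<notin> lev 1" using lev_unique[of 0 1 root] lev_0 by auto
  have d22: "root \<notin> ?hi" using lev_0 by (intro not_in_levels[of _ 0]) auto
  have d23: "lev 1 \<inter> ?hi = {}"
  proof -
    have "?hi \<subseteq> (\<Union>k\<in>{2..Suc (Suc r)}. lev k)" by (intro UN_mono) auto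
    thus ?thesis using d1 by blast
  qed
  note d2 = d21 d22 d23
  have innV: "inner \<subseteq> V" unfolding inner_def using lev_V by (intro UN_least) auto
  have Fx: "F \<sigma> = K \<sigma> * (hd \<sigma> * ?P \<sigma>)" for \<sigma>
  proof -
    have jj: "te j \<in> E" using teE j all1 by blast
    have "F \<sigma> = x j (\<sigma> root) (\<sigma> j) * (\<Prod>e\<in>E - {te j}. fac e \<sigma>) * (\<Prod>v\<in>V. Om v (\<sigma> v))"
    proof -
      have "(\<Prod>e\<in>E. fac e \<sigma>) = fac (te j) \<sigma> * (\<Prod>e\<in>E - {te j}. fac e \<sigma>)"
        using jj finE by (rule prod.remove[rotated])
      moreover have "ze (fst (te j)) (\<sigma> (fst (te j))) * ze (snd (te j)) (\<sigma> (snd (te j))) = ze root (\<sigma> root) * ze j (\<sigma> j)"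
        using par1[OF j] by (cases "j \<le> root") (auto simp: te_def min_def max_def)
      moreover have "fac (te j) \<sigma> = 1 + t * (ze root (\<sigma> root) * ze j (\<sigma> j))" using par1[OF j] by (simp add: fac_te)
      ultimately show ?thesis unfolding F_def x_def by (simp add: algebra_simps)
    qed
    also have "(\<Prod>e\<in>E - {te j}. fac e \<sigma>) = (\<Prod>e\<in>E - te ` ?all. fac e \<sigma>) * (\<Prod>v\<in>?all - {j}. fac (te v) \<sigma>)"
    proof -
      have jall: "j \<in> ?all" using j all1 by blast
      have im: "te ` (?all - {j}) = te ` ?all - {te j}"
        using inj_on_image_set_diff[OF te_inj, of ?all "{j}"] jall by simp
      have aux: "X \<subseteq> E \<Longrightarrow> te j \<in> X \<Longrightarrow> E - {te j} = (E - X) \<union> (X - {te j})" for X by blast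
      have "E - {te j} = (E - te ` ?all) \<union> te ` (?all - {j})"
        unfolding im by (rule aux[OF teE imageI[OF jall]])
      moreover have "(E - te ` ?all) \<inter> te ` (?all - {j}) = {}" unfolding im by blast
      ultimately have "(\<Prod>e\<in>E - {te j}. fac e \<sigma>) = (\<Prod>e\<in>E - te ` ?all. fac e \<sigma>) * (\<Prod>e\<in>te ` (?all - {j}). fac e \<sigma>)"
        using finE finall by (simp add: prod.union_disjoint)
      also have "(\<Prod>e\<in>te ` (?all - {j}). fac e \<sigma>) = (\<Prod>v\<in>?all - {j}. fac (te v) \<sigma>)"
        by (subst prod.reindex) (auto intro: inj_on_subset[OF te_inj])
      finally show ?thesis .
    qed
    also have "(\<Prod>v\<in>?all - {j}. fac (te v) \<sigma>) = (\<Prod>v\<in>lev 1 - {j}. fac (te v) \<sigma>) * (\<Prod>k\<in>{2..Suc (Suc r)}. \<Prod>v\<in>lev k. fac (te v) \<sigma>)"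
    proof -
      have "?all - {j} = (lev 1 - {j}) \<union> (\<Union>k\<in>{2..Suc (Suc r)}. lev k)" using all1 d1 j by blast
      moreover have "(lev 1 - {j}) \<inter> (\<Union>k\<in>{2..Suc (Suc r)}. lev k) = {}" using d1 by blast
      moreover have "finite (\<Union>k\<in>{2..Suc (Suc r)}. lev k)" by (auto intro!: fl)
      ultimately have "(\<Prod>v\<in>?all - {j}. fac (te v) \<sigma>) = (\<Prod>v\<in>lev 1 - {j}. fac (te v) \<sigma>) * (\<Prod>v\<in>(\<Union>k\<in>{2..Suc (Suc r)}. lev k). fac (te v) \<sigma>)"
        using fl1 by (simp add: prod.union_disjoint)
      also have "(\<Prod>v\<in>(\<Union>k\<in>{2..Suc (Suc r)}. lev k). fac (te v) \<sigma>) = (\<Prod>k\<in>{2..Suc (Suc r)}. \<Prod>v\<in>lev k. fac (te v) \<sigma>)"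
        using lv by (intro prod.UNION_disjoint) (auto intro: fl)
      finally show ?thesis .
    qed
    also have "(\<Prod>v\<in>V. Om v (\<sigma> v)) = (\<Prod>v\<in>V - inner. Om v (\<sigma> v)) * (Om root (\<sigma> root) * ((\<Prod>v\<in>lev 1. Om v (\<sigma> v)) * (\<Prod>k\<in>{2..Suc r}. \<Prod>v\<in>lev k. Om v (\<sigma> v))))"
    proof -
      have "(\<Prod>v\<in>V. Om v (\<sigma> v)) = (\<Prod>v\<in>V - inner. Om v (\<sigma> v)) * (\<Prod>v\<in>inner. Om v (\<sigma> v))"
        using innV finV by (rule prod.subset_diff)
      also have "(\<Prod>v\<in>inner. Om v (\<sigma> v)) = Om root (\<sigma> root) * (\<Prod>v\<in>lev 1 \<union> ?hi. Om v (\<sigma> v))"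
        unfolding inn using d2 fl1 by (subst prod.insert) (auto intro!: fl)
      also have "(\<Prod>v\<in>lev 1 \<union> ?hi. Om v (\<sigma> v)) = (\<Prod>v\<in>lev 1. Om v (\<sigma> v)) * (\<Prod>v\<in>?hi. Om v (\<sigma> v))"
        using d2 fl1 by (intro prod.union_disjoint) (auto intro!: fl)
      also have "(\<Prod>v\<in>?hi. Om v (\<sigma> v)) = (\<Prod>k\<in>{2..Suc r}. \<Prod>v\<in>lev k. Om v (\<sigma> v))"
        using lv by (intro prod.UNION_disjoint) (auto intro: fl)
      finally show ?thesis .
    qed
    also have "x j (\<sigma> root) (\<sigma> j) * ((\<Prod>e\<in>E - te ` ?all. fac e \<sigma>) * ((\<Prod>v\<in>lev 1 - {j}. fac (te v) \<sigma>) * (\<Prod>k\<in>{2..Suc (Suc r)}. \<Prod>v\<in>lev k. fac (te v) \<sigma>)))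
        * ((\<Prod>v\<in>V - inner. Om v (\<sigma> v)) * (Om root (\<sigma> root) * ((\<Prod>v\<in>lev 1. Om v (\<sigma> v)) * (\<Prod>k\<in>{2..Suc r}. \<Prod>v\<in>lev k. Om v (\<sigma> v)))))
      = K \<sigma> * ((Om root (\<sigma> root) * ((\<Prod>v\<in>lev 1. Om v (\<sigma> v)) * (x j (\<sigma> root) (\<sigma> j) * (\<Prod>v\<in>lev 1 - {j}. fac (te v) \<sigma>))))
         * ((\<Prod>k\<in>{2..Suc r}. \<Prod>v\<in>lev k. Om v (\<sigma> v)) * (\<Prod>k\<in>{2..Suc (Suc r)}. \<Prod>v\<in>lev k. fac (te v) \<sigma>)))"
      unfolding K_def by (simp only: mult_ac)
    also have "x j (\<sigma> root) (\<sigma> j) * (\<Prod>v\<in>lev 1 - {j}. fac (te v) \<sigma>) = (\<Prod>v\<in>lev 1. x v (\<sigma> root) (\<sigma> v))"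
    proof -
      have "(\<Prod>v\<in>lev 1 - {j}. fac (te v) \<sigma>) = (\<Prod>v\<in>lev 1 - {j}. x v (\<sigma> root) (\<sigma> v))"
        by (intro prod.cong refl) (auto simp: fac_te x_def par1)
      thus ?thesis using prod.remove[OF fl1 j, of "\<lambda>v. x v (\<sigma> root) (\<sigma> v)"] by simp
    qed
    also have "(\<Prod>k\<in>{2..Suc r}. \<Prod>v\<in>lev k. Om v (\<sigma> v)) * (\<Prod>k\<in>{2..Suc (Suc r)}. \<Prod>v\<in>lev k. fac (te v) \<sigma>) = ?P \<sigma>"
    proof -
      have "(\<Prod>k\<in>{2..Suc r}. \<Prod>v\<in>lev k. Om v (\<sigma> v)) = (\<Prod>k\<in>{2..Suc (Suc r)}. \<Prod>v\<in>lev k. if k \<le> Suc r then Om v (\<sigma> v) else 1)"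
        by (simp add: prod.cl_ivl_Suc)
      thus ?thesis unfolding B_def by (simp add: prod.distrib fac_te)
    qed
    finally show ?thesis unfolding hd_def by (simp add: prod.distrib)
  qed
  \<comment> \<open>An edge with an endpoint in \<open>inner\<close> is a tree edge, so the
    remaining factors see only spins outside \<open>inner\<close>.\<close>
  have Kin: "K \<sigma>' = K \<sigma>" if ag: "\<And>v. v \<notin> inner \<Longrightarrow> \<sigma>' v = \<sigma> v" for \<sigma> \<sigma>'
  proof -
    have "fac e \<sigma>' = fac e \<sigma>" if e: "e \<in> E - te ` ?all" for e
    proof -
      have "v \<notin> inner" if v: "v = fst e \<or> v = snd e" for v
      proof
        assume "v \<in> inner"
        then obtain k where "k \<le> Suc r" "v \<in> lev k" by (auto simp: inner_def)
        then obtain k' v' where "k' \<le> Suc r" "v' \<in> lev (Suc k')" "e = te v'"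
          using edge_par[of k v "fst e" "snd e"] v e unfolding te_def by (metis DiffD1 prod.collapse)
        moreover have "v' \<in> ?all" using calculation by force
        ultimately show False using e by blast
      qed
      thus ?thesis unfolding fac_def using ag by simp
    qed
    thus ?thesis unfolding K_def using ag by (intro arg_cong2[where f = "(*)"] prod.cong) auto
  qed
  have K0: "K \<sigma> \<ge> 0" for \<sigma>
    unfolding K_def using Om0 edge_nonneg by (intro mult_nonneg_nonneg prod_nonneg) (auto simp: fac_def less_imp_le)
  have main: "0 \<le> spin_sum inner F \<sigma>" for \<sigma>
  proof -
    obtain C z where C: "C > 0" and z: "\<And>v. v \<in> lev 2 \<Longrightarrow> z v \<in> Bx r v"
      and eq: "\<And>\<tau>. (\<forall>v. v \<notin> inner \<longrightarrow> \<tau> v = \<sigma> v) \<Longrightarrow>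
        spin_sum ?hi ?P \<tau> = C * (\<Prod>v\<in>lev 2. 1 + t * (ze (par v) (\<tau> (par v)) * z v))"
      using eliminate_levels[of r \<sigma>] by (auto simp: numeral_2_eq_2)
    define ch where "ch v = {u\<in>lev 2. par u = v}" for v
    define N where "N v = (\<Sum>s\<in>UNIV. Om v s * (\<Prod>u\<in>ch v. 1 + t * (ze v s * z u)))" for v
    define M where "M v = (\<Sum>s\<in>UNIV. Om v s * ze v s * (\<Prod>u\<in>ch v. 1 + t * (ze v s * z u)))" for v
    define y where "y v = M v / N v" for v
    have NM: "N v > 0" "y v \<in> Bx (Suc r) v" if "v \<in> lev 1" for v
      using box_step[of 0 v z r] that z unfolding N_def M_def ch_def y_def by (auto simp: numeral_2_eq_2)
    define xN where "xN v s = (if v = j then \<alpha> * (ze root s * y v) + \<beta> * (1 + t * (ze root s * y v)) else 1 + t * (ze root s * y v))" for v s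
    have xsum: "(\<Sum>s'\<in>UNIV. Om v s' * x v s s' * (\<Prod>u\<in>ch v. 1 + t * (ze v s' * z u))) = N v * xN v s" if "v \<in> lev 1" for v s
    proof -
      have e1: "M v = N v * y v" using NM(1)[OF that] by (simp add: y_def)
      have e2: "(\<Sum>s'\<in>UNIV. Om v s' * x v s s' * (\<Prod>u\<in>ch v. 1 + t * (ze v s' * z u)))
         = (if v = j then \<alpha> * (ze root s * M v) + \<beta> * (N v + t * (ze root s * M v)) else N v + t * (ze root s * M v))"
        unfolding N_def M_def UNIV_bool x_def by (simp add: algebra_simps)
      show ?thesis unfolding e2 xN_def e1 by (simp add: algebra_simps)
    qed
    have l2: "finite (lev 2)" by (rule fl) simp
    have fh: "finite ?hi" by (auto intro!: fl)
    have step2: "spin_sum ?hi (\<lambda>\<sigma>. hd \<sigma> * ?P \<sigma>) \<tau>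
        = C * (Om root (\<tau> root) * (\<Prod>v\<in>lev 1. Om v (\<tau> v) * x v (\<tau> root) (\<tau> v) * (\<Prod>u\<in>ch v. 1 + t * (ze v (\<tau> v) * z u))))"
      if \<tau>: "\<forall>v. v \<notin> inner \<longrightarrow> \<tau> v = \<sigma> v" for \<tau>
    proof -
      have "spin_sum ?hi (\<lambda>\<sigma>. hd \<sigma> * ?P \<sigma>) \<tau> = hd \<tau> * spin_sum ?hi ?P \<tau>"
      proof (rule spin_sum_factor)
        fix \<rho> assume \<rho>: "\<And>v. v \<notin> ?hi \<Longrightarrow> \<rho> v = \<tau> v"
        have "\<rho> root = \<tau> root" "\<And>v. v \<in> lev 1 \<Longrightarrow> \<rho> v = \<tau> v" using \<rho> d2 by blast+
        thus "hd \<rho> = hd \<tau>" unfolding hd_def by simp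
      qed
      also have "spin_sum ?hi ?P \<tau> = C * (\<Prod>v\<in>lev 2. 1 + t * (ze (par v) (\<tau> (par v)) * z v))" by (rule eq[OF \<tau>])
      also have "(\<Prod>v\<in>lev 2. 1 + t * (ze (par v) (\<tau> (par v)) * z v)) = (\<Prod>v\<in>lev 1. \<Prod>u\<in>ch v. 1 + t * (ze (par u) (\<tau> (par u)) * z u))"
        unfolding ch_def using par_lev[of 1] fl1 l2 by (intro prod.group[symmetric]) (auto simp: numeral_2_eq_2)
      also have "\<dots> = (\<Prod>v\<in>lev 1. \<Prod>u\<in>ch v. 1 + t * (ze v (\<tau> v) * z u))"
        by (intro prod.cong refl) (auto simp: ch_def)
      finally show ?thesis unfolding hd_def by (simp add: prod.distrib mult_ac)
    qed
    have inn2: "inner = insert root (lev 1) \<union> ?hi" using inn by auto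
    have "spin_sum inner F \<sigma> = K \<sigma> * spin_sum (insert root (lev 1) \<union> ?hi) (\<lambda>\<sigma>. hd \<sigma> * ?P \<sigma>) \<sigma>"
      unfolding inn2[symmetric] Fx[abs_def] by (intro spin_sum_factor Kin)
    also have "spin_sum (insert root (lev 1) \<union> ?hi) (\<lambda>\<sigma>. hd \<sigma> * ?P \<sigma>) \<sigma>
       = spin_sum (insert root (lev 1)) (spin_sum ?hi (\<lambda>\<sigma>. hd \<sigma> * ?P \<sigma>)) \<sigma>"
      using fl1 fh d2 by (intro spin_sum_Un) auto
    also have "\<dots> = spin_sum (insert root (lev 1)) (\<lambda>\<tau>. C * (Om root (\<tau> root) * (\<Prod>v\<in>lev 1. Om v (\<tau> v) * x v (\<tau> root) (\<tau> v) * (\<Prod>u\<in>ch v. 1 + t * (ze v (\<tau> v) * z u))))) \<sigma>"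
      by (intro spin_sum_cong step2) (auto simp: inn)
    also have "\<dots> = C * (\<Sum>s\<in>UNIV. Om root s * (\<Prod>v\<in>lev 1. N v * xN v s))"
    proof -
      have "spin_sum (lev 1) (\<lambda>\<tau>. Om root (\<tau> root) * (\<Prod>v\<in>lev 1. Om v (\<tau> v) * x v (\<tau> root) (\<tau> v) * (\<Prod>u\<in>ch v. 1 + t * (ze v (\<tau> v) * z u)))) (\<sigma>(root := s))
         = Om root s * (\<Prod>v\<in>lev 1. N v * xN v s)" for s
      proof -
        have "spin_sum (lev 1) (\<lambda>\<tau>. Om root (\<tau> root) * (\<Prod>v\<in>lev 1. Om v (\<tau> v) * x v (\<tau> root) (\<tau> v) * (\<Prod>u\<in>ch v. 1 + t * (ze v (\<tau> v) * z u)))) (\<sigma>(root := s))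
          = spin_sum (lev 1) (\<lambda>\<tau>. Om root s * (\<Prod>v\<in>lev 1. Om v (\<tau> v) * x v s (\<tau> v) * (\<Prod>u\<in>ch v. 1 + t * (ze v (\<tau> v) * z u)))) (\<sigma>(root := s))"
          using d2(1) by (intro spin_sum_cong) simp
        also have "\<dots> = Om root s * (\<Prod>v\<in>lev 1. \<Sum>s'\<in>UNIV. Om v s' * x v s s' * (\<Prod>u\<in>ch v. 1 + t * (ze v s' * z u)))"
          unfolding spin_sum_cmult UNIV_bool
          by (subst spin_sum_prod[OF fl1, where f = "\<lambda>v s'. Om v s' * x v s s' * (\<Prod>u\<in>ch v. 1 + t * (ze v s' * z u))"])
             (simp add: add.commute)
        finally show ?thesis by (simp add: xsum)
      qed
      thus ?thesis unfolding spin_sum_cmult spin_sum_insert[OF fl1 d2(1)] UNIV_bool by simp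
    qed
    also have "(\<Sum>s\<in>UNIV. Om root s * (\<Prod>v\<in>lev 1. N v * xN v s)) = (\<Prod>v\<in>lev 1. N v) * (\<Sum>s\<in>UNIV. Om root s * (\<Prod>v\<in>lev 1. xN v s))"
      by (simp add: prod.distrib sum_distrib_left mult_ac)
    also have "(\<Sum>s\<in>UNIV. Om root s * (\<Prod>v\<in>lev 1. xN v s))
       = (\<Sum>s\<in>UNIV. Om root s * (\<alpha> * (ze root s * y j) + \<beta> * (1 + t * (ze root s * y j))) * (\<Prod>u\<in>lev 1 - {j}. 1 + t * (ze root s * y u)))"
      unfolding prod.remove[OF fl1 j] xN_def by (intro sum.cong refl) (auto intro!: prod.cong)
    finally have total: "spin_sum inner F \<sigma> = K \<sigma> * (C * ((\<Prod>v\<in>lev 1. N v) * \<dots>))" .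
    define Q where "Q = (\<Sum>s\<in>UNIV. Om root s * (\<Prod>u\<in>lev 1 - {j}. 1 + t * (ze root s * y u)))"
    \<comment> \<open>The message from the root to \<open>j\<close>; therefore the product omits
      \<open>j\<close>.\<close>
    define w where "w = (\<Sum>s\<in>UNIV. Om root s * ze root s * (\<Prod>u\<in>lev 1 - {j}. 1 + t * (ze root s * y u))) / Q"
    have Q: "Q > 0" "w \<in> Bx (Suc (Suc r)) root" using box_root[OF j NM(2)] unfolding Q_def w_def by auto
    have wQ: "(\<Sum>s\<in>UNIV. Om root s * ze root s * (\<Prod>u\<in>lev 1 - {j}. 1 + t * (ze root s * y u))) = Q * w" using Q(1) by (simp add: w_def)
    have "(\<Sum>s\<in>UNIV. Om root s * (\<alpha> * (ze root s * y j) + \<beta> * (1 + t * (ze root s * y j))) * (\<Prod>u\<in>lev 1 - {j}. 1 + t * (ze root s * y u)))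
       = \<alpha> * (Q * w * y j) + \<beta> * (Q + t * (Q * w * y j))"
      unfolding wQ[symmetric] unfolding Q_def UNIV_bool by (simp add: algebra_simps)
    also have "\<dots> = Q * (\<alpha> * (w * y j) + \<beta> * (1 + t * (w * y j)))" by (simp add: algebra_simps)
    also have "\<dots> \<ge> 0" using Q pos[OF Q(2) NM(2)[OF j]] by simp
    finally show ?thesis unfolding total using K0 C NM(1) by (intro mult_nonneg_nonneg prod_nonneg) (auto simp: less_imp_le)
  qed
  have "V = (V - inner) \<union> inner" using innV by auto
  hence "spin_sum V F \<sigma>0 = spin_sum (V - inner) (spin_sum inner F) \<sigma>0"
    using spin_sum_Un[of "V - inner" inner F \<sigma>0] finV innV by (metis Diff_disjoint Int_commute finite_Diff finite_subset)
  also have "\<dots> \<ge> 0" unfolding spin_sum_def[of "V - inner"] by (intro sum_nonneg main)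
  finally show ?thesis unfolding F_def spin_sum_add spin_sum_cmult by simp
qed

end

section \<open>Removing vertices and edges from a partition function\<close>

definition wsum :: "'v set \<Rightarrow> ('v \<times> 'v) set \<Rightarrow> ('v \<times> 'v \<Rightarrow> bool \<Rightarrow> bool \<Rightarrow> real) \<Rightarrow> ('v \<Rightarrow> bool \<Rightarrow> real) \<Rightarrow> real" where
  "wsum V E ew vw = spin_sum V (\<lambda>\<sigma>. (\<Prod>e\<in>E. ew e (\<sigma> (fst e)) (\<sigma> (snd e))) * (\<Prod>v\<in>V. vw v (\<sigma> v))) (\<lambda>_. False)"

definition incident :: "('v \<times> 'v) set \<Rightarrow> 'v \<Rightarrow> ('v \<times> 'v) set" where
  "incident E v = {e\<in>E. fst e = v \<or> snd e = v}"

lemma finite_incident: "finite E \<Longrightarrow> finite (incident E v)"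
  by (simp add: incident_def)

text \<open>\<open>fs\<close> is a free spin: every edge weight involving it is at least
  \<open>\<delta>\<close>, whereas two copies of the other spin may have weight zero.\<close>

locale weights =
  fixes V :: "'v set" and E :: "('v \<times> 'v) set" and ew :: "'v \<times> 'v \<Rightarrow> bool \<Rightarrow> bool \<Rightarrow> real"
    and vw :: "'v \<Rightarrow> bool \<Rightarrow> real" and fs :: bool and M \<delta> \<kappa> :: real
  assumes finV: "finite V" and finE: "finite E" and EV: "\<And>e. e \<in> E \<Longrightarrow> fst e \<in> V \<and> snd e \<in> V"
    and ew_nonneg: "\<And>e s s'. e \<in> E \<Longrightarrow> 0 \<le> ew e s s'" and ew_le: "\<And>e s s'. e \<in> E \<Longrightarrow> ew e s s' \<le> M"
    and \<delta>0: "0 < \<delta>" "\<delta> \<le> 1" and M1: "M \<ge> 1"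
    and ew_fs: "\<And>e s. e \<in> E \<Longrightarrow> \<delta> \<le> ew e fs s" "\<And>e s. e \<in> E \<Longrightarrow> \<delta> \<le> ew e s fs"
    and vw0: "\<And>v s. v \<in> V \<Longrightarrow> vw v s > 0" and vw_le: "\<And>v s. v \<in> V \<Longrightarrow> vw v s \<le> \<kappa> * vw v fs"
begin

lemma sub_weights: "E' \<subseteq> E \<Longrightarrow> weights V E' ew vw fs M \<delta> \<kappa>"
  using finV finE EV ew_nonneg ew_le \<delta>0 M1 ew_fs vw0 vw_le finite_subset
  by unfold_locales blast+

lemma weight_nonneg: "0 \<le> (\<Prod>e\<in>E. ew e (\<sigma> (fst e)) (\<sigma> (snd e))) * (\<Prod>v\<in>V. vw v (\<sigma> v))"
  using ew_nonneg vw0 by (intro mult_nonneg_nonneg prod_nonneg) (auto simp: less_imp_le)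

lemma wsum_pos: "wsum V E ew vw > 0"
  unfolding wsum_def
proof (rule spin_sum_pos[OF finV weight_nonneg])
  let ?\<sigma> = "\<lambda>v. if v \<in> V then fs else False"
  show "0 < (\<Prod>e\<in>E. ew e (?\<sigma> (fst e)) (?\<sigma> (snd e))) * (\<Prod>v\<in>V. vw v (?\<sigma> v))"
    using EV ew_fs \<delta>0 vw0 by (intro mult_pos_pos prod_pos) (auto intro: less_le_trans)
qed auto

lemma wsum_remove_le:
  assumes "E' \<subseteq> E" shows "wsum V E ew vw \<le> M ^ card E' * wsum V (E - E') ew vw"
  unfolding wsum_def spin_sum_cmult[symmetric]
proof (rule spin_sum_mono)
  fix \<sigma>
  interpret s: weights V "E - E'" ew vw fs M \<delta> \<kappa> by (rule sub_weights) auto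
  have "(\<Prod>e\<in>E. ew e (\<sigma> (fst e)) (\<sigma> (snd e))) = (\<Prod>e\<in>E - E'. ew e (\<sigma> (fst e)) (\<sigma> (snd e))) * (\<Prod>e\<in>E'. ew e (\<sigma> (fst e)) (\<sigma> (snd e)))"
    using assms finE by (rule prod.subset_diff)
  moreover have "(\<Prod>e\<in>E'. ew e (\<sigma> (fst e)) (\<sigma> (snd e))) \<le> M ^ card E'"
  proof -
    have "(\<Prod>e\<in>E'. ew e (\<sigma> (fst e)) (\<sigma> (snd e))) \<le> (\<Prod>e\<in>E'. M)"
      using assms ew_nonneg ew_le by (intro prod_mono) blast
    thus ?thesis by simp
  qed
  ultimately show "(\<Prod>e\<in>E. ew e (\<sigma> (fst e)) (\<sigma> (snd e))) * (\<Prod>v\<in>V. vw v (\<sigma> v))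
     \<le> M ^ card E' * ((\<Prod>e\<in>E - E'. ew e (\<sigma> (fst e)) (\<sigma> (snd e))) * (\<Prod>v\<in>V. vw v (\<sigma> v)))"
    using s.weight_nonneg[of \<sigma>] mult_right_mono[of "\<Prod>e\<in>E'. ew e (\<sigma> (fst e)) (\<sigma> (snd e))" "M ^ card E'"
        "(\<Prod>e\<in>E - E'. ew e (\<sigma> (fst e)) (\<sigma> (snd e))) * (\<Prod>v\<in>V. vw v (\<sigma> v))"] by (simp add: mult_ac)
qed

text \<open>Resetting \<open>v\<close> to the free spin makes all its edge weights at least
  \<open>\<delta>\<close>; the factor \<open>2 * \<kappa>\<close> pays for the two values that its
  spin could take.\<close>

lemma wsum_remove_ge:
  assumes v: "v \<in> V"
  shows "wsum V (E - incident E v) ew vw \<le> 2 * \<kappa> * (1 / \<delta>) ^ card (incident E v) * wsum V E ew vw"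
  unfolding wsum_def
proof (rule spin_sum_compare[OF finV v])
  fix \<sigma>
  let ?W = "\<lambda>E \<sigma>. (\<Prod>e\<in>E. ew e (\<sigma> (fst e)) (\<sigma> (snd e))) * (\<Prod>v\<in>V. vw v (\<sigma> v))"
  let ?k = "card (incident E v)"
  interpret s: weights V "E - incident E v" ew vw fs M \<delta> \<kappa> by (rule sub_weights) auto
  define \<rho> where "\<rho> = (\<Prod>e\<in>E - incident E v. ew e (\<sigma> (fst e)) (\<sigma> (snd e))) * (\<Prod>u\<in>V - {v}. vw u (\<sigma> u))"
  have \<rho>0: "\<rho> \<ge> 0" unfolding \<rho>_def using ew_nonneg vw0 by (intro mult_nonneg_nonneg prod_nonneg) (auto simp: less_imp_le)
  have V': "(\<Prod>u\<in>V. vw u ((\<sigma>(v := s)) u)) = vw v s * (\<Prod>u\<in>V - {v}. vw u (\<sigma> u))" for s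
    using prod.remove[OF finV v, of "\<lambda>u. vw u ((\<sigma>(v := s)) u)"] by simp
  have E': "(\<Prod>e\<in>E - incident E v. ew e ((\<sigma>(v := s)) (fst e)) ((\<sigma>(v := s)) (snd e))) = (\<Prod>e\<in>E - incident E v. ew e (\<sigma> (fst e)) (\<sigma> (snd e)))" for s
    by (intro prod.cong) (auto simp: incident_def)
  have 1: "?W (E - incident E v) (\<sigma>(v := s)) = \<rho> * vw v s" for s
    unfolding V' E' \<rho>_def by (simp add: mult_ac)
  have 2: "?W E (\<sigma>(v := fs)) \<ge> \<rho> * vw v fs * \<delta> ^ ?k"
  proof -
    have sub: "incident E v \<subseteq> E" by (auto simp: incident_def)
    have "?W E (\<sigma>(v := fs)) = ?W (E - incident E v) (\<sigma>(v := fs)) * (\<Prod>e\<in>incident E v. ew e ((\<sigma>(v := fs)) (fst e)) ((\<sigma>(v := fs)) (snd e)))"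
      unfolding prod.subset_diff[OF sub finE] by (simp only: mult_ac)
    also have "\<dots> = \<rho> * vw v fs * (\<Prod>e\<in>incident E v. ew e ((\<sigma>(v := fs)) (fst e)) ((\<sigma>(v := fs)) (snd e)))" unfolding 1 ..
    also have "\<dots> \<ge> \<rho> * vw v fs * \<delta> ^ ?k"
    proof (rule mult_left_mono)
      show "\<delta> ^ ?k \<le> (\<Prod>e\<in>incident E v. ew e ((\<sigma>(v := fs)) (fst e)) ((\<sigma>(v := fs)) (snd e)))"
      proof -
        have "(\<Prod>e\<in>incident E v. \<delta>) \<le> (\<Prod>e\<in>incident E v. ew e ((\<sigma>(v := fs)) (fst e)) ((\<sigma>(v := fs)) (snd e)))"
        proof (intro prod_mono conjI)
          fix e assume "e \<in> incident E v"
          hence "e \<in> E" "fst e = v \<or> snd e = v" by (auto simp: incident_def)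
          thus "\<delta> \<le> ew e ((\<sigma>(v := fs)) (fst e)) ((\<sigma>(v := fs)) (snd e))"
            using ew_fs(1)[of e] ew_fs(2)[of e] by auto
        qed (use \<delta>0 in simp)
        thus ?thesis by simp
      qed
      show "0 \<le> \<rho> * vw v fs" using \<rho>0 vw0[OF v] by (simp add: less_imp_le)
    qed
    finally show ?thesis .
  qed
  have "?W (E - incident E v) (\<sigma>(v := True)) + ?W (E - incident E v) (\<sigma>(v := False)) = \<rho> * (vw v True + vw v False)"
    unfolding 1 by (simp add: distrib_left)
  also have "\<dots> \<le> \<rho> * (2 * \<kappa> * vw v fs)" using \<rho>0 vw_le[OF v, of True] vw_le[OF v, of False] by (intro mult_left_mono) auto
  also have "\<dots> = 2 * \<kappa> * (1 / \<delta>) ^ ?k * (\<rho> * vw v fs * \<delta> ^ ?k)" using \<delta>0 by (simp add: power_divide)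
  also have "\<dots> \<le> 2 * \<kappa> * (1 / \<delta>) ^ ?k * (?W E (\<sigma>(v := True)) + ?W E (\<sigma>(v := False)))"
  proof (rule mult_left_mono)
    define X where "X s = ?W E (\<sigma>(v := s))" for s
    have X0: "X s \<ge> 0" for s unfolding X_def by (rule weight_nonneg)
    have "\<rho> * vw v fs * \<delta> ^ ?k \<le> X fs" using 2 unfolding X_def .
    also have "X fs \<le> X True + X False" using X0[of True] X0[of False] by (cases fs) auto
    finally show "\<rho> * vw v fs * \<delta> ^ ?k \<le> ?W E (\<sigma>(v := True)) + ?W E (\<sigma>(v := False))"
      unfolding X_def .
    have "\<kappa> \<ge> 0" using vw_le[OF v, of fs] vw0[OF v, of fs] by (simp add: zero_less_mult_iff)
    thus "0 \<le> 2 * \<kappa> * (1 / \<delta>) ^ ?k" using \<delta>0 by simp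
  qed
  finally show "?W (E - incident E v) (\<sigma>(v := True)) + ?W (E - incident E v) (\<sigma>(v := False))
     \<le> 2 * \<kappa> * (1 / \<delta>) ^ ?k * (?W E (\<sigma>(v := True)) + ?W E (\<sigma>(v := False)))" .
qed

lemma kappa1: "V \<noteq> {} \<Longrightarrow> \<kappa> \<ge> 1"
  using vw_le[of _ fs] vw0[of _ fs] by (metis all_not_in_conv mult_le_cancel_right1 not_less)

text \<open>The weight of a single edge may vanish, so its removal cannot be undone directly. All
  edges at one endpoint are dropped instead, and then restored through the free spin.\<close>

lemma wsum_remove_edge_le:
  assumes e: "e \<in> E"
  shows "wsum V (E - {e}) ew vw \<le> 2 * \<kappa> * (M / \<delta>) ^ card (incident E (fst e)) * wsum V E ew vw"
proof -
  let ?v = "fst e" let ?I = "incident E ?v"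
  have v: "?v \<in> V" using EV e by auto
  interpret s: weights V "E - {e}" ew vw fs M \<delta> \<kappa> by (rule sub_weights) auto
  interpret s2: weights V "E - ?I" ew vw fs M \<delta> \<kappa> by (rule sub_weights) auto
  have eI: "e \<in> ?I" using e by (simp add: incident_def)
  have fI: "finite ?I" using finE by (rule finite_incident)
  have "wsum V (E - {e}) ew vw \<le> M ^ card (?I - {e}) * wsum V (E - {e} - (?I - {e})) ew vw"
    by (rule s.wsum_remove_le) (auto simp: incident_def)
  also have "E - {e} - (?I - {e}) = E - ?I" using eI by auto
  also have "M ^ card (?I - {e}) * wsum V (E - ?I) ew vw \<le> M ^ card ?I * wsum V (E - ?I) ew vw"
    using M1 s2.wsum_pos fI by (intro mult_right_mono power_increasing card_mono) auto
  also have "\<dots> \<le> M ^ card ?I * (2 * \<kappa> * (1 / \<delta>) ^ card ?I * wsum V E ew vw)"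
    using wsum_remove_ge[OF v] M1 by (intro mult_left_mono) auto
  also have "\<dots> = 2 * \<kappa> * (M / \<delta>) ^ card ?I * wsum V E ew vw" by (simp add: power_divide)
  finally show ?thesis .
qed

text \<open>Vertices are cut off one at a time, and the number of edges remaining at each is at most
  its original degree. The cost is linear in the degree, which is the form that uniform sparsity
  controls.\<close>

lemma ln_wsum_remove_vertices:
  assumes S: "finite S" "S \<subseteq> V" and C: "ln M \<le> C" "ln (2 * \<kappa>) \<le> C" "ln (1 / \<delta>) \<le> C"
  shows "\<bar>ln (wsum V E ew vw) - ln (wsum V (E - (\<Union>v\<in>S. incident E v)) ew vw)\<bar>
     \<le> C * (\<Sum>v\<in>S. real (card (incident E v)) + 1)"
  using S
proof (induction S rule: finite_induct)
  case empty thus ?case by simp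
next
  case (insert v S)
  let ?E = "E - (\<Union>v\<in>S. incident E v)"
  interpret s: weights V ?E ew vw fs M \<delta> \<kappa> by (rule sub_weights) auto
  interpret s': weights V "?E - incident ?E v" ew vw fs M \<delta> \<kappa> by (rule sub_weights) auto
  have v: "v \<in> V" using insert by auto
  have eq: "E - (\<Union>v\<in>insert v S. incident E v) = ?E - incident ?E v" by (auto simp: incident_def)
  let ?k = "card (incident ?E v)"
  have k: "?k \<le> card (incident E v)" using finE by (intro card_mono finite_incident) (auto simp: incident_def)
  have C0: "C \<ge> 0" using C(1) M1 ln_ge_zero[of M] by linarith
  have kp: "\<kappa> \<ge> 1" using kappa1 v by auto
  have p: "wsum V ?E ew vw > 0" "wsum V (?E - incident ?E v) ew vw > 0" by (rule s.wsum_pos, rule s'.wsum_pos)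
  have "ln (wsum V ?E ew vw) \<le> ln (M ^ ?k * wsum V (?E - incident ?E v) ew vw)"
    using s.wsum_remove_le[of "incident ?E v"] p M1 by (subst ln_le_cancel_iff) (auto simp: incident_def)
  also have "\<dots> = ?k * ln M + ln (wsum V (?E - incident ?E v) ew vw)"
    using p M1 by (simp add: ln_mult ln_realpow)
  also have "\<dots> \<le> C * (real ?k + 1) + ln (wsum V (?E - incident ?E v) ew vw)"
    using mult_left_mono[OF C(1), of "real ?k"] C0 by (simp add: algebra_simps)
  finally have 1: "ln (wsum V ?E ew vw) - ln (wsum V (?E - incident ?E v) ew vw) \<le> C * (real ?k + 1)" by simp
  have "ln (wsum V (?E - incident ?E v) ew vw) \<le> ln (2 * \<kappa> * (1 / \<delta>) ^ ?k * wsum V ?E ew vw)"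
    using s.wsum_remove_ge[OF v] p kp \<delta>0 by (subst ln_le_cancel_iff) auto
  also have "\<dots> = ln (2 * \<kappa>) + ?k * ln (1 / \<delta>) + ln (wsum V ?E ew vw)"
  proof -
    have "ln (2 * \<kappa> * (1 / \<delta>) ^ ?k * wsum V ?E ew vw) = ln (2 * \<kappa> * (1 / \<delta>) ^ ?k) + ln (wsum V ?E ew vw)"
      using p kp \<delta>0 by (intro ln_mult_pos) auto
    also have "ln (2 * \<kappa> * (1 / \<delta>) ^ ?k) = ln (2 * \<kappa>) + ln ((1 / \<delta>) ^ ?k)"
      using kp \<delta>0 by (intro ln_mult_pos) auto
    also have "ln ((1 / \<delta>) ^ ?k) = ?k * ln (1 / \<delta>)" by (rule ln_realpow)
    finally show ?thesis .
  qed
  also have "\<dots> \<le> C * (real ?k + 1) + ln (wsum V ?E ew vw)"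
    using mult_left_mono[OF C(3), of "real ?k"] C(2) by (simp add: algebra_simps)
  finally have 2: "ln (wsum V (?E - incident ?E v) ew vw) - ln (wsum V ?E ew vw) \<le> C * (real ?k + 1)" by simp
  have "C * (real ?k + 1) \<le> C * (real (card (incident E v)) + 1)" using k C0 by (intro mult_left_mono) auto
  moreover have "C * (\<Sum>v\<in>insert v S. real (card (incident E v)) + 1)
      = C * (real (card (incident E v)) + 1) + C * (\<Sum>v\<in>S. real (card (incident E v)) + 1)"
    using insert by (simp add: distrib_left)
  ultimately show ?case unfolding eq using 1 2 insert by (simp add: abs_le_iff)
qed

end

section \<open>Levels of a tree ball\<close>

lemma dist_le_mono: "dist_le G k v x \<Longrightarrow> k \<le> l \<Longrightarrow> dist_le G l v x"
  by (induction l) (auto simp: le_Suc_eq)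

locale tree_ball_iso =
  fixes d N :: nat and G :: graph and v :: nat and f :: "nat \<Rightarrow> nat list"
  assumes iso: "ball_iso d N G v f" and sym: "\<And>x y. G x y \<longleftrightarrow> G y x" and d2: "d \<ge> 2"
begin

text \<open>The length of the word serves as the distance from the root; \<open>lev_dist\<close>
  relates it to paths in \<open>G\<close>, which keeps neighbours of inner vertices inside the
  ball.\<close>

definition lev :: "nat \<Rightarrow> nat set" where "lev k = {x\<in>ball G N v. length (f x) = k}"

definition par :: "nat \<Rightarrow> nat" where "par x = inv_into (ball G N v) f (butlast (f x))"

definition ch :: "nat \<Rightarrow> nat set" where "ch x = {u\<in>lev (Suc (length (f x))). par u = x}"

lemma bij: "bij_betw f (ball G N v) (tree_ball d N)" and root: "f v = []"
  and adj: "x \<in> ball G N v \<Longrightarrow> y \<in> ball G N v \<Longrightarrow> G x y \<longleftrightarrow> tree_adj (f x) (f y)"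
  using iso by (auto simp: ball_iso_def)

lemma inj: "inj_on f (ball G N v)" using bij by (rule bij_betw_imp_inj_on)

lemma f_mem: "x \<in> ball G N v \<Longrightarrow> f x \<in> tree_ball d N" using bij by (auto dest: bij_betwE)

lemma ex_preimage: "ws \<in> tree_ball d N \<Longrightarrow> \<exists>x\<in>ball G N v. f x = ws"
  using bij unfolding bij_betw_def by (metis imageE)

lemma root_mem: "v \<in> ball G N v"
  using dist_le_mono[of G 0 v v N] by (simp add: ball_def)

lemma lev_0: "lev 0 = {v}"
  using inj root root_mem by (auto simp: lev_def inj_on_def)

lemma butlast_tree_ball: "ws \<in> tree_ball d N \<Longrightarrow> butlast ws \<in> tree_ball d N"
  by (auto simp: tree_ball_def nth_butlast)

lemma par_props:
  assumes "x \<in> ball G N v" "f x \<noteq> []"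
  shows "par x \<in> ball G N v" "f (par x) = butlast (f x)" "G (par x) x"
proof -
  have "butlast (f x) \<in> f ` ball G N v"
    using ex_preimage[OF butlast_tree_ball[OF f_mem[OF assms(1)]]] by (metis imageI)
  thus 1: "par x \<in> ball G N v" "f (par x) = butlast (f x)"
    unfolding par_def by (auto intro: inv_into_into f_inv_into_f)
  have "tree_adj (f (par x)) (f x)"
    unfolding tree_adj_def 1 using assms(2) append_butlast_last_id by metis
  thus "G (par x) x" using adj 1 assms by simp
qed

lemma par_lev: "x \<in> lev (Suc k) \<Longrightarrow> par x \<in> lev k"
  using par_props[of x] unfolding lev_def by (cases "f x") auto

lemma lev_dist: "x \<in> lev k \<Longrightarrow> dist_le G k v x"
proof (induction k arbitrary: x)
  case 0 thus ?case using lev_0 by simp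
next
  case (Suc k)
  hence "par x \<in> lev k" by (intro par_lev)
  moreover have "G (par x) x" using Suc.prems par_props(3)[of x] unfolding lev_def by (cases "f x") auto
  ultimately show ?case using Suc.IH by auto
qed

lemma nbr_mem:
  assumes "x \<in> lev k" "k < N" "G x y" shows "y \<in> ball G N v"
proof -
  have "dist_le G (Suc k) v y" using lev_dist[OF assms(1)] assms(3) by auto
  thus ?thesis using dist_le_mono[of G "Suc k" v y N] assms(2) by (simp add: ball_def)
qed

lemma par_unique:
  assumes "y \<in> ball G N v" "x \<in> ball G N v" "f y = f x @ [b]" shows "par y = x"
  using par_props[of y] assms inj by (auto simp: inj_on_def)

text \<open>The restriction \<open>k < N\<close> is essential: a vertex on the last level may have
  neighbours outside the ball.\<close>

lemma nbrs:
  assumes x: "x \<in> lev k" and k: "k < N"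
  shows "G x y \<longleftrightarrow> y \<in> ch x \<or> (k > 0 \<and> y = par x)"
proof
  have xb: "x \<in> ball G N v" "length (f x) = k" using x by (auto simp: lev_def)
  assume "G x y"
  hence y: "y \<in> ball G N v" using nbr_mem[OF x k] by simp
  hence "tree_adj (f x) (f y)" using adj xb \<open>G x y\<close> by simp
  thus "y \<in> ch x \<or> (k > 0 \<and> y = par x)" unfolding tree_adj_def
  proof
    assume "\<exists>b. f y = f x @ [b]"
    thus ?thesis using par_unique[OF y xb(1)] xb y by (auto simp: ch_def lev_def)
  next
    assume "\<exists>b. f x = f y @ [b]"
    thus ?thesis using par_unique[OF xb(1) y] xb by auto
  qed
next
  have xb: "x \<in> ball G N v" "length (f x) = k" using x by (auto simp: lev_def)
  assume "y \<in> ch x \<or> (k > 0 \<and> y = par x)"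
  thus "G x y"
  proof
    assume "y \<in> ch x"
    hence "y \<in> ball G N v" "f y \<noteq> []" "par y = x" by (auto simp: ch_def lev_def)
    thus ?thesis using par_props(3) by blast
  next
    assume "k > 0 \<and> y = par x"
    thus ?thesis using par_props(3)[of x] xb sym by auto
  qed
qed

lemma ch_image:
  assumes x: "x \<in> lev k" and k: "k < N"
  shows "f ` ch x = (\<lambda>b. f x @ [b]) ` {..<(if k = 0 then d else d - 1)}"
proof (intro equalityI subsetI)
  have xb: "x \<in> ball G N v" "length (f x) = k" using x by (auto simp: lev_def)
  { fix ws assume "ws \<in> f ` ch x"
    then obtain u where u: "ws = f u" "u \<in> ball G N v" "length (f u) = Suc k" "par u = x"
      using xb by (auto simp: ch_def lev_def)
    hence "f u \<noteq> []" by auto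
    hence e: "f u = f x @ [last (f u)]" using par_props(2)[of u] u by (metis append_butlast_last_id)
    have "\<forall>i<length (f u). f u ! i < (if i = 0 then d else d - 1)" using f_mem[OF u(2)] by (simp add: tree_ball_def)
    hence "f u ! k < (if k = 0 then d else d - 1)" using u(3) by auto
    moreover have "f u ! k = last (f u)" using e xb by (metis nth_append_length)
    ultimately show "ws \<in> (\<lambda>b. f x @ [b]) ` {..<(if k = 0 then d else d - 1)}" using e u(1) by auto }
  { fix ws assume "ws \<in> (\<lambda>b. f x @ [b]) ` {..<(if k = 0 then d else d - 1)}"
    then obtain b where b: "ws = f x @ [b]" "b < (if k = 0 then d else d - 1)" by auto
    have "ws \<in> tree_ball d N" using f_mem[OF xb(1)] b xb k
      by (auto simp: tree_ball_def nth_append less_Suc_eq)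
    then obtain u where u: "u \<in> ball G N v" "f u = ws" using ex_preimage by blast
    hence "u \<in> ch x" using par_unique[OF u(1) xb(1)] b xb by (auto simp: ch_def lev_def)
    thus "ws \<in> f ` ch x" using u by auto }
qed

lemma card_ch:
  assumes x: "x \<in> lev k" and k: "k < N"
  shows "card (ch x) = (if k = 0 then d else d - 1)" "finite (ch x)"
proof -
  have i: "inj_on f (ch x)" by (rule inj_on_subset[OF inj]) (auto simp: ch_def lev_def)
  hence "card (ch x) = card (f ` ch x)" by (simp add: card_image)
  also have "\<dots> = (if k = 0 then d else d - 1)"
    unfolding ch_image[OF x k] by (subst card_image) (auto simp: inj_on_def)
  finally show "card (ch x) = (if k = 0 then d else d - 1)" .
  show "finite (ch x)" using ch_image[OF x k] i by (metis finite_imageD finite_imageI finite_lessThan)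
qed

lemma degree_eq:
  assumes x: "x \<in> lev k" and k: "k < N" shows "degree G x = d"
proof (cases "k = 0")
  case True
  hence "{u. G x u} = ch x" using nbrs[OF x k] by auto
  thus ?thesis using card_ch[OF x k] True by (simp add: degree_def)
next
  case False
  hence "{u. G x u} = insert (par x) (ch x)" using nbrs[OF x k] by auto
  moreover have "par x \<notin> ch x"
    using par_props(2)[of x] x False by (auto simp: ch_def lev_def)
  ultimately show ?thesis using card_ch[OF x k] False d2 by (simp add: degree_def)
qed

lemma lev_1: "N > 0 \<Longrightarrow> lev 1 = ch v"
  using root par_lev[of _ 0] lev_0 by (auto simp: ch_def)

end

section \<open>Gauges of a specification\<close>

definition spin_coord :: "(bool \<Rightarrow> bool) \<Rightarrow> (bool \<Rightarrow> real) \<Rightarrow> (bool \<Rightarrow> real) \<Rightarrow> bool \<Rightarrow> bool \<Rightarrow> real" where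
  "spin_coord f a g c s = (if s = f c then a c else - g c)"

text \<open>With \<open>bip\<close> the colours are those of a nearly bipartite graph; otherwise every vertex has
  the colour \<open>True\<close> and the data do not depend on the colour.\<close>

definition colour_compat :: "bool \<Rightarrow> bool \<Rightarrow> bool \<Rightarrow> bool" where
  "colour_compat bip c c' \<longleftrightarrow> (if bip then c' = (\<not> c) else c \<and> c')"

text \<open>On a \<open>d\<close>-regular graph a vertex collects one factor \<open>w\<close> from
  each of its edges, hence \<open>w c s ^ d\<close> in \<open>p\<close> and \<open>q\<close>. By
  \<open>strict\<close>, at least one of the two pairs made of the favoured spin of one colour and
  the other spin of the opposite colour is allowed.\<close>

locale spin_gauge = pos_gauge d T a g p q for d T a g p q +
  fixes \<psi> :: "bool \<Rightarrow> bool \<Rightarrow> real" and \<psi>b :: "bool \<Rightarrow> real" and w :: "bool \<Rightarrow> bool \<Rightarrow> real"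
    and f :: "bool \<Rightarrow> bool" and fs bip :: bool
  assumes w0: "\<And>c s. w c s > 0" and \<psi>b0: "\<And>s. \<psi>b s > 0"
    and \<psi>_nonneg: "\<And>s s'. \<psi> s s' \<ge> 0" and \<psi>_sym: "\<And>s s'. \<psi> s s' = \<psi> s' s"
    and p_eq: "\<And>c. p c = \<psi>b (f c) * w c (f c) ^ d" and q_eq: "\<And>c. q c = \<psi>b (\<not> f c) * w c (\<not> f c) ^ d"
    and \<psi>_eq: "\<And>c c' s s'. colour_compat bip c c' \<Longrightarrow>
        \<psi> s s' = w c s * w c' s' * (1 + T * (spin_coord f a g c s * spin_coord f a g c' s'))"
    and strict: "T * a True * g False < 1 \<or> T * a False * g True < 1"
    and free: "\<And>s. \<psi> fs s > 0"
    and uncoloured: "\<not> bip \<Longrightarrow> a False = a True \<and> g False = g True \<and> p False = p True \<and> q False = q True"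
begin

abbreviation \<zeta> :: "bool \<Rightarrow> bool \<Rightarrow> real" where "\<zeta> \<equiv> spin_coord f a g"

definition \<omega> :: "bool \<Rightarrow> bool \<Rightarrow> real" where "\<omega> c s = \<psi>b s * w c s ^ d"

lemma sum_favoured: "(\<Sum>s\<in>UNIV. F s) = F (f c) + F (\<not> f c)" for F :: "bool \<Rightarrow> real"
  by (cases "f c") (auto simp: UNIV_bool)

text \<open>The incoming messages may differ, but each of the two products is monotone in every one
  of them. The outgoing message therefore lies between its values for all messages equal to
  \<open>l\<close> and all equal to \<open>h\<close>.\<close>

lemma message_bounds:
  assumes t: "0 \<le> t" "t \<le> T" and Us: "finite Us" "card Us = d - 1"
    and z: "\<And>u. u \<in> Us \<Longrightarrow> l \<le> z u \<and> z u \<le> h"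
    and lh: "l \<le> h" "- g (\<not> c) \<le> l" "h \<le> a (\<not> c)"
  shows "(\<Sum>s\<in>UNIV. \<omega> c s * (\<Prod>u\<in>Us. 1 + t * (\<zeta> c s * z u))) > 0 \<and>
    (\<Sum>s\<in>UNIV. \<omega> c s * \<zeta> c s * (\<Prod>u\<in>Us. 1 + t * (\<zeta> c s * z u))) /
    (\<Sum>s\<in>UNIV. \<omega> c s * (\<Prod>u\<in>Us. 1 + t * (\<zeta> c s * z u))) \<in> {A c (t * l)..A c (t * h)}"
proof -
  define P where "P = p c * (\<Prod>u\<in>Us. 1 + a c * (t * z u))"
  define Q where "Q = q c * (\<Prod>u\<in>Us. 1 - g c * (t * z u))"
  have z1: "\<zeta> c (f c) = a c" "\<zeta> c (\<not> f c) = - g c" by (auto simp: spin_coord_def)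
  have s1: "(\<Sum>s\<in>UNIV. \<omega> c s * (\<Prod>u\<in>Us. 1 + t * (\<zeta> c s * z u))) = P + Q"
    unfolding sum_favoured[of _ c] z1 \<omega>_def P_def Q_def p_eq q_eq by (simp add: mult_ac)
  have s2: "(\<Sum>s\<in>UNIV. \<omega> c s * \<zeta> c s * (\<Prod>u\<in>Us. 1 + t * (\<zeta> c s * z u))) = a c * P - g c * Q"
    unfolding sum_favoured[of _ c] z1 \<omega>_def P_def Q_def p_eq q_eq by (simp add: mult_ac)
  have ad: "adm c (t * x)" if "l \<le> x" "x \<le> h" for x using that lh t by (intro adm_box) auto
  have adl: "adm c (t * l)" "adm c (t * h)" using ad lh by auto
  have zz: "0 \<le> 1 + a c * (t * z u)" "0 \<le> 1 - g c * (t * z u)"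
     "1 + a c * (t * l) \<le> 1 + a c * (t * z u)" "1 + a c * (t * z u) \<le> 1 + a c * (t * h)"
     "1 - g c * (t * z u) \<le> 1 - g c * (t * l)" "1 - g c * (t * h) \<le> 1 - g c * (t * z u)" if "u \<in> Us" for u
    using ad[of "z u"] z[OF that] a0[of c] g0[of c] t by (auto simp: adm_def intro!: mult_left_mono)
  have lh0: "0 \<le> 1 + a c * (t * l)" "0 \<le> 1 - g c * (t * h)" using adl by (auto simp: adm_def)
  have Pl: "p c * (1 + a c * (t * l)) ^ (d - 1) \<le> P" "P \<le> p c * (1 + a c * (t * h)) ^ (d - 1)"
    using prod_mono[of Us "\<lambda>_. 1 + a c * (t * l)" "\<lambda>u. 1 + a c * (t * z u)"]
      prod_mono[of Us "\<lambda>u. 1 + a c * (t * z u)" "\<lambda>_. 1 + a c * (t * h)"] zz lh0 p0[of c] Us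
    by (auto simp: P_def intro!: mult_left_mono)
  have Ql: "q c * (1 - g c * (t * h)) ^ (d - 1) \<le> Q" "Q \<le> q c * (1 - g c * (t * l)) ^ (d - 1)"
    using prod_mono[of Us "\<lambda>_. 1 - g c * (t * h)" "\<lambda>u. 1 - g c * (t * z u)"]
      prod_mono[of Us "\<lambda>u. 1 - g c * (t * z u)" "\<lambda>_. 1 - g c * (t * l)"] zz lh0 q0[of c] Us
    by (auto simp: Q_def intro!: mult_left_mono)
  have PQ0: "P \<ge> 0" "Q \<ge> 0" using zz p0[of c] q0[of c]
    by (auto simp: P_def Q_def less_imp_le intro!: mult_nonneg_nonneg prod_nonneg)
  \<comment> \<open>For one of the two spins no factor can vanish, whatever the incoming messages
    are, so the normalisation is positive.\<close>
  have "T * a c * g (\<not> c) < 1 \<or> T * g c * a (\<not> c) < 1" using strict by (cases c) (auto simp: mult_ac)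
  hence PQ: "P + Q > 0"
  proof
    assume s: "T * a c * g (\<not> c) < 1"
    have "1 + a c * (t * z u) > 0" if u: "u \<in> Us" for u
    proof (cases "z u \<ge> 0")
      case True thus ?thesis using a0[of c] t by (intro add_pos_nonneg mult_nonneg_nonneg) (auto simp: less_imp_le)
    next
      case False
      have "a c * (t * (- z u)) \<le> a c * (T * g (\<not> c))"
        using z[OF u] lh False t a0[of c] T0 by (intro mult_left_mono mult_mono) auto
      thus ?thesis using s by (simp add: mult_ac)
    qed
    hence "P > 0" using p0[of c] by (auto simp: P_def intro!: mult_pos_pos prod_pos)
    thus ?thesis using PQ0 by simp
  next
    assume s: "T * g c * a (\<not> c) < 1"
    have "1 - g c * (t * z u) > 0" if u: "u \<in> Us" for u
    proof (cases "z u \<le> 0")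
      case True
      hence "g c * (t * z u) \<le> 0" using g0[of c] t by (simp add: mult_nonneg_nonpos)
      thus ?thesis by simp
    next
      case False
      have "g c * (t * z u) \<le> g c * (T * a (\<not> c))"
        using z[OF u] lh False t g0[of c] T0 by (intro mult_left_mono mult_mono) auto
      thus ?thesis using s by (simp add: mult_ac)
    qed
    hence "Q > 0" using q0[of c] by (auto simp: Q_def intro!: mult_pos_pos prod_pos)
    thus ?thesis using PQ0 by simp
  qed
  have pos: "p c * (1 + a c * (t * l)) ^ (d - 1) \<ge> 0" "q c * (1 - g c * (t * h)) ^ (d - 1) \<ge> 0"
    using lh0 p0[of c] q0[of c] by (auto simp: less_imp_le)
  have "A c (t * l) \<le> (a c * P - g c * Q) / (P + Q)"
    unfolding A_def den_def using pos Pl Ql PQ0 PQ powsum_pos[OF adl(1)] a0[of c] g0[of c]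
    by (intro weighted_mean_mono) auto
  moreover have "(a c * P - g c * Q) / (P + Q) \<le> A c (t * h)"
    unfolding A_def den_def using pos Pl Ql PQ0 PQ powsum_pos[OF adl(2)] a0[of c] g0[of c]
    by (intro weighted_mean_mono) auto
  ultimately show ?thesis unfolding s1 s2 using PQ by simp
qed

text \<open>An affine function of \<open>t\<close> on \<open>{0..T}\<close> is at least the smaller
  of its end values, which are \<open>1\<close> and a nonnegative multiple of an entry of
  \<open>\<psi>\<close>.\<close>

lemma factor_nonneg:
  assumes "colour_compat bip c c'" "0 \<le> t" "t \<le> T"
  shows "0 \<le> 1 + t * (\<zeta> c s * \<zeta> c' s')" "min 1 (1 + T * (\<zeta> c s * \<zeta> c' s')) \<le> 1 + t * (\<zeta> c s * \<zeta> c' s')"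
proof -
  have "w c s * w c' s' * (1 + T * (\<zeta> c s * \<zeta> c' s')) \<ge> 0" using \<psi>_eq[OF assms(1), of s s'] \<psi>_nonneg[of s s'] by simp
  hence n: "1 + T * (\<zeta> c s * \<zeta> c' s') \<ge> 0"
    using mult_pos_pos[OF w0[of c s] w0[of c' s']] by (meson mult_pos_neg not_le)
  show m: "min 1 (1 + T * (\<zeta> c s * \<zeta> c' s')) \<le> 1 + t * (\<zeta> c s * \<zeta> c' s')"
  proof (cases "\<zeta> c s * \<zeta> c' s' \<ge> 0")
    case True thus ?thesis using assms by (simp add: min_le_iff_disj)
  next
    case False
    hence "T * (\<zeta> c s * \<zeta> c' s') \<le> t * (\<zeta> c s * \<zeta> c' s')" using assms by (intro mult_right_mono_neg) auto
    thus ?thesis by (simp add: min_le_iff_disj)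
  qed
  thus "0 \<le> 1 + t * (\<zeta> c s * \<zeta> c' s')" using n by (simp add: min_def split: if_splits)
qed

lemma colour_compat_sym: "colour_compat bip c c' \<Longrightarrow> colour_compat bip c' c"
  by (auto simp: colour_compat_def split: if_splits)

text \<open>All constants are maxima and minima over finite sets, so they depend neither on the
  graph nor on \<open>t\<close>. Exponents \<open>k < d\<close> occur because vertices may lose
  edges when irregular ones are cut off.\<close>

lemma ex_uniform_bounds:
  obtains M \<delta> \<kappa> Z :: real where "M \<ge> 1" "0 < \<delta>" "\<delta> \<le> 1" "\<kappa> \<ge> 1" "Z \<ge> 0"
    "\<And>c s c' s'. \<bar>\<zeta> c s * \<zeta> c' s'\<bar> \<le> Z"
    "\<And>s s'. \<psi> s s' \<le> M" "\<And>s. \<delta> \<le> \<psi> fs s" "\<And>s. \<psi>b s \<le> \<kappa> * \<psi>b fs"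
    "\<And>t c c' s s'. colour_compat bip c c' \<Longrightarrow> 0 \<le> t \<Longrightarrow> t \<le> T \<Longrightarrow> 1 + t * (\<zeta> c s * \<zeta> c' s') \<le> M"
    "\<And>t c c' s. colour_compat bip c c' \<Longrightarrow> 0 \<le> t \<Longrightarrow> t \<le> T \<Longrightarrow> \<delta> \<le> 1 + t * (\<zeta> c fs * \<zeta> c' s)"
    "\<And>c s k. k \<le> d \<Longrightarrow> \<psi>b s * w c s ^ k \<le> \<kappa> * (\<psi>b fs * w c fs ^ k)"
proof -
  define Z where "Z = Max (range (\<lambda>(c, s, c', s'). \<bar>\<zeta> c s * \<zeta> c' s'\<bar>))"
  have Z: "\<bar>\<zeta> c s * \<zeta> c' s'\<bar> \<le> Z" for c s c' s'
    unfolding Z_def by (intro Max_ge) (auto intro!: image_eqI[where x = "(c, s, c', s')"])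
  have Z0: "Z \<ge> 0" using Z[of True True True True] by linarith
  define M where "M = Max (insert (1 + T * Z) (range (\<lambda>(s, s'). \<psi> s s')))"
  have M1: "1 + T * Z \<le> M" unfolding M_def by (intro Max_ge) auto
  have M2: "\<psi> s s' \<le> M" for s s' unfolding M_def by (intro Max_ge) (auto intro!: image_eqI[where x = "(s, s')"])
  have TZ: "T * Z \<ge> 0" using T0 Z0 by simp
  define D where "D = insert 1 (range (\<psi> fs) \<union> {x. \<exists>c c' s. colour_compat bip c c' \<and> x = 1 + T * (\<zeta> c fs * \<zeta> c' s)})"
  define \<delta> where "\<delta> = Min D"
  have sub: "{x. \<exists>c c' s. colour_compat bip c c' \<and> x = 1 + T * (\<zeta> c fs * \<zeta> c' s)} \<subseteq> range (\<lambda>(c, c', s). 1 + T * (\<zeta> c fs * \<zeta> c' s))"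
    by (auto intro!: image_eqI[where x = "(c, c', s)" for c c' s])
  have "finite {x. \<exists>c c' s. colour_compat bip c c' \<and> x = 1 + T * (\<zeta> c fs * \<zeta> c' s)}"
    by (rule finite_subset[OF sub]) simp
  hence finD: "finite D" unfolding D_def by simp
  have "x > 0" if "x \<in> D" for x
  proof -
    have "1 + T * (\<zeta> c fs * \<zeta> c' s) > 0" if "colour_compat bip c c'" for c c' s
      using \<psi>_eq[OF that, of fs s] free[of s] mult_pos_pos[OF w0[of c fs] w0[of c' s]] zero_less_mult_pos by metis
    thus ?thesis using that free by (auto simp: D_def)
  qed
  hence \<delta>0: "\<delta> > 0" unfolding \<delta>_def using finD by (subst Min_gr_iff) (auto simp: D_def)
  have \<delta>le: "\<delta> \<le> x" if "x \<in> D" for x unfolding \<delta>_def using finD that by (rule Min_le)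
  define R where "R = (\<lambda>(c, s, k). \<psi>b s * w c s ^ k / (\<psi>b fs * w c fs ^ k)) ` (UNIV \<times> UNIV \<times> {..d})"
  define \<kappa> where "\<kappa> = Max (insert 1 R)"
  have finR: "finite (insert 1 R)" by (simp add: R_def)
  have \<kappa>1: "\<kappa> \<ge> 1" unfolding \<kappa>_def using finR by (intro Max_ge) auto
  have \<kappa>: "\<psi>b s * w c s ^ k \<le> \<kappa> * (\<psi>b fs * w c fs ^ k)" if "k \<le> d" for c s k
  proof -
    have "\<psi>b s * w c s ^ k / (\<psi>b fs * w c fs ^ k) \<le> \<kappa>" unfolding \<kappa>_def R_def using that
      by (intro Max_ge) (auto intro!: image_eqI[where x = "(c, s, k)"])
    thus ?thesis using \<psi>b0[of fs] w0[of c fs] by (simp add: pos_divide_le_eq)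
  qed
  show ?thesis
  proof (rule that[of M \<delta> \<kappa> Z])
    show "\<psi>b s \<le> \<kappa> * \<psi>b fs" for s using \<kappa>[of 0 s] by simp
    show "1 + t * (\<zeta> c s * \<zeta> c' s') \<le> M" if "colour_compat bip c c'" "0 \<le> t" "t \<le> T" for t c c' s s'
    proof -
      have "t * (\<zeta> c s * \<zeta> c' s') \<le> T * Z" using Z[of c s c' s'] Z0 that
        by (meson abs_ge_self mult_mono' mult_left_mono mult_right_mono order_trans)
      thus ?thesis using M1 by linarith
    qed
    show "\<delta> \<le> 1 + t * (\<zeta> c fs * \<zeta> c' s)" if "colour_compat bip c c'" "0 \<le> t" "t \<le> T" for t c c' s
    proof -
      have "1 \<in> D" "1 + T * (\<zeta> c fs * \<zeta> c' s) \<in> D" unfolding D_def using that(1) by blast+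
      hence "\<delta> \<le> 1" "\<delta> \<le> 1 + T * (\<zeta> c fs * \<zeta> c' s)" by (auto intro: \<delta>le)
      thus ?thesis using factor_nonneg(2)[OF that, of fs s] by linarith
    qed
  qed (use Z Z0 M1 M2 TZ \<delta>0 \<delta>le \<kappa>1 \<kappa> in \<open>auto simp: D_def\<close>)
qed

end

section \<open>Interpolation on a graph\<close>

definition edges :: "nat \<Rightarrow> graph \<Rightarrow> (nat \<times> nat) set" where
  "edges n G = {(i, j). i < j \<and> j < n \<and> G i j}"

lemma finite_edges: "finite (edges n G)"
  by (rule finite_subset[of _ "{..<n} \<times> {..<n}"]) (auto simp: edges_def)

lemma partition_fn_wsum: "partition_fn \<psi> \<psi>b n G = wsum {0..<n} (edges n G) (\<lambda>_. \<psi>) (\<lambda>_. \<psi>b)"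
  unfolding partition_fn_def wsum_def edges_def
  by (rule sum_PiE_bool) (auto intro!: arg_cong2[where f = "(*)"] prod.cong)

lemma card_incident_edges:
  assumes "simple_graph_on n G" "v < n"
  shows "card (incident (edges n G) v) = degree G v"
proof -
  have "incident (edges n G) v = (\<lambda>u. (min u v, max u v)) ` {u. G v u}"
  proof (intro equalityI subsetI)
    fix e assume "e \<in> incident (edges n G) v"
    then obtain i j where e: "e = (i, j)" "i < j" "j < n" "G i j" "i = v \<or> j = v" by (auto simp: incident_def edges_def)
    show "e \<in> (\<lambda>u. (min u v, max u v)) ` {u. G v u}"
    proof (cases "i = v")
      case True thus ?thesis using e by (intro image_eqI[where x = j]) auto
    next
      case False thus ?thesis using e assms by (intro image_eqI[where x = i]) (auto simp: simple_graph_on_def)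
    qed
  next
    fix e assume "e \<in> (\<lambda>u. (min u v, max u v)) ` {u. G v u}"
    then obtain u where u: "G v u" "e = (min u v, max u v)" by auto
    hence "G u v" "u \<noteq> v" "u < n" using assms by (auto simp: simple_graph_on_def)
    thus "e \<in> incident (edges n G) v" using u assms by (cases "u < v") (auto simp: incident_def edges_def min_def max_def)
  qed
  moreover have "inj_on (\<lambda>u. (min u v, max u v)) {u. G v u}"
    by (auto simp: inj_on_def min_def max_def split: if_splits)
  ultimately show ?thesis by (simp add: card_image degree_def)
qed

lemma prod_edges_vertices:
  fixes h :: "'v \<Rightarrow> real"
  assumes "finite E" "finite V" "\<And>e. e \<in> E \<Longrightarrow> fst e \<in> V \<and> snd e \<in> V \<and> fst e \<noteq> snd e"
  shows "(\<Prod>e\<in>E. h (fst e) * h (snd e)) = (\<Prod>v\<in>V. h v ^ card (incident E v))"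
proof -
  have g: "(\<Prod>e\<in>E. h (k e)) = (\<Prod>v\<in>V. h v ^ card {e\<in>E. k e = v})" if "k ` E \<subseteq> V" for k
  proof -
    have "(\<Prod>e\<in>E. h (k e)) = (\<Prod>v\<in>V. \<Prod>e\<in>{e\<in>E. k e = v}. h (k e))"
      using assms that by (intro prod.group[symmetric])
    also have "\<dots> = (\<Prod>v\<in>V. h v ^ card {e\<in>E. k e = v})" by (intro prod.cong refl) simp
    finally show ?thesis .
  qed
  have c: "card (incident E v) = card {e\<in>E. fst e = v} + card {e\<in>E. snd e = v}" for v
  proof -
    have "incident E v = {e\<in>E. fst e = v} \<union> {e\<in>E. snd e = v}" by (auto simp: incident_def)
    moreover have "{e\<in>E. fst e = v} \<inter> {e\<in>E. snd e = v} = {}" using assms(3) by fastforce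
    ultimately show ?thesis using assms(1) by (simp add: card_Un_disjoint)
  qed
  have "fst ` E \<subseteq> V" "snd ` E \<subseteq> V" using assms(3) by auto
  thus ?thesis unfolding prod.distrib c power_add using g[of fst] g[of snd] by simp
qed

lemma sum_incident:
  assumes "finite E" "finite V" "\<And>e. e \<in> E \<Longrightarrow> fst e \<in> V \<and> snd e \<in> V \<and> fst e \<noteq> snd e"
  shows "(\<Sum>v\<in>V. card (incident E v)) = 2 * card E"
proof -
  have "(\<Sum>v\<in>V. card (incident E v)) = (\<Sum>v\<in>V. \<Sum>e\<in>E. if fst e = v \<or> snd e = v then 1 else 0)"
    using assms(1) by (intro sum.cong refl) (simp add: incident_def sum.If_cases Int_def)
  also have "\<dots> = (\<Sum>e\<in>E. \<Sum>v\<in>V. if fst e = v \<or> snd e = v then 1 else 0)" by (rule sum.swap)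
  also have "\<dots> = (\<Sum>e\<in>E. 2)"
  proof (intro sum.cong refl)
    fix e assume e: "e \<in> E"
    have "{v\<in>V. fst e = v \<or> snd e = v} = {fst e, snd e}" using assms(3)[OF e] by auto
    thus "(\<Sum>v\<in>V. if fst e = v \<or> snd e = v then 1 else 0) = (2::nat)"
      using assms(3)[OF e] assms(2) by (simp add: sum.If_cases Int_def)
  qed
  finally show ?thesis by simp
qed

lemma DERIV_prod_linear:
  fixes x :: "'e \<Rightarrow> real"
  assumes "finite E"
  shows "((\<lambda>t. \<Prod>e\<in>E. 1 + t * x e) has_real_derivative (\<Sum>e\<in>E. x e * (\<Prod>e'\<in>E - {e}. 1 + t * x e'))) (at t)"
  using assms
proof (induction E rule: finite_induct)
  case empty show ?case by simp
next
  case (insert e E)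
  have "((\<lambda>t. (1 + t * x e) * (\<Prod>e\<in>E. 1 + t * x e)) has_real_derivative
      x e * (\<Prod>e\<in>E. 1 + t * x e) + (\<Sum>e\<in>E. x e * (\<Prod>e'\<in>E - {e}. 1 + t * x e')) * (1 + t * x e)) (at t)"
    by (rule DERIV_mult[OF _ insert.IH]) (auto intro!: derivative_eq_intros)
  moreover have "(\<Sum>e'\<in>insert e E. x e' * (\<Prod>i\<in>insert e E - {e'}. 1 + t * x i))
     = x e * (\<Prod>e\<in>E. 1 + t * x e) + (\<Sum>e\<in>E. x e * (\<Prod>e'\<in>E - {e}. 1 + t * x e')) * (1 + t * x e)"
  proof -
    have eq: "x e' * (\<Prod>i\<in>insert e E - {e'}. 1 + t * x i) = x e' * (\<Prod>i\<in>E - {e'}. 1 + t * x i) * (1 + t * x e)" if "e' \<in> E" for e'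
    proof -
      have "insert e E - {e'} = insert e (E - {e'})" using that insert by auto
      thus ?thesis using insert by simp
    qed
    have "(\<Sum>e'\<in>E. x e' * (\<Prod>i\<in>insert e E - {e'}. 1 + t * x i)) = (\<Sum>e'\<in>E. x e' * (\<Prod>i\<in>E - {e'}. 1 + t * x i) * (1 + t * x e))"
      by (intro sum.cong refl eq)
    moreover have "insert e E - {e} = E" using insert by auto
    ultimately show ?thesis using insert by (simp add: sum_distrib_right)
  qed
  ultimately show ?case using insert by simp
qed

text \<open>The colour of the root is left free, so one condition covers both colourings of the
  tree.\<close>

definition good_ball :: "nat \<Rightarrow> bool \<Rightarrow> graph \<Rightarrow> (nat \<Rightarrow> bool) \<Rightarrow> nat \<Rightarrow> nat \<Rightarrow> bool" where
  "good_ball d bip G col R v \<longleftrightarrow> (\<exists>h. ball_iso d R G v h \<and>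
     (bip \<longrightarrow> (\<forall>x\<in>ball G R v. col x = (col v = even (length (h x))))))"

locale bounded_spin_gauge = spin_gauge d T a g p q \<psi> \<psi>b w f fs bip for d T a g p q \<psi> \<psi>b w f fs bip +
  fixes M \<delta> \<kappa> Zm :: real
  assumes M1: "M \<ge> 1" and \<delta>0: "0 < \<delta>" "\<delta> \<le> 1" and \<kappa>1: "\<kappa> \<ge> 1" and Zm0: "Zm \<ge> 0"
    and \<zeta>_le: "\<And>c s c' s'. \<bar>spin_coord f a g c s * spin_coord f a g c' s'\<bar> \<le> Zm"
    and \<psi>_le: "\<And>s s'. \<psi> s s' \<le> M" and \<psi>_ge: "\<And>s. \<delta> \<le> \<psi> fs s" and \<psi>b_le: "\<And>s. \<psi>b s \<le> \<kappa> * \<psi>b fs"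
    and fac_le: "\<And>t c c' s s'. colour_compat bip c c' \<Longrightarrow> 0 \<le> t \<Longrightarrow> t \<le> T \<Longrightarrow>
        1 + t * (spin_coord f a g c s * spin_coord f a g c' s') \<le> M"
    and fac_ge: "\<And>t c c' s. colour_compat bip c c' \<Longrightarrow> 0 \<le> t \<Longrightarrow> t \<le> T \<Longrightarrow>
        \<delta> \<le> 1 + t * (spin_coord f a g c fs * spin_coord f a g c' s)"
    and om_le: "\<And>c s k. k \<le> d \<Longrightarrow> \<psi>b s * w c s ^ k \<le> \<kappa> * (\<psi>b fs * w c fs ^ k)"

locale graph_gauge = bounded_spin_gauge +
  fixes n :: nat and G :: graph and col :: "nat \<Rightarrow> bool"
  assumes G: "simple_graph_on n G" and col: "\<not> bip \<Longrightarrow> col = (\<lambda>_. True)"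
begin

text \<open>Cutting off these vertices leaves degrees at most \<open>d\<close> and only edges
  between compatible colours, where the gauge form of \<open>\<psi>\<close> is valid.\<close>

definition irregular :: "nat set" where
  "irregular = {v\<in>{0..<n}. degree G v \<noteq> d \<or> (\<exists>u. G v u \<and> \<not> colour_compat bip (col v) (col u))}"

definition E :: "(nat \<times> nat) set" where
  "E = edges n G - (\<Union>v\<in>irregular. incident (edges n G) v)"

abbreviation (input) ze :: "nat \<Rightarrow> bool \<Rightarrow> real" where "ze v \<equiv> \<zeta> (col v)"

text \<open>The exponent is the degree after the cutting and not \<open>d\<close>; with it the gauge
  transformation is exact on the whole graph.\<close>

definition Om :: "nat \<Rightarrow> bool \<Rightarrow> real" where
  "Om v s = \<psi>b s * w (col v) s ^ card (incident E v)"

definition ew :: "real \<Rightarrow> nat \<times> nat \<Rightarrow> bool \<Rightarrow> bool \<Rightarrow> real" where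
  "ew t e s s' = 1 + t * (ze (fst e) s * ze (snd e) s')"

definition Z :: "real \<Rightarrow> real" where "Z t = wsum {0..<n} E (ew t) Om"

definition dZ :: "nat \<times> nat \<Rightarrow> real \<Rightarrow> real" where
  "dZ e t = spin_sum {0..<n} (\<lambda>\<sigma>. (ze (fst e) (\<sigma> (fst e)) * ze (snd e) (\<sigma> (snd e))) *
     (\<Prod>e'\<in>E - {e}. ew t e' (\<sigma> (fst e')) (\<sigma> (snd e'))) * (\<Prod>v\<in>{0..<n}. Om v (\<sigma> v))) (\<lambda>_. False)"

lemma fin_E: "finite E" by (simp add: E_def finite_edges)

lemma E_iff: "(i, j) \<in> E \<longleftrightarrow> i < j \<and> j < n \<and> G i j \<and> i \<notin> irregular \<and> j \<notin> irregular"
  by (auto simp: E_def edges_def incident_def)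

lemma E_props: assumes "e \<in> E"
  shows "fst e \<in> {0..<n} \<and> snd e \<in> {0..<n} \<and> fst e \<noteq> snd e" "colour_compat bip (col (fst e)) (col (snd e))"
proof -
  have e: "fst e < snd e" "snd e < n" "G (fst e) (snd e)" "fst e \<notin> irregular" using E_iff[of "fst e" "snd e"] assms by auto
  thus "fst e \<in> {0..<n} \<and> snd e \<in> {0..<n} \<and> fst e \<noteq> snd e" by auto
  show "colour_compat bip (col (fst e)) (col (snd e))" using e by (auto simp: irregular_def)
qed

lemma card_incident_E: "v < n \<Longrightarrow> card (incident E v) \<le> d"
proof -
  assume v: "v < n"
  show ?thesis
  proof (cases "v \<in> irregular")
    case True
    hence "incident E v = {}" by (auto simp: incident_def E_def)
    thus ?thesis by simp
  next
    case False
    hence "degree G v = d" using v by (auto simp: irregular_def)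
    moreover have "card (incident E v) \<le> card (incident (edges n G) v)"
      by (intro card_mono finite_incident finite_edges) (auto simp: incident_def E_def)
    ultimately show ?thesis using card_incident_edges[OF G v] by simp
  qed
qed

text \<open>Each edge hands its two gauge factors to its ends, where they are collected in
  \<open>Om\<close>.\<close>

lemma wsum_Z: "wsum {0..<n} E (\<lambda>_. \<psi>) (\<lambda>_. \<psi>b) = Z T"
  unfolding Z_def wsum_def
proof (rule spin_sum_cong)
  fix \<sigma>
  have "(\<Prod>e\<in>E. \<psi> (\<sigma> (fst e)) (\<sigma> (snd e)))
      = (\<Prod>e\<in>E. (w (col (fst e)) (\<sigma> (fst e)) * w (col (snd e)) (\<sigma> (snd e))) * ew T e (\<sigma> (fst e)) (\<sigma> (snd e)))"
    unfolding ew_def by (intro prod.cong refl \<psi>_eq E_props)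
  also have "\<dots> = (\<Prod>v\<in>{0..<n}. w (col v) (\<sigma> v) ^ card (incident E v)) * (\<Prod>e\<in>E. ew T e (\<sigma> (fst e)) (\<sigma> (snd e)))"
    unfolding prod.distrib[of "\<lambda>e. w (col (fst e)) (\<sigma> (fst e)) * w (col (snd e)) (\<sigma> (snd e))"]
    using prod_edges_vertices[OF fin_E finite_atLeastLessThan E_props(1), of "\<lambda>v. w (col v) (\<sigma> v)"] by simp
  finally show "(\<Prod>e\<in>E. \<psi> (\<sigma> (fst e)) (\<sigma> (snd e))) * (\<Prod>v\<in>{0..<n}. \<psi>b (\<sigma> v))
     = (\<Prod>e\<in>E. ew T e (\<sigma> (fst e)) (\<sigma> (snd e))) * (\<Prod>v\<in>{0..<n}. Om v (\<sigma> v))"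
    unfolding Om_def prod.distrib by simp
qed

lemma Z_0: "Z 0 = (\<Prod>v\<in>{0..<n}. Om v True + Om v False)"
  unfolding Z_def wsum_def ew_def using spin_sum_prod[of "{0..<n}" Om] by simp

lemma Z_deriv: "(Z has_real_derivative (\<Sum>e\<in>E. dZ e t)) (at t)"
proof -
  have "((\<lambda>t. (\<Prod>e\<in>E. 1 + t * (ze (fst e) (\<sigma> (fst e)) * ze (snd e) (\<sigma> (snd e)))) * (\<Prod>v\<in>{0..<n}. Om v (\<sigma> v))) has_real_derivative
      (\<Sum>e\<in>E. (ze (fst e) (\<sigma> (fst e)) * ze (snd e) (\<sigma> (snd e))) * (\<Prod>e'\<in>E - {e}. ew t e' (\<sigma> (fst e')) (\<sigma> (snd e'))) * (\<Prod>v\<in>{0..<n}. Om v (\<sigma> v)))) (at t)" for \<sigma>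
    unfolding sum_distrib_right[symmetric] ew_def
    by (rule DERIV_cmult_right[OF DERIV_prod_linear[OF fin_E]])
  hence "((\<lambda>t. spin_sum {0..<n} (\<lambda>\<sigma>. (\<Prod>e\<in>E. 1 + t * (ze (fst e) (\<sigma> (fst e)) * ze (snd e) (\<sigma> (snd e)))) * (\<Prod>v\<in>{0..<n}. Om v (\<sigma> v))) (\<lambda>_. False))
     has_real_derivative spin_sum {0..<n} (\<lambda>\<sigma>. \<Sum>e\<in>E. (ze (fst e) (\<sigma> (fst e)) * ze (snd e) (\<sigma> (snd e))) * (\<Prod>e'\<in>E - {e}. ew t e' (\<sigma> (fst e')) (\<sigma> (snd e'))) * (\<Prod>v\<in>{0..<n}. Om v (\<sigma> v))) (\<lambda>_. False)) (at t)"
    unfolding spin_sum_def by (intro DERIV_sum)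
  thus ?thesis unfolding spin_sum_sum dZ_def[symmetric] unfolding Z_def wsum_def ew_def[abs_def] .
qed

lemma weights_\<psi>: "weights {0..<n} (edges n G) (\<lambda>_. \<psi>) (\<lambda>_. \<psi>b) fs M \<delta> \<kappa>"
proof
  show "\<delta> \<le> \<psi> s fs" for s using \<psi>_ge[of s] \<psi>_sym[of s fs] by simp
qed (use finite_edges \<psi>_nonneg \<psi>_le \<delta>0 M1 \<psi>_ge \<psi>b0 \<psi>b_le in \<open>auto simp: edges_def\<close>)

lemma weights_ew: assumes t: "0 \<le> t" "t \<le> T" shows "weights {0..<n} E (ew t) Om fs M \<delta> \<kappa>"
proof
  fix e s s' assume e: "e \<in> E"
  note cc = E_props(2)[OF e]
  show "fst e \<in> {0..<n} \<and> snd e \<in> {0..<n}" using E_props(1)[OF e] by simp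
  show "0 \<le> ew t e s s'" unfolding ew_def by (rule factor_nonneg[OF cc t])
  show "ew t e s s' \<le> M" unfolding ew_def by (rule fac_le[OF cc t])
  show "\<delta> \<le> ew t e fs s" unfolding ew_def by (rule fac_ge[OF cc t])
  show "\<delta> \<le> ew t e s fs"
    unfolding ew_def using fac_ge[OF colour_compat_sym[OF cc] t, of s] by (simp add: mult.commute)
next
  fix v s assume v: "v \<in> {0..<n}"
  show "Om v s > 0" unfolding Om_def using \<psi>b0 w0 by simp
  show "Om v s \<le> \<kappa> * Om v fs" unfolding Om_def using v by (intro om_le card_incident_E) auto
qed (use fin_E \<delta>0 M1 in auto)

lemma Z_pos: "0 \<le> t \<Longrightarrow> t \<le> T \<Longrightarrow> Z t > 0"
  unfolding Z_def by (rule weights.wsum_pos[OF weights_ew])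

definition C0 :: real where "C0 = max (ln M) (max (ln (2 * \<kappa>)) (ln (1 / \<delta>)))"

lemma ln_partition_fn:
  "\<bar>ln (partition_fn \<psi> \<psi>b n G) - ln (Z T)\<bar> \<le> C0 * (\<Sum>v\<in>irregular. real (degree G v) + 1)"
proof -
  have "\<bar>ln (wsum {0..<n} (edges n G) (\<lambda>_. \<psi>) (\<lambda>_. \<psi>b)) - ln (wsum {0..<n} E (\<lambda>_. \<psi>) (\<lambda>_. \<psi>b))\<bar>
     \<le> C0 * (\<Sum>v\<in>irregular. real (card (incident (edges n G) v)) + 1)"
    unfolding E_def by (rule weights.ln_wsum_remove_vertices[OF weights_\<psi>]) (auto simp: irregular_def C0_def)
  also have "(\<Sum>v\<in>irregular. real (card (incident (edges n G) v)) + 1) = (\<Sum>v\<in>irregular. real (degree G v) + 1)"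
    by (intro sum.cong refl) (auto simp: irregular_def card_incident_edges[OF G])
  finally show ?thesis unfolding partition_fn_wsum wsum_Z .
qed

definition C2 :: real where "C2 = Zm * (2 * \<kappa> * (M / \<delta>) ^ d)"

lemma C2_nonneg: "C2 \<ge> 0" using Zm0 \<kappa>1 M1 \<delta>0 by (simp add: C2_def)

text \<open>A crude bound, meant for edges without a tree neighbourhood. The derivative contains the
  weight without the edge \<open>e\<close>, and \<open>wsum_remove_edge_le\<close> puts the edge
  back although its factor may be zero.\<close>

lemma dZ_bound: assumes t: "0 \<le> t" "t \<le> T" and e: "e \<in> E" shows "\<bar>dZ e t\<bar> \<le> C2 * Z t"
proof -
  interpret we: weights "{0..<n}" E "ew t" Om fs M \<delta> \<kappa> by (rule weights_ew[OF t])
  interpret wr: weights "{0..<n}" "E - {e}" "ew t" Om fs M \<delta> \<kappa> by (rule we.sub_weights) auto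
  let ?W = "\<lambda>\<sigma>. (\<Prod>e'\<in>E - {e}. ew t e' (\<sigma> (fst e')) (\<sigma> (snd e'))) * (\<Prod>v\<in>{0..<n}. Om v (\<sigma> v))"
  let ?z = "\<lambda>\<sigma>. ze (fst e) (\<sigma> (fst e)) * ze (snd e) (\<sigma> (snd e))"
  have "dZ e t = spin_sum {0..<n} (\<lambda>\<sigma>. ?z \<sigma> * ?W \<sigma>) (\<lambda>_. False)" by (simp add: dZ_def mult.assoc)
  hence "\<bar>dZ e t\<bar> \<le> spin_sum {0..<n} (\<lambda>\<sigma>. \<bar>?z \<sigma> * ?W \<sigma>\<bar>) (\<lambda>_. False)" by (simp add: spin_sum_def sum_abs)
  also have "\<dots> \<le> spin_sum {0..<n} (\<lambda>\<sigma>. Zm * ?W \<sigma>) (\<lambda>_. False)"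
  proof (rule spin_sum_mono)
    fix \<sigma>
    have "\<bar>?z \<sigma> * ?W \<sigma>\<bar> = \<bar>?z \<sigma>\<bar> * ?W \<sigma>" 
      by (simp only: abs_mult[of "?z \<sigma>"] abs_of_nonneg[OF wr.weight_nonneg])
    also have "\<dots> \<le> Zm * ?W \<sigma>" using wr.weight_nonneg[of \<sigma>] by (intro mult_right_mono \<zeta>_le)
    finally show "\<bar>?z \<sigma> * ?W \<sigma>\<bar> \<le> Zm * ?W \<sigma>" .
  qed
  also have "\<dots> = Zm * wsum {0..<n} (E - {e}) (ew t) Om" unfolding wsum_def spin_sum_cmult ..
  also have "\<dots> \<le> Zm * (2 * \<kappa> * (M / \<delta>) ^ card (incident E (fst e)) * wsum {0..<n} E (ew t) Om)"
    using Zm0 by (intro mult_left_mono we.wsum_remove_edge_le e)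
  also have "\<dots> \<le> Zm * (2 * \<kappa> * (M / \<delta>) ^ d * wsum {0..<n} E (ew t) Om)"
  proof -
    have "1 \<le> M / \<delta>" using M1 \<delta>0 by (simp add: field_simps)
    hence "(M / \<delta>) ^ card (incident E (fst e)) \<le> (M / \<delta>) ^ d"
      using E_props(1)[OF e] by (intro power_increasing card_incident_E) auto
    thus ?thesis using Zm0 \<kappa>1 we.wsum_pos by (intro mult_left_mono mult_right_mono) auto
  qed
  finally show ?thesis unfolding C2_def Z_def by (simp add: mult_ac)
qed

section \<open>Sandwiching messages on tree-like balls\<close>

lemma tree_levels:
  assumes iso: "tree_ball_iso d N G v h" and colour: "bip \<longrightarrow> (\<forall>x\<in>ball G N v. col x = (col v = even (length (h x))))"
    and x: "x \<in> tree_ball_iso.lev N G v h k" "k < N"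
  shows "x \<notin> irregular" "\<And>u. G x u \<Longrightarrow> colour_compat bip (col x) (col u)"
proof -
  interpret tree_ball_iso d N G v h by (rule iso)
  show cc: "colour_compat bip (col x) (col u)" if u: "G x u" for u
  proof (cases bip)
    case True
    have xb: "x \<in> ball G N v" "length (h x) = k" using x by (auto simp: lev_def)
    have ub: "u \<in> ball G N v" using nbr_mem[OF x u] .
    have "length (h u) = Suc k \<or> Suc (length (h u)) = k"
      using nbrs[OF x, of u] u xb par_lev[of x "k - 1"] x by (auto simp: ch_def lev_def)
    moreover have "col x = (col v = even k)" "col u = (col v = even (length (h u)))"
      using colour True xb ub by auto
    ultimately show ?thesis unfolding colour_compat_def using True by auto
  next
    case False thus ?thesis using col by (simp add: colour_compat_def)
  qed
  show "x \<notin> irregular" using degree_eq[OF x] cc by (auto simp: irregular_def)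
qed

text \<open>Intervals that contain every message sent \<open>m\<close> levels above the boundary,
  starting from the full range. The lower bound on the free energy uses the ends
  \<open>- g c\<close> and \<open>U\<close>; the upper bound uses \<open>U\<close> and minus the
  \<open>U\<close> of the opposite colour.\<close>

definition message_box :: "real \<Rightarrow> (nat \<Rightarrow> bool \<Rightarrow> real) \<Rightarrow> (nat \<Rightarrow> bool \<Rightarrow> real) \<Rightarrow> bool" where
  "message_box t lo hi \<longleftrightarrow> (\<forall>c. lo 0 c = - g c \<and> hi 0 c = a c) \<and>
     (\<forall>m c. - g c \<le> lo m c \<and> lo m c \<le> hi m c \<and> hi m c \<le> a c) \<and>
     (\<forall>m c. lo (Suc m) c \<le> A c (t * lo m (\<not> c)) \<and> A c (t * hi m (\<not> c)) \<le> hi (Suc m) c) \<and>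
     (\<not> bip \<longrightarrow> (\<forall>m. lo m False = lo m True \<and> hi m False = hi m True))"

lemma message_box_step:
  assumes t: "0 \<le> t" "t \<le> T" and box: "message_box t lo hi"
    and Us: "finite Us" "card Us = d - 1" "\<And>u. u \<in> Us \<Longrightarrow> colour_compat bip (col v) (col u)"
    and z: "\<And>u. u \<in> Us \<Longrightarrow> z u \<in> {lo m (col u)..hi m (col u)}"
    and deg: "card (incident E v) = d"
  shows "(\<Sum>s\<in>UNIV. Om v s * (\<Prod>u\<in>Us. 1 + t * (ze v s * z u))) > 0 \<and>
    (\<Sum>s\<in>UNIV. Om v s * ze v s * (\<Prod>u\<in>Us. 1 + t * (ze v s * z u))) /
    (\<Sum>s\<in>UNIV. Om v s * (\<Prod>u\<in>Us. 1 + t * (ze v s * z u))) \<in> {lo (Suc m) (col v)..hi (Suc m) (col v)}"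
proof -
  have Om: "Om v s = \<omega> (col v) s" for s by (simp add: Om_def \<omega>_def deg)
  have b: "- g c \<le> lo k c" "lo k c \<le> hi k c" "hi k c \<le> a c"
      "lo (Suc k) c \<le> A c (t * lo k (\<not> c))" "A c (t * hi k (\<not> c)) \<le> hi (Suc k) c" for k c
    using box by (auto simp: message_box_def)
  have nb: "lo m (\<not> col v) \<le> z u \<and> z u \<le> hi m (\<not> col v)" if u: "u \<in> Us" for u
  proof (cases bip)
    case True thus ?thesis using Us(3)[OF u] z[OF u] by (simp add: colour_compat_def)
  next
    case False
    moreover have "\<not> bip \<longrightarrow> (\<forall>m. lo m False = lo m True \<and> hi m False = hi m True)"
      using box unfolding message_box_def by blast
    ultimately have "lo m False = lo m True" "hi m False = hi m True" by blast+
    thus ?thesis using Us(3)[OF u] z[OF u] False by (simp add: colour_compat_def)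
  qed
  have "(\<Sum>s\<in>UNIV. \<omega> (col v) s * (\<Prod>u\<in>Us. 1 + t * (ze v s * z u))) > 0 \<and>
    (\<Sum>s\<in>UNIV. \<omega> (col v) s * ze v s * (\<Prod>u\<in>Us. 1 + t * (ze v s * z u))) /
    (\<Sum>s\<in>UNIV. \<omega> (col v) s * (\<Prod>u\<in>Us. 1 + t * (ze v s * z u)))
      \<in> {A (col v) (t * lo m (\<not> col v))..A (col v) (t * hi m (\<not> col v))}"
    by (rule message_bounds[OF t Us(1,2) nb b(2,1,3)])
  thus ?thesis unfolding Om using b(4,5)[where k = m and c = "col v"] by auto
qed

lemma G_sym: "G x y \<longleftrightarrow> G y x" and G_less: "G x y \<Longrightarrow> x < n \<and> y < n" and G_irrefl: "\<not> G x x"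
  using G unfolding simple_graph_on_def by blast+

lemma edge_E: assumes "G x y" "x \<notin> irregular" "y \<notin> irregular" shows "(min x y, max x y) \<in> E"
proof (cases "x < y")
  case True thus ?thesis using assms G_less[OF assms(1)] by (simp add: E_iff)
next
  case False
  hence "y < x" using assms G_irrefl[of x] by (cases "x = y") auto
  thus ?thesis using assms G_less[OF assms(1)] G_sym[of x y] by (simp add: E_iff)
qed

text \<open>The reason for the radius \<open>r + 3\<close>: vertices up to level
  \<open>r + 1\<close> have to keep all their edges, so their neighbours up to level
  \<open>r + 2\<close> have to be regular, and this is visible only with one more level.\<close>

lemma tree_structure:
  assumes h: "ball_iso d (r + 3) G i h"
    and colour: "bip \<longrightarrow> (\<forall>x\<in>ball G (r + 3) i. col x = (col i = even (length (h x))))" and iN: "i < n"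
  shows "tree_ball_iso d (r + 3) G i h"
    and "tree_ball_iso.lev (r + 3) G i h k \<subseteq> {0..<n}"
    and "\<And>x. x \<in> tree_ball_iso.lev (r + 3) G i h k \<Longrightarrow> k \<le> Suc r \<Longrightarrow> card (incident E x) = d"
proof -
  have d2: "2 \<le> d" using d3 by simp
  show iso: "tree_ball_iso d (r + 3) G i h" by (rule tree_ball_iso.intro[OF h G_sym d2])
  interpret tb: tree_ball_iso d "r + 3" G i h by (rule iso)
  note reg = tree_levels[OF tb.tree_ball_iso_axioms colour]
  note edge = edge_E
  note Gsym = G_sym
  note Gn = G_less
  show levV: "tb.lev k \<subseteq> {0..<n}" for k
  proof (cases k)
    case 0 thus ?thesis using tb.lev_0 iN by auto
  next
    case (Suc l)
    show ?thesis
    proof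
      fix x assume x: "x \<in> tb.lev k"
      hence "x \<in> ball G (r + 3) i" "h x \<noteq> []" using Suc by (auto simp: tb.lev_def)
      thus "x \<in> {0..<n}" using tb.par_props(3)[of x] Gn by auto
    qed
  qed
  show "card (incident E x) = d" if x: "x \<in> tb.lev k" "k \<le> Suc r" for x k
  proof -
    have "incident E x = incident (edges n G) x"
    proof
      show "incident E x \<subseteq> incident (edges n G) x" by (auto simp: incident_def E_def)
      show "incident (edges n G) x \<subseteq> incident E x"
      proof
        fix e' assume "e' \<in> incident (edges n G) x"
        hence e': "fst e' < snd e'" "G (fst e') (snd e')" "x = fst e' \<or> x = snd e'"
          by (auto simp: incident_def edges_def)
        define u where "u = (if x = fst e' then snd e' else fst e')"
        have u: "G x u" "e' = (min x u, max x u)" "x = fst e' \<or> x = snd e'"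
          using e' Gsym[of "fst e'" "snd e'"] unfolding u_def by (auto simp: prod_eq_iff)
        have "u \<in> tb.ch x \<or> (k > 0 \<and> u = tb.par x)" using tb.nbrs[OF x(1), of u] x(2) u by simp
        hence "u \<in> tb.lev (Suc k) \<or> u \<in> tb.lev (k - 1)"
          using x tb.par_lev[of x "k - 1"] by (auto simp: tb.ch_def tb.lev_def)
        moreover have "Suc k < r + 3" "k - 1 < r + 3" using x(2) by auto
        ultimately have "u \<notin> irregular" using reg(1)[of u "Suc k"] reg(1)[of u "k - 1"] by blast
        moreover have "x \<notin> irregular" using reg(1)[of x k] x by auto
        ultimately have "e' \<in> E" using edge u by simp
        thus "e' \<in> incident E x" using u(3) by (auto simp: incident_def)
      qed
    qed
    moreover have "degree G x = d" using tb.degree_eq[OF x(1)] x(2) by simp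
    moreover have "x < n" using levV[of k] x(1) by auto
    ultimately show ?thesis using card_incident_edges[OF G] by simp
  qed
qed

text \<open>The ball is rooted at the first endpoint of the edge. The root's message is
  \<open>Suc (Suc r)\<close> levels above the boundary and that of its neighbour one level less,
  hence the two different depths in the hypothesis.\<close>

lemma tree_estimate:
  assumes t: "0 \<le> t" "t \<le> T" and e: "e \<in> E" and gb: "good_ball d bip G col (r + 3) (fst e)"
    and box: "message_box t lo hi"
    and pos: "\<And>c c' x y. colour_compat bip c c' \<Longrightarrow> x \<in> {lo (Suc (Suc r)) c..hi (Suc (Suc r)) c} \<Longrightarrow>
       y \<in> {lo (Suc r) c'..hi (Suc r) c'} \<Longrightarrow> 0 \<le> \<alpha> * (x * y) + \<beta> * (1 + t * (x * y))"
  shows "0 \<le> \<alpha> * dZ e t + \<beta> * Z t"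
proof -
  obtain i j where ij: "e = (i, j)" by (cases e)
  have eij: "i < j" "j < n" "G i j" using e E_iff ij by auto
  obtain h where h: "ball_iso d (r + 3) G i h" and colour: "bip \<longrightarrow> (\<forall>x\<in>ball G (r + 3) i. col x = (col i = even (length (h x))))"
    using gb ij by (auto simp: good_ball_def)
  have iN: "i < n" using eij by simp
  interpret tb: tree_ball_iso d "r + 3" G i h by (rule tree_structure(1)[OF h colour iN])
  note Gsym = tb.sym
  note reg = tree_levels[OF tb.tree_ball_iso_axioms colour]
  note levV = tree_structure(2)[OF h colour iN]
  note deg = tree_structure(3)[OF h colour iN]
  have edge: "(min x y, max x y) \<in> E" if "G x y" "x \<notin> irregular" "y \<notin> irregular" for x y
    using that by (rule edge_E)
  let ?Bx = "\<lambda>m v. {lo m (col v)..hi m (col v)}"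
  interpret lt: level_tree "{0..<n}" E Om ze t tb.lev tb.par i r ?Bx
  proof
    show "finite {0..<n}" "finite E" using fin_E by auto
    show "E \<subseteq> {0..<n} \<times> {0..<n}" using E_iff by auto
    show "0 < Om v s" for v s unfolding Om_def using \<psi>b0 w0 by simp
    show "0 \<le> 1 + t * (ze x s * ze y s')" if "(x, y) \<in> E" for x y s s'
      using factor_nonneg(1)[OF E_props(2)[OF that] t] by simp
    show "tb.lev k \<subseteq> {0..<n}" for k by (rule levV)
    show "tb.lev k \<inter> tb.lev k' = {}" if "k < k'" for k k' using that by (auto simp: tb.lev_def)
    show "tb.lev 0 = {i}" by (rule tb.lev_0)
    show "tb.par v \<in> tb.lev k" if "v \<in> tb.lev (Suc k)" for k v using that by (rule tb.par_lev)
    show "(min v (tb.par v), max v (tb.par v)) \<in> E" if k: "k \<le> Suc r" and v: "v \<in> tb.lev (Suc k)" for k v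
    proof (rule edge)
      have "v \<in> ball G (r + 3) i" "h v \<noteq> []" using v by (auto simp: tb.lev_def)
      thus "G v (tb.par v)" using tb.par_props(3) tb.sym by blast
      show "v \<notin> irregular" using reg(1)[OF v] k by simp
      show "tb.par v \<notin> irregular" using reg(1)[OF tb.par_lev[OF v]] k by simp
    qed
    show "\<exists>k' v'. k' \<le> Suc r \<and> v' \<in> tb.lev (Suc k') \<and> (x, y) = (min v' (tb.par v'), max v' (tb.par v'))"
      if k: "k \<le> Suc r" and v: "v \<in> tb.lev k" and xy: "(x, y) \<in> E" and vx: "v = x \<or> v = y" for k v x y
    proof -
      define u where "u = (if v = x then y else x)"
      have x: "x < y" "G x y" using xy E_iff by auto
      hence u: "G v u" "(x, y) = (min v u, max v u)" using vx tb.sym by (auto simp: u_def)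
      from tb.nbrs[OF v, of u] k u have "u \<in> tb.ch v \<or> (k > 0 \<and> u = tb.par v)" by simp
      thus ?thesis
      proof
        assume "u \<in> tb.ch v"
        hence "u \<in> tb.lev (Suc k)" "tb.par u = v" using v by (auto simp: tb.ch_def tb.lev_def)
        thus ?thesis using k u by (intro exI[of _ k] exI[of _ u]) (auto simp: min.commute max.commute)
      next
        assume "k > 0 \<and> u = tb.par v"
        thus ?thesis using k u v by (intro exI[of _ "k - 1"] exI[of _ v]) auto
      qed
    qed
    show "ze v s \<in> ?Bx 0 v" for v s
      using box a0[of "col v"] g0[of "col v"] unfolding message_box_def spin_coord_def by (auto intro: order_trans less_imp_le)
    show "0 < (\<Sum>s\<in>UNIV. Om v s * (\<Prod>u\<in>{u \<in> tb.lev (Suc (Suc k)). tb.par u = v}. 1 + t * (ze v s * z u))) \<and>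
       (\<Sum>s\<in>UNIV. Om v s * ze v s * (\<Prod>u\<in>{u \<in> tb.lev (Suc (Suc k)). tb.par u = v}. 1 + t * (ze v s * z u))) /
       (\<Sum>s\<in>UNIV. Om v s * (\<Prod>u\<in>{u \<in> tb.lev (Suc (Suc k)). tb.par u = v}. 1 + t * (ze v s * z u))) \<in> ?Bx (Suc m) v"
      if k: "k \<le> r" and v: "v \<in> tb.lev (Suc k)"
        and z: "\<And>u. u \<in> tb.lev (Suc (Suc k)) \<Longrightarrow> tb.par u = v \<Longrightarrow> z u \<in> ?Bx m u" for k m v z
    proof (rule message_box_step[OF t box])
      have ch: "{u \<in> tb.lev (Suc (Suc k)). tb.par u = v} = tb.ch v" using v by (auto simp: tb.ch_def tb.lev_def)
      have kN: "Suc k < r + 3" using k by simp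
      show "finite {u \<in> tb.lev (Suc (Suc k)). tb.par u = v}" "card {u \<in> tb.lev (Suc (Suc k)). tb.par u = v} = d - 1"
        unfolding ch using tb.card_ch[OF v kN] by auto
      show "colour_compat bip (col v) (col u)" if "u \<in> {u \<in> tb.lev (Suc (Suc k)). tb.par u = v}" for u
        using that tb.nbrs[OF v kN, of u] unfolding ch by (intro reg(2)[OF v kN]) auto
      show "card (incident E v) = d" using deg[OF v] k by simp
    qed (use z in auto)
    show "0 < (\<Sum>s\<in>UNIV. Om i s * (\<Prod>u\<in>tb.lev 1 - {j}. 1 + t * (ze i s * z u))) \<and>
       (\<Sum>s\<in>UNIV. Om i s * ze i s * (\<Prod>u\<in>tb.lev 1 - {j}. 1 + t * (ze i s * z u))) /
       (\<Sum>s\<in>UNIV. Om i s * (\<Prod>u\<in>tb.lev 1 - {j}. 1 + t * (ze i s * z u))) \<in> ?Bx (Suc m) i"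
      if j: "j \<in> tb.lev 1" and z: "\<And>u. u \<in> tb.lev 1 \<Longrightarrow> z u \<in> ?Bx m u" for j z m
    proof (rule message_box_step[OF t box])
      have i0: "i \<in> tb.lev 0" using tb.lev_0 by simp
      have l1: "tb.lev 1 = tb.ch i" by (rule tb.lev_1) simp
      show "finite (tb.lev 1 - {j})" "card (tb.lev 1 - {j}) = d - 1"
        using tb.card_ch[OF i0] j l1 by auto
      show "colour_compat bip (col i) (col u)" if "u \<in> tb.lev 1 - {j}" for u
        using that tb.nbrs[OF i0, of u] l1 by (intro reg(2)[OF i0]) auto
      show "card (incident E i) = d" using deg[OF i0] by simp
    qed (use z in auto)
  qed
  have i0: "i \<in> tb.lev 0" using tb.lev_0 by simp
  have l1: "tb.lev 1 = tb.ch i" by (rule tb.lev_1) simp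
  have j1: "j \<in> tb.lev 1" unfolding l1 using tb.nbrs[OF i0, of j] eij by simp
  have "tb.par j = i" using j1 l1 by (simp add: tb.ch_def)
  hence te: "lt.te j = e" using eij ij by (simp add: lt.te_def)
  have fac: "lt.fac e \<sigma> = ew t e (\<sigma> (fst e)) (\<sigma> (snd e))" for e \<sigma> by (simp add: lt.fac_def ew_def)
  have cc: "colour_compat bip (col i) (col j)" using E_props(2)[OF e] ij by simp
  have "0 \<le> \<alpha> * spin_sum {0..<n} (\<lambda>\<sigma>. (ze (fst (lt.te j)) (\<sigma> (fst (lt.te j))) * ze (snd (lt.te j)) (\<sigma> (snd (lt.te j))))
              * (\<Prod>e\<in>E - {lt.te j}. lt.fac e \<sigma>) * (\<Prod>v\<in>{0..<n}. Om v (\<sigma> v))) (\<lambda>_. False)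
           + \<beta> * spin_sum {0..<n} (\<lambda>\<sigma>. (\<Prod>e\<in>E. lt.fac e \<sigma>) * (\<Prod>v\<in>{0..<n}. Om v (\<sigma> v))) (\<lambda>_. False)"
    by (rule lt.edge_estimate[OF j1]) (rule pos[OF cc])
  thus ?thesis unfolding te fac dZ_def Z_def wsum_def .
qed

definition bad :: "nat \<Rightarrow> nat set" where "bad R = {v\<in>{0..<n}. \<not> good_ball d bip G col R v}"

lemma good_vertex:
  assumes "v < n" "v \<notin> bad (r + 3)" shows "card (incident E v) = d" "v \<notin> irregular"
proof -
  obtain h where h: "ball_iso d (r + 3) G v h" and colour: "bip \<longrightarrow> (\<forall>x\<in>ball G (r + 3) v. col x = (col v = even (length (h x))))"
    using assms by (auto simp: bad_def good_ball_def)
  interpret tb: tree_ball_iso d "r + 3" G v h by (rule tree_structure(1)[OF h colour assms(1)])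
  have v: "v \<in> tb.lev 0" using tb.lev_0 by simp
  show "card (incident E v) = d" by (rule tree_structure(3)[OF h colour assms(1) v]) simp
  show "v \<notin> irregular" by (rule tree_levels(1)[OF tb.tree_ball_iso_axioms colour v]) simp
qed

lemma card_E: "real (card E) \<le> real n * real d / 2"
proof -
  have "2 * card E = (\<Sum>v\<in>{0..<n}. card (incident E v))"
    by (rule sum_incident[OF fin_E _ E_props(1), symmetric]) auto
  also have "\<dots> \<le> (\<Sum>v\<in>{0..<n}. d)" by (intro sum_mono card_incident_E) auto
  finally have "2 * card E \<le> n * d" by simp
  hence "real (2 * card E) \<le> real (n * d)" by (simp only: of_nat_le_iff)
  thus ?thesis by simp
qed

text \<open>\<open>y\<close> bounds the contribution of an edge whose first endpoint has a tree
  ball, and there are at most \<open>n * d / 2\<close> edges in all. A bad vertex spoils at most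
  \<open>d\<close> edges, each of which costs at most \<open>C2\<close>. The sign
  \<open>\<epsilon>\<close> gives both directions by one argument.\<close>

lemma ln_Z_increment:
  assumes t: "0 \<le> t1" "t1 \<le> t2" "t2 \<le> T" and y: "y \<ge> 0"
    and est: "\<And>t. t1 \<le> t \<Longrightarrow> t \<le> t2 \<Longrightarrow> \<exists>lo hi. message_box t lo hi \<and>
       (\<forall>c c' x z. colour_compat bip c c' \<longrightarrow> x \<in> {lo (Suc (Suc r)) c..hi (Suc (Suc r)) c} \<longrightarrow>
         z \<in> {lo (Suc r) c'..hi (Suc r) c'} \<longrightarrow> 0 \<le> - \<epsilon> * (x * z) + y * (1 + t * (x * z)))"
    and \<epsilon>: "\<bar>\<epsilon>\<bar> \<le> 1"
  shows "\<epsilon> * (ln (Z t2) - ln (Z t1)) \<le> (t2 - t1) * (y * (real n * real d / 2) + C2 * real d * real (card (bad (r + 3))))"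
proof -
  define K where "K = y * (real n * real d / 2) + C2 * real d * real (card (bad (r + 3)))"
  have "t1 * K - \<epsilon> * ln (Z t1) \<le> t2 * K - \<epsilon> * ln (Z t2)"
  proof (rule DERIV_nonneg_imp_nondecreasing[OF t(2)])
    fix s assume s: "t1 \<le> s" "s \<le> t2"
    have s0: "0 \<le> s" "s \<le> T" using s t by auto
    have Zp: "Z s > 0" by (rule Z_pos[OF s0])
    have der: "((\<lambda>t. t * K - \<epsilon> * ln (Z t)) has_real_derivative K - \<epsilon> * ((\<Sum>e\<in>E. dZ e s) / Z s)) (at s)"
      using Zp by (auto intro!: derivative_eq_intros Z_deriv)
    obtain lo hi where box: "message_box s lo hi" and pos: "\<And>c c' x z. colour_compat bip c c' \<Longrightarrow> x \<in> {lo (Suc (Suc r)) c..hi (Suc (Suc r)) c} \<Longrightarrow>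
         z \<in> {lo (Suc r) c'..hi (Suc r) c'} \<Longrightarrow> 0 \<le> - \<epsilon> * (x * z) + y * (1 + s * (x * z))"
      using est[OF s] by blast
    let ?B = "{e\<in>E. fst e \<in> bad (r + 3)}"
    have "\<epsilon> * dZ e s \<le> (y + (if e \<in> ?B then C2 else 0)) * Z s" if e: "e \<in> E" for e
    proof (cases "e \<in> ?B")
      case True
      have "\<epsilon> * dZ e s \<le> \<bar>\<epsilon>\<bar> * \<bar>dZ e s\<bar>" by (metis abs_ge_self abs_mult)
      also have "\<dots> \<le> 1 * \<bar>dZ e s\<bar>" using \<epsilon> by (intro mult_right_mono) auto
      also have "\<dots> \<le> C2 * Z s" using dZ_bound[OF s0 e] by simp
      also have "\<dots> \<le> (y + C2) * Z s" using y Zp by (intro mult_right_mono) auto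
      finally show ?thesis using True by simp
    next
      case False
      hence "good_ball d bip G col (r + 3) (fst e)" using e E_props(1)[OF e] by (auto simp: bad_def)
      hence "0 \<le> - \<epsilon> * dZ e s + y * Z s" by (rule tree_estimate[OF s0 e _ box pos])
      moreover have "(if e \<in> ?B then C2 else 0) = 0" using False by (rule if_not_P)
      ultimately show ?thesis by simp
    qed
    hence "\<epsilon> * (\<Sum>e\<in>E. dZ e s) \<le> (\<Sum>e\<in>E. (y + (if e \<in> ?B then C2 else 0)) * Z s)"
      unfolding sum_distrib_left by (rule sum_mono)
    also have "\<dots> = (y * real (card E) + C2 * real (card ?B)) * Z s"
    proof -
      have "(\<Sum>e\<in>E. if e \<in> ?B then C2 else 0) = (\<Sum>e\<in>E \<inter> ?B. C2)"
        using fin_E by (rule sum.inter_restrict[symmetric])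
      also have "E \<inter> ?B = ?B" by blast
      finally have "(\<Sum>e\<in>E. if e \<in> ?B then C2 else 0) = C2 * real (card ?B)" by (simp only: sum_constant mult.commute)
      thus ?thesis unfolding sum_distrib_right[symmetric] sum.distrib by (simp only: sum_constant mult.commute)
    qed
    also have "\<dots> \<le> K * Z s"
    proof (rule mult_right_mono)
      have "card ?B \<le> card (\<Union>v\<in>bad (r + 3). incident E v)"
        by (intro card_mono) (auto simp: incident_def bad_def fin_E)
      also have "\<dots> \<le> (\<Sum>v\<in>bad (r + 3). card (incident E v))" by (rule card_UN_le) (simp add: bad_def)
      also have "\<dots> \<le> (\<Sum>v\<in>bad (r + 3). d)" by (intro sum_mono card_incident_E) (auto simp: bad_def)
      finally have "card ?B \<le> card (bad (r + 3)) * d" by simp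
      hence "real (card ?B) \<le> real (card (bad (r + 3)) * d)" by (simp only: of_nat_le_iff)
      hence "C2 * real (card ?B) \<le> C2 * real (card (bad (r + 3)) * d)" using C2_nonneg by (rule mult_left_mono)
      moreover have "y * real (card E) \<le> y * (real n * real d / 2)" using y card_E by (rule mult_left_mono[rotated])
      ultimately show "y * real (card E) + C2 * real (card ?B) \<le> K" unfolding K_def by (simp add: mult_ac)
    qed (use Zp in simp)
    finally have "\<epsilon> * ((\<Sum>e\<in>E. dZ e s) / Z s) \<le> K" using Zp by (simp add: pos_divide_le_eq)
    thus "\<exists>y. ((\<lambda>t. t * K - \<epsilon> * ln (Z t)) has_real_derivative y) (at s) \<and> 0 \<le> y" using der by auto
  qed
  thus ?thesis unfolding K_def[symmetric] by (simp add: algebra_simps)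
qed

end

section \<open>Constants uniform in the graph\<close>

context bounded_spin_gauge begin

declare U.simps(2) [simp del]

text \<open>The error at \<open>t = 0\<close> of a vertex that has \<open>k\<close> edges instead of
  \<open>d\<close>.\<close>

definition C1 :: real where
  "C1 = Max ((\<lambda>(c, k). \<bar>ln (\<psi>b True * w c True ^ k + \<psi>b False * w c False ^ k) - L c 0\<bar>) ` (UNIV \<times> {..d}))"

lemma C1_bound: "k \<le> d \<Longrightarrow> \<bar>ln (\<psi>b True * w c True ^ k + \<psi>b False * w c False ^ k) - L c 0\<bar> \<le> C1"
  unfolding C1_def by (intro Max_ge) (auto intro!: image_eqI[where x = "(c, k)"])

lemma L_0: "L c 0 = ln (\<psi>b True * w c True ^ d + \<psi>b False * w c False ^ d)"
  unfolding L_def p_eq q_eq by (cases "f c") (simp_all add: add.commute)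

lemma U_uncoloured: "\<not> bip \<Longrightarrow> U t k False = U t k True"
proof (induction k)
  case 0 thus ?case using uncoloured by simp
next
  case (Suc k)
  have "A False = A True" using uncoloured[OF Suc.prems] by (auto simp: A_def den_def fun_eq_iff)
  thus ?case using Suc by (simp add: U.simps(2))
qed

lemma compat_U: "colour_compat bip c c' \<Longrightarrow> U t k c * U t k c' = U t k True * U t k False"
  using U_uncoloured[of t k] by (cases bip; cases c; cases c') (auto simp: colour_compat_def)

text \<open>The expression is affine in \<open>x\<close>, so only the ends \<open>- g c\<close> and
  \<open>a c\<close> matter, and there it is one of the two factors in \<open>adm\<close>.\<close>

lemma factor_box:
  assumes "0 \<le> t" "t \<le> T" "- g c \<le> x" "x \<le> a c" "- g (\<not> c) \<le> z" "z \<le> a (\<not> c)"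
  shows "0 \<le> 1 + t * (x * z)"
proof -
  have ad: "0 \<le> 1 + a c * (t * z)" "0 \<le> 1 - g c * (t * z)" using adm_box[of t c z] assms by (auto simp: adm_def)
  show ?thesis
  proof (cases "t * z \<ge> 0")
    case True
    hence "- g c * (t * z) \<le> x * (t * z)" using assms by (intro mult_right_mono) auto
    thus ?thesis using ad by (simp add: mult_ac)
  next
    case False
    hence "a c * (t * z) \<le> x * (t * z)" using assms by (intro mult_right_mono_neg) auto
    thus ?thesis using ad by (simp add: mult_ac)
  qed
qed

lemma compat_box:
  assumes "colour_compat bip c c'" "- g c' \<le> z" "z \<le> a c'" shows "- g (\<not> c) \<le> z" "z \<le> a (\<not> c)"
  using assms uncoloured by (auto simp: colour_compat_def split: if_splits)

definition Ctot :: real where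
  "Ctot = max (ln M) (max (ln (2 * \<kappa>)) (ln (1 / \<delta>))) + C1 + T * (Zm * (2 * \<kappa> * (M / \<delta>) ^ d) * real d)"

end

section \<open>Bounds on the partition function of a fixed graph\<close>

context graph_gauge begin

lemma C0_nonneg: "C0 \<ge> 0" using ln_ge_zero[OF M1] by (simp add: C0_def le_max_iff_disj)

lemma C1_nonneg: "C1 \<ge> 0" using C1_bound[of 0 True] by linarith

lemma bad_sum_ge: "real (card (bad R)) \<le> (\<Sum>v\<in>bad R. real (degree G v) + 1)"
proof -
  have "(\<Sum>v\<in>bad R. 1) \<le> (\<Sum>v\<in>bad R. real (degree G v) + 1)" by (intro sum_mono) auto
  thus ?thesis by simp
qed

lemma ln_Z_0: "\<bar>ln (Z 0) - (\<Sum>v\<in>{0..<n}. L (col v) 0)\<bar> \<le> C1 * real (card (bad (r + 3)))"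
proof -
  have pos: "Om v True + Om v False > 0" for v using \<psi>b0 w0 by (auto simp: Om_def intro!: add_pos_pos)
  have "ln (Z 0) = (\<Sum>v\<in>{0..<n}. ln (Om v True + Om v False))"
    unfolding Z_0 using pos less_imp_neq by (intro ln_prod) fastforce+
  hence "\<bar>ln (Z 0) - (\<Sum>v\<in>{0..<n}. L (col v) 0)\<bar> \<le> (\<Sum>v\<in>{0..<n}. \<bar>ln (Om v True + Om v False) - L (col v) 0\<bar>)"
    by (simp add: sum_subtractf[symmetric] sum_abs)
  also have "\<dots> \<le> (\<Sum>v\<in>{0..<n}. if v \<in> bad (r + 3) then C1 else 0)"
  proof (rule sum_mono)
    fix v assume v: "v \<in> {0..<n}"
    show "\<bar>ln (Om v True + Om v False) - L (col v) 0\<bar> \<le> (if v \<in> bad (r + 3) then C1 else 0)"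
    proof (cases "v \<in> bad (r + 3)")
      case True thus ?thesis using C1_bound[OF card_incident_E, of v "col v"] v by (simp add: Om_def)
    next
      case False
      thus ?thesis using good_vertex(1)[of v r] v by (simp add: Om_def L_0)
    qed
  qed
  also have "\<dots> = (\<Sum>v\<in>{0..<n} \<inter> bad (r + 3). C1)" by (rule sum.inter_restrict[symmetric]) simp
  also have "{0..<n} \<inter> bad (r + 3) = bad (r + 3)" by (auto simp: bad_def)
  finally show ?thesis by (simp add: mult.commute)
qed

lemma irregular_sum:
  "(\<Sum>v\<in>irregular. real (degree G v) + 1) \<le> (\<Sum>v\<in>bad (r + 3). real (degree G v) + 1)"
proof (rule sum_mono2)
  show "irregular \<subseteq> bad (r + 3)" using good_vertex(2)[of _ r] by (auto simp: irregular_def)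
qed (auto simp: bad_def)

lemma ln_partition_fn_bound:
  assumes y: "\<epsilon> * (ln (Z T) - ln (Z 0)) \<le> Y + T * (C2 * real d * real (card (bad (r + 3))))" and \<epsilon>: "\<bar>\<epsilon>\<bar> = 1"
  shows "\<epsilon> * (ln (partition_fn \<psi> \<psi>b n G) - (\<Sum>v\<in>{0..<n}. L (col v) 0))
    \<le> Y + Ctot * (\<Sum>v\<in>bad (r + 3). real (degree G v) + 1)"
proof -
  let ?S = "\<Sum>v\<in>bad (r + 3). real (degree G v) + 1"
  let ?l = "ln (partition_fn \<psi> \<psi>b n G)"
  have e: "\<epsilon> * x \<le> \<bar>x\<bar>" for x using abs_ge_self[of "\<epsilon> * x"] \<epsilon> by (simp add: abs_mult)
  have 1: "\<epsilon> * (?l - ln (Z T)) \<le> C0 * ?S"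
    using e[of "?l - ln (Z T)"] ln_partition_fn mult_left_mono[OF irregular_sum[of r] C0_nonneg] by linarith
  have 2: "\<epsilon> * (ln (Z 0) - (\<Sum>v\<in>{0..<n}. L (col v) 0)) \<le> C1 * ?S"
    using e[of "ln (Z 0) - (\<Sum>v\<in>{0..<n}. L (col v) 0)"] ln_Z_0[of r] mult_left_mono[OF bad_sum_ge[of "r + 3"] C1_nonneg] by linarith
  have 3: "T * (C2 * real d * real (card (bad (r + 3)))) \<le> T * (C2 * real d) * ?S"
    using mult_left_mono[OF bad_sum_ge[of "r + 3"], of "T * (C2 * real d)"] T0 C2_nonneg by (simp add: mult.assoc)
  have "\<epsilon> * (?l - (\<Sum>v\<in>{0..<n}. L (col v) 0)) = \<epsilon> * (?l - ln (Z T)) + \<epsilon> * (ln (Z T) - ln (Z 0)) + \<epsilon> * (ln (Z 0) - (\<Sum>v\<in>{0..<n}. L (col v) 0))"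
    by (simp add: algebra_simps)
  also have "\<dots> \<le> C0 * ?S + (Y + T * (C2 * real d) * ?S) + C1 * ?S" using 1 2 3 y by linarith
  also have "\<dots> = Y + Ctot * ?S" unfolding Ctot_def C0_def C2_def by (simp add: algebra_simps)
  finally show ?thesis .
qed

text \<open>A product of two messages is negative only if one of them is positive, and positive
  messages are at most \<open>\<eta>\<close>. The derivative of \<open>ln Z\<close> is therefore
  almost nonnegative; the lower ends of the boxes are the trivial ones.\<close>

lemma ln_partition_fn_lower:
  assumes \<eta>: "\<And>c. U T (Suc r) c \<le> \<eta>" and Gm: "\<And>c. g c \<le> Gm" and small: "T * (Gm * \<eta>) \<le> 1 / 2"
  shows "ln (partition_fn \<psi> \<psi>b n G) \<ge> (\<Sum>v\<in>{0..<n}. L (col v) 0)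
    - T * (2 * (Gm * \<eta>)) * (real n * real d / 2) - Ctot * (\<Sum>v\<in>bad (r + 3). real (degree G v) + 1)"
proof -
  have U0: "0 \<le> U T k c" for k c using U_box[OF T0 order_refl] by blast
  have \<eta>0: "\<eta> \<ge> 0" using U0[of "Suc r" True] \<eta>[of True] by linarith
  have Gm0: "Gm \<ge> 0" using g0[of True] Gm[of True] by linarith
  have "- 1 * (ln (Z T) - ln (Z 0)) \<le> (T - 0) * (2 * (Gm * \<eta>) * (real n * real d / 2) + C2 * real d * real (card (bad (r + 3))))"
  proof (rule ln_Z_increment)
    fix t assume t: "0 \<le> t" "t \<le> T"
    have box: "message_box t (\<lambda>_ c. - g c) (U t)"
      unfolding message_box_def
    proof (intro conjI allI impI)
      fix m c
      show "- g c \<le> U t m c" "U t m c \<le> a c" using U_box[OF t, of m c] g0[of c] by auto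
      show "- g c \<le> A c (t * - g (\<not> c))"
        using t g0[of "\<not> c"] a0[of "\<not> c"] by (intro A_ge adm_box) (auto intro: order_trans less_imp_le)
    next
      fix m assume "\<not> bip"
      thus "- g False = - g True" "U t m False = U t m True" using uncoloured U_uncoloured by auto
    qed (auto simp: U.simps(2))
    have "0 \<le> - (- 1) * (x * z) + 2 * (Gm * \<eta>) * (1 + t * (x * z))"
      if cc: "colour_compat bip c c'" and x: "x \<in> {- g c..U t (Suc (Suc r)) c}" and z: "z \<in> {- g c'..U t (Suc r) c'}" for c c' x z
    proof -
      have xl: "x \<le> \<eta>" using x U_antimono[OF t, of "Suc r" c] U_mono_t[OF t order_refl, of "Suc r" c] \<eta>[of c] by auto
      have zl: "z \<le> \<eta>" using z U_mono_t[OF t order_refl, of "Suc r" c'] \<eta>[of c'] by auto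
      have xg: "- Gm \<le> x" "- Gm \<le> z" using x z Gm[of c] Gm[of c'] by auto
      have low: "- (Gm * \<eta>) \<le> x * z"
      proof (cases "x * z \<ge> 0")
        case True thus ?thesis using Gm0 \<eta>0 by (meson le_minus_iff minus_le_iff mult_nonneg_nonneg order_trans neg_le_0_iff_le)
      next
        case False
        hence "(x < 0 \<and> z > 0) \<or> (x > 0 \<and> z < 0)" by (auto simp: not_le mult_less_0_iff)
        thus ?thesis
        proof
          assume "x < 0 \<and> z > 0"
          hence "(- x) * z \<le> Gm * \<eta>" using xg zl Gm0 by (intro mult_mono) auto
          thus ?thesis by simp
        next
          assume "x > 0 \<and> z < 0"
          hence "(- z) * x \<le> Gm * \<eta>" using xg xl Gm0 by (intro mult_mono) auto
          thus ?thesis by (simp add: mult.commute)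
        qed
      qed
      have "t * (x * z) \<ge> - (1 / 2)"
      proof -
        have "t * (- (Gm * \<eta>)) \<le> t * (x * z)" using low t by (intro mult_left_mono) auto
        moreover have "t * (Gm * \<eta>) \<le> T * (Gm * \<eta>)" using t Gm0 \<eta>0 by (intro mult_right_mono) auto
        ultimately show ?thesis using small by simp
      qed
      \<comment> \<open>The factor \<open>2\<close> in the slope compensates for
        \<open>1 + t * (x * z)\<close>, which is only known to be at least
        \<open>1 / 2\<close>.\<close>
      hence "2 * (Gm * \<eta>) * (1 / 2) \<le> 2 * (Gm * \<eta>) * (1 + t * (x * z))" using Gm0 \<eta>0 by (intro mult_left_mono) auto
      thus ?thesis using low by simp
    qed
    thus "\<exists>lo hi. message_box t lo hi \<and> (\<forall>c c' x z. colour_compat bip c c' \<longrightarrow> x \<in> {lo (Suc (Suc r)) c..hi (Suc (Suc r)) c} \<longrightarrow>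
         z \<in> {lo (Suc r) c'..hi (Suc r) c'} \<longrightarrow> 0 \<le> - (- 1) * (x * z) + 2 * (Gm * \<eta>) * (1 + t * (x * z)))"
      using box by (intro exI[of _ "\<lambda>_ c. - g c"] exI[of _ "U t"]) blast
  qed (use T0 Gm0 \<eta>0 in auto)
  hence "- 1 * (ln (Z T) - ln (Z 0)) \<le> T * (2 * (Gm * \<eta>)) * (real n * real d / 2) + T * (C2 * real d * real (card (bad (r + 3))))"
    by (simp add: algebra_simps)
  from ln_partition_fn_bound[OF this] show ?thesis by simp
qed

text \<open>By \<open>odd\<close> all messages are bounded below by \<open>- U\<close> of the
  opposite colour. On an edge the two positive and the two negative extremes then have the same
  product, and this bounds every product of messages from above.\<close>

lemma ln_partition_fn_upper:
  assumes sym: "\<And>c. a (\<not> c) = g c" and odd: "\<And>c y. 0 \<le> y \<Longrightarrow> adm (\<not> c) y \<Longrightarrow> - A (\<not> c) y \<le> A c (- y)" and N: "N > 0"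
  shows "ln (partition_fn \<psi> \<psi>b n G) \<le> (\<Sum>v\<in>{0..<n}. L (col v) 0)
    + (real n * real d / 2) * (\<Sum>i<N. T / real N * inc N (Suc r) i) + Ctot * (\<Sum>v\<in>bad (r + 3). real (degree G v) + 1)"
proof -
  define s where "s i = T * real i / real N" for i
  have s: "0 \<le> s i" "s i \<le> s (Suc i)" for i using T0 N by (auto simp: s_def divide_right_mono mult_left_mono)
  have sT: "s i \<le> T" if "i \<le> N" for i
    using T0 N that by (simp add: s_def pos_divide_le_eq mult_left_mono)
  have sN: "s N = T" "s 0 = 0" using N by (auto simp: s_def)
  have ds: "s (Suc i) - s i = T / real N" for i by (simp add: s_def diff_divide_distrib[symmetric] algebra_simps)
  let ?K = "C2 * real d * real (card (bad (r + 3)))"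
  \<comment> \<open>On each interval \<open>inc\<close> combines the largest messages, those at the
    right end, with the smallest parameter in the denominator.\<close>
  have step: "1 * (ln (Z (s (Suc i))) - ln (Z (s i))) \<le> (s (Suc i) - s i) * (inc N (Suc r) i * (real n * real d / 2) + ?K)"
    if i: "i < N" for i
  proof (rule ln_Z_increment)
    define P where "P = U (s (Suc i)) (Suc r) True * U (s (Suc i)) (Suc r) False"
    have v: "0 \<le> s (Suc i)" "s (Suc i) \<le> T" using s sT i by (auto intro: order_trans)
    have P0: "P \<ge> 0" unfolding P_def using U_box[OF v] by (intro mult_nonneg_nonneg) blast+
    have inc: "inc N (Suc r) i = P / (1 + s i * P)" by (simp add: inc_def P_def s_def Let_def)
    have d0: "1 + s i * P > 0" using s P0 by (simp add: add_pos_nonneg)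
    show "0 \<le> inc N (Suc r) i" unfolding inc using P0 d0 by simp
    fix t assume t': "s i \<le> t" "t \<le> s (Suc i)"
    have t: "0 \<le> t" "t \<le> T" using t' s[of i] v by auto
    have UP: "U t (Suc r) c * U t (Suc r) c' \<le> P" if "colour_compat bip c c'" for c c'
    proof -
      have "U t (Suc r) True * U t (Suc r) False \<le> P"
        unfolding P_def using U_mono_t[OF t(1) t'(2) v(2)] U_box[OF t] U_box[OF v] by (intro mult_mono) blast+
      thus ?thesis unfolding compat_U[OF that] .
    qed
    have box: "message_box t (\<lambda>m c. - U t m (\<not> c)) (U t)"
      unfolding message_box_def
    proof (intro conjI allI impI)
      fix m c
      show "- U t 0 (\<not> c) = - g c" using sym by simp
      show "- g c \<le> - U t m (\<not> c)" using U_box[OF t, of m "\<not> c"] sym[of c] by simp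
      show "- U t m (\<not> c) \<le> U t m c" using U_box[OF t, of m "\<not> c"] U_box[OF t, of m c] by linarith
      show "U t m c \<le> a c" using U_box[OF t, of m c] by simp
      have "adm (\<not> c) (t * U t m c)" using U_adm[OF t, of "\<not> c" m] by simp
      thus "- U t (Suc m) (\<not> c) \<le> A c (t * - U t m (\<not> \<not> c))"
        using odd[of "t * U t m c" c] U_box[OF t, of m c] t by (simp add: U.simps(2))
    next
      fix m assume "\<not> bip"
      thus "- U t m (\<not> False) = - U t m (\<not> True)" "U t m False = U t m True" using U_uncoloured by auto
    qed (auto simp: U.simps(2))
    have "0 \<le> - 1 * (x * z) + inc N (Suc r) i * (1 + t * (x * z))"
      if cc: "colour_compat bip c c'" and x: "x \<in> {- U t (Suc (Suc r)) (\<not> c)..U t (Suc (Suc r)) c}"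
        and z: "z \<in> {- U t (Suc r) (\<not> c')..U t (Suc r) c'}" for c c' x z
    proof -
      let ?U = "U t (Suc r)"
      have cn: "?U (\<not> c') = ?U c" "?U (\<not> c) = ?U c'"
        using cc U_uncoloured[of t "Suc r"] by (auto simp: colour_compat_def split: if_splits)
      have xb: "x \<le> ?U c" "- ?U c' \<le> x" using x U_antimono[OF t, of "Suc r" c] U_antimono[OF t, of "Suc r" "\<not> c"] cn by auto
      have zb: "z \<le> ?U c'" "- ?U c \<le> z" using z cn by auto
      have U0: "0 \<le> ?U c" "0 \<le> ?U c'" using U_box[OF t] by auto
      have qP: "x * z \<le> P"
      proof (cases "x * z \<le> 0")
        case True thus ?thesis using P0 by linarith
      next
        case False
        hence "(x > 0 \<and> z > 0) \<or> (x < 0 \<and> z < 0)" by (auto simp: not_le zero_less_mult_iff)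
        hence "x * z \<le> ?U c * ?U c'"
        proof
          assume "x > 0 \<and> z > 0" thus ?thesis using xb zb by (intro mult_mono) auto
        next
          assume "x < 0 \<and> z < 0"
          hence "(- x) * (- z) \<le> ?U c' * ?U c" using xb zb U0 by (intro mult_mono) auto
          thus ?thesis by (simp add: mult.commute)
        qed
        thus ?thesis using UP[OF cc] by linarith
      qed
      have q1: "0 \<le> 1 + t * (x * z)"
      proof (rule factor_box[OF t, of c])
        show "- g c \<le> x" "x \<le> a c" using x U_box[OF t, of "Suc (Suc r)" c] U_box[OF t, of "Suc (Suc r)" "\<not> c"] sym[of c] by auto
        have zz: "- g c' \<le> z" "z \<le> a c'" using z U_box[OF t, of "Suc r" c'] U_box[OF t, of "Suc r" "\<not> c'"] sym[of c'] by auto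
        show "- g (\<not> c) \<le> z" "z \<le> a (\<not> c)" using compat_box[OF cc zz] by auto
      qed
      have "x * z * (1 + s i * P) \<le> P * (1 + t * (x * z))"
      proof (cases "x * z \<ge> 0")
        case True
        have "x * z * (s i * P) \<le> P * (t * (x * z))"
          using mult_right_mono[OF t'(1), of "x * z * P"] True P0 by (simp add: mult_ac)
        thus ?thesis using qP by (simp add: algebra_simps)
      next
        case False
        hence "x * z \<le> 0" by (meson nle_le)
        hence "x * z * (1 + s i * P) \<le> 0" using mult_nonpos_nonneg[of "x * z" "1 + s i * P"] d0 by (meson less_imp_le)
        also have "0 \<le> P * (1 + t * (x * z))" using P0 q1 by simp
        finally show ?thesis .
      qed
      hence "x * z \<le> P * (1 + t * (x * z)) / (1 + s i * P)" using d0 by (simp add: pos_le_divide_eq)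
      thus ?thesis unfolding inc by simp
    qed
    thus "\<exists>lo hi. message_box t lo hi \<and> (\<forall>c c' x z. colour_compat bip c c' \<longrightarrow> x \<in> {lo (Suc (Suc r)) c..hi (Suc (Suc r)) c} \<longrightarrow>
         z \<in> {lo (Suc r) c'..hi (Suc r) c'} \<longrightarrow> 0 \<le> - 1 * (x * z) + inc N (Suc r) i * (1 + t * (x * z)))"
      using box by (intro exI[of _ "\<lambda>m c. - U t m (\<not> c)"] exI[of _ "U t"]) blast
  qed (use s sT i in auto)
  have "ln (Z (s N)) - ln (Z (s 0)) = (\<Sum>i<N. ln (Z (s (Suc i))) - ln (Z (s i)))"
    by (rule sum_lessThan_telescope[of "\<lambda>i. ln (Z (s i))", symmetric])
  also have "\<dots> \<le> (\<Sum>i<N. T / real N * (inc N (Suc r) i * (real n * real d / 2) + ?K))"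
    using step unfolding ds by (intro sum_mono) auto
  also have "\<dots> = (real n * real d / 2) * (\<Sum>i<N. T / real N * inc N (Suc r) i) + T * ?K"
    using N by (simp add: distrib_left sum.distrib sum_distrib_left mult_ac)
  finally have "1 * (ln (Z T) - ln (Z 0)) \<le> (real n * real d / 2) * (\<Sum>i<N. T / real N * inc N (Suc r) i) + T * ?K"
    unfolding sN by simp
  from ln_partition_fn_bound[OF this] show ?thesis by simp
qed

end

section \<open>Limits of the free energy\<close>

lemma finite_simple_graphs: "finite {G. simple_graph_on n G}"
proof (rule finite_imageD)
  let ?h = "\<lambda>G :: graph. {(i, j). G i j}"
  have "?h ` {G. simple_graph_on n G} \<subseteq> Pow ({..<n} \<times> {..<n})"
    unfolding simple_graph_on_def by blast
  thus "finite (?h ` {G. simple_graph_on n G})" by (rule finite_subset) simp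
  show "inj_on ?h {G. simple_graph_on n G}" by (auto simp: inj_on_def fun_eq_iff set_eq_iff)
qed

lemma finite_set_random_graph: "random_graph_seq P \<Longrightarrow> finite (set_pmf (P n))"
  by (rule finite_subset[OF _ finite_simple_graphs[of n]]) (auto simp: random_graph_seq_def)

lemma finite_set_rooted:
  assumes "random_graph_seq P" "n > 0" shows "finite (set_pmf (rooted P n))"
  using finite_set_random_graph[OF assms(1), of n] assms(2) by (auto simp: rooted_def)

lemma expectation_rooted:
  fixes F :: "graph \<times> nat \<Rightarrow> real"
  assumes "random_graph_seq P" "n > 0"
  shows "measure_pmf.expectation (rooted P n) F
     = measure_pmf.expectation (P n) (\<lambda>G. (\<Sum>v\<in>{0..<n}. F (G, v)) / real n)"
proof -
  have fin: "finite (set_pmf (P n))" by (rule finite_set_random_graph[OF assms(1)])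
  have "measure_pmf.expectation (rooted P n) F = (\<Sum>G\<in>set_pmf (P n). pmf (P n) G *\<^sub>R
      measure_pmf.expectation (map_pmf (\<lambda>v. (G, v)) (pmf_of_set {0..<n})) F)"
    unfolding rooted_def using fin assms(2) by (intro pmf_expectation_bind) auto
  also have "\<dots> = (\<Sum>G\<in>set_pmf (P n). pmf (P n) G *\<^sub>R ((\<Sum>v\<in>{0..<n}. F (G, v)) / real n))"
    using assms(2) by (intro sum.cong refl) (simp add: integral_pmf_of_set)
  also have "\<dots> = measure_pmf.expectation (P n) (\<lambda>G. (\<Sum>v\<in>{0..<n}. F (G, v)) / real n)"
    using fin by (intro integral_measure_pmf[symmetric]) auto
  finally show ?thesis .
qed

text \<open>Truncation at a degree \<open>L\<close>: large degrees are controlled by uniform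
  sparsity, the others by the vanishing probability of a bad ball.\<close>

lemma expectation_bad_tendsto_0:
  assumes rg: "random_graph_seq P" and sparse: "uniformly_sparse P"
    and good: "(\<lambda>n. measure_pmf.prob (rooted P n) {(G, v). Q n G v}) \<longlonglongrightarrow> 1"
  shows "(\<lambda>n. measure_pmf.expectation (rooted P n)
     (\<lambda>(G, v). (real (degree G v) + 1) * (if Q n G v then 0 else 1))) \<longlonglongrightarrow> 0"
proof -
  let ?B = "\<lambda>n. measure_pmf.expectation (rooted P n) (\<lambda>(G, v). (real (degree G v) + 1) * (if Q n G v then 0 else 1))"
  let ?D = "\<lambda>L n. measure_pmf.expectation (rooted P n) (\<lambda>(G, v). real (degree G v) * (if degree G v \<ge> L then 1 else 0))"
  have B0: "?B n \<ge> 0" for n by (rule integral_nonneg_AE) auto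
  have bound: "?B n \<le> ?D L n + (real L + 1) * (1 - measure_pmf.prob (rooted P n) {(G, v). Q n G v})" if n: "n > 0" for n L
  proof -
    note int = integrable_measure_pmf_finite[OF finite_set_rooted[OF rg n]]
    have "?B n \<le> measure_pmf.expectation (rooted P n) (\<lambda>x. (case x of (G, v) \<Rightarrow> real (degree G v) * (if degree G v \<ge> L then 1 else 0))
        + (real L + 1) * indicator (- {(G, v). Q n G v}) x)"
      by (rule integral_mono[OF int int]) (auto split: split_indicator)
    also have "\<dots> = ?D L n + (real L + 1) * measure_pmf.prob (rooted P n) (- {(G, v). Q n G v})"
      by (subst Bochner_Integration.integral_add[OF int int]) simp
    also have "measure_pmf.prob (rooted P n) (- {(G, v). Q n G v}) = 1 - measure_pmf.prob (rooted P n) {(G, v). Q n G v}"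
      using measure_pmf.prob_compl[of "{(G, v). Q n G v}" "rooted P n"] by (simp add: Compl_eq_Diff_UNIV)
    finally show ?thesis .
  qed
  show ?thesis
  proof (rule order_tendstoI)
    fix e :: real assume "e < 0"
    thus "eventually (\<lambda>n. e < ?B n) sequentially" using B0 by (intro always_eventually allI) (meson less_le_trans)
  next
    fix e :: real assume e: "0 < e"
    have "eventually (\<lambda>L::nat. limsup (\<lambda>n. ereal (?D L n)) < ereal (e / 2)) sequentially"
      using sparse e unfolding uniformly_sparse_def by (intro order_tendstoD(2)[of _ 0]) auto
    then obtain L where "limsup (\<lambda>n. ereal (?D L n)) < ereal (e / 2)"
      unfolding eventually_sequentially by blast
    hence 1: "eventually (\<lambda>n. ?D L n < e / 2) sequentially"
      using Limsup_lessD[of sequentially "\<lambda>n. ereal (?D L n)" "ereal (e / 2)"] by simp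
    have "(\<lambda>n. (real L + 1) * (1 - measure_pmf.prob (rooted P n) {(G, v). Q n G v})) \<longlonglongrightarrow> (real L + 1) * (1 - 1)"
      by (intro tendsto_intros good)
    hence 2: "eventually (\<lambda>n. (real L + 1) * (1 - measure_pmf.prob (rooted P n) {(G, v). Q n G v}) < e / 2) sequentially"
      using e by (intro order_tendstoD(2)[of _ 0]) auto
    from 1 2 eventually_gt_at_top[of 0] show "eventually (\<lambda>n. ?B n < e) sequentially"
    proof eventually_elim
      case (elim n) thus ?case using bound[of n L] by linarith
    qed
  qed
qed

section \<open>Passing to the expected free energy\<close>

context bounded_spin_gauge begin

context
  fixes P :: "nat \<Rightarrow> graph pmf" and col :: "nat \<Rightarrow> graph \<Rightarrow> nat \<Rightarrow> bool" and Lbar :: real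
  assumes rg: "random_graph_seq P" and sparse: "uniformly_sparse P"
    and uncol: "\<And>n G. \<not> bip \<Longrightarrow> col n G = (\<lambda>_. True)"
    and good: "\<And>R. (\<lambda>n. measure_pmf.prob (rooted P n) {(G, v). good_ball d bip G (col n G) R v}) \<longlonglongrightarrow> 1"
    and Lbar: "(\<lambda>n. measure_pmf.expectation (rooted P n) (\<lambda>(G, v). L (col n G v) 0)) \<longlonglongrightarrow> Lbar"
begin

lemma free_energy_bound:
  assumes n: "n > 0"
    and bd: "\<And>G. simple_graph_on n G \<Longrightarrow>
      \<epsilon> * (ln (partition_fn \<psi> \<psi>b n G) - (\<Sum>v\<in>{0..<n}. L (col n G v) 0))
      \<le> real n * K + Ctot * (\<Sum>v\<in>{v\<in>{0..<n}. \<not> good_ball d bip G (col n G) R v}. real (degree G v) + 1)"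
  shows "\<epsilon> * (free_energy_seq \<psi> \<psi>b P n - measure_pmf.expectation (rooted P n) (\<lambda>(G, v). L (col n G v) 0))
    \<le> K + Ctot * measure_pmf.expectation (rooted P n)
        (\<lambda>(G, v). (real (degree G v) + 1) * (if good_ball d bip G (col n G) R v then 0 else 1))"
proof -
  note int = integrable_measure_pmf_finite[OF finite_set_random_graph[OF rg, of n]]
  let ?b = "\<lambda>(G, v). (real (degree G v) + 1) * (if good_ball d bip G (col n G) R v then 0 else 1)"
  let ?l = "\<lambda>(G, v). L (col n G v) 0"
  have "\<epsilon> * (free_energy_seq \<psi> \<psi>b P n - measure_pmf.expectation (rooted P n) ?l)
     = measure_pmf.expectation (P n) (\<lambda>G. \<epsilon> * (ln (partition_fn \<psi> \<psi>b n G) / real n - (\<Sum>v\<in>{0..<n}. ?l (G, v)) / real n))"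
    unfolding free_energy_seq_def expectation_rooted[OF rg n]
    by (subst integral_mult_right_zero, subst Bochner_Integration.integral_diff[OF int int]) simp
  also have "\<dots> \<le> measure_pmf.expectation (P n) (\<lambda>G. K + Ctot * ((\<Sum>v\<in>{0..<n}. ?b (G, v)) / real n))"
  proof (rule integral_mono_AE[OF int int])
    show "AE G in measure_pmf (P n). \<epsilon> * (ln (partition_fn \<psi> \<psi>b n G) / real n - (\<Sum>v\<in>{0..<n}. ?l (G, v)) / real n)
        \<le> K + Ctot * ((\<Sum>v\<in>{0..<n}. ?b (G, v)) / real n)"
    proof (rule AE_pmfI)
      fix G assume "G \<in> set_pmf (P n)"
      hence G: "simple_graph_on n G" using rg by (auto simp: random_graph_seq_def)
      have "(\<Sum>v\<in>{v\<in>{0..<n}. \<not> good_ball d bip G (col n G) R v}. real (degree G v) + 1) = (\<Sum>v\<in>{0..<n}. ?b (G, v))"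
        by (subst sum.inter_filter) (auto intro!: sum.cong)
      hence "\<epsilon> * (ln (partition_fn \<psi> \<psi>b n G) - (\<Sum>v\<in>{0..<n}. L (col n G v) 0)) / real n
          \<le> (real n * K + Ctot * (\<Sum>v\<in>{0..<n}. ?b (G, v))) / real n"
        using bd[OF G] n by (intro divide_right_mono) auto
      thus "\<epsilon> * (ln (partition_fn \<psi> \<psi>b n G) / real n - (\<Sum>v\<in>{0..<n}. ?l (G, v)) / real n)
        \<le> K + Ctot * ((\<Sum>v\<in>{0..<n}. ?b (G, v)) / real n)"
        using n by (simp add: diff_divide_distrib add_divide_distrib right_diff_distrib)
    qed
  qed
  also have "\<dots> = K + Ctot * measure_pmf.expectation (rooted P n) ?b"
    unfolding expectation_rooted[OF rg n] by (subst Bochner_Integration.integral_add[OF int int]) simp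
  finally show ?thesis .
qed

lemma graph_gauge_at: "simple_graph_on n G \<Longrightarrow>
    graph_gauge d T a g p q \<psi> \<psi>b w f fs bip M \<delta> \<kappa> Zm n G (col n G)"
  using uncol by unfold_locales auto

text \<open>If the extremal fixed pair is the origin of the gauge, the largest messages tend to
  \<open>0\<close> with the depth, and nothing is lost in the limit between \<open>t = 0\<close> and
  \<open>T\<close>.\<close>

lemma free_energy_lower:
  assumes zero: "\<And>c. Ulim T c = 0" and e: "e > 0"
  shows "eventually (\<lambda>n. free_energy_seq \<psi> \<psi>b P n \<ge> Lbar - e) sequentially"
proof -
  define Gm where "Gm = g True + g False"
  have Gm: "g c \<le> Gm" "Gm > 0" for c using g0[of True] g0[of False] by (cases c; auto simp: Gm_def)+
  \<comment> \<open>The first bound keeps \<open>1 + t * (x * z)\<close> above \<open>1 / 2\<close>,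
    the second makes the total loss at most \<open>e / 2\<close>; the \<open>+ 1\<close> covers
    \<open>T = 0\<close>.\<close>
  define \<eta> where "\<eta> = min (1 / (2 * T * Gm + 1)) (e / (2 * (T * Gm * real d + 1)))"
  have TG: "T * Gm \<ge> 0" using T0 Gm(2) by simp
  have TGd: "T * Gm * real d \<ge> 0" using TG by simp
  have \<eta>0: "\<eta> > 0" unfolding \<eta>_def min_less_iff_conj using TG TGd e by (intro conjI divide_pos_pos) (linarith | simp add: mult.assoc)+
  have small: "T * (Gm * \<eta>) \<le> 1 / 2"
  proof -
    have "\<eta> \<le> 1 / (2 * T * Gm + 1)" by (simp add: \<eta>_def)
    hence "\<eta> * (2 * T * Gm + 1) \<le> 1" using TG by (simp add: pos_le_divide_eq mult.assoc)
    thus ?thesis using \<eta>0 by (simp add: algebra_simps)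
  qed
  have small2: "T * (2 * (Gm * \<eta>)) * (real d / 2) \<le> e / 2"
  proof -
    have pd: "T * Gm * real d + 1 > 0" using TG by (simp add: add_nonneg_pos)
    have "\<eta> \<le> e / (2 * (T * Gm * real d + 1))" by (simp add: \<eta>_def)
    hence "\<eta> * (2 * (T * Gm * real d + 1)) \<le> e" using pd by (simp add: pos_le_divide_eq)
    thus ?thesis using \<eta>0 by (simp add: algebra_simps)
  qed
  have "eventually (\<lambda>k. U T k True < \<eta> \<and> U T k False < \<eta>) sequentially"
    using order_tendstoD(2)[OF U_tendsto[OF T0 order_refl, of True], of \<eta>]
      order_tendstoD(2)[OF U_tendsto[OF T0 order_refl, of False], of \<eta>] zero \<eta>0 by (intro eventually_conj) auto
  then obtain k0 where k0: "\<And>k. k \<ge> k0 \<Longrightarrow> U T k True < \<eta> \<and> U T k False < \<eta>" unfolding eventually_sequentially by blast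
  define r where "r = k0"
  have U\<eta>: "U T (Suc r) c \<le> \<eta>" for c using k0[of "Suc r"] by (cases c) (auto simp: r_def)
  let ?B = "\<lambda>n. measure_pmf.expectation (rooted P n) (\<lambda>(G, v). (real (degree G v) + 1) * (if good_ball d bip G (col n G) (r + 3) v then 0 else 1))"
  have bnd: "- 1 * (free_energy_seq \<psi> \<psi>b P n - measure_pmf.expectation (rooted P n) (\<lambda>(G, v). L (col n G v) 0))
     \<le> T * (2 * (Gm * \<eta>)) * (real d / 2) + Ctot * ?B n" if n: "n > 0" for n
  proof (rule free_energy_bound[OF n])
    fix G assume "simple_graph_on n G"
    then interpret gg: graph_gauge d T a g p q \<psi> \<psi>b w f fs bip M \<delta> \<kappa> Zm n G "col n G" by (rule graph_gauge_at)
    show "- 1 * (ln (partition_fn \<psi> \<psi>b n G) - (\<Sum>v\<in>{0..<n}. L (col n G v) 0))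
      \<le> real n * (T * (2 * (Gm * \<eta>)) * (real d / 2)) + Ctot * (\<Sum>v\<in>{v\<in>{0..<n}. \<not> good_ball d bip G (col n G) (r + 3) v}. real (degree G v) + 1)"
      using gg.ln_partition_fn_lower[OF U\<eta> Gm(1) small] unfolding gg.bad_def by (simp add: mult_ac)
  qed
  have "(\<lambda>n. Ctot * ?B n) \<longlonglongrightarrow> Ctot * 0"
    by (intro tendsto_mult_left expectation_bad_tendsto_0[OF rg sparse good])
  hence 1: "eventually (\<lambda>n. Ctot * ?B n < e / 4) sequentially" using e by (intro order_tendstoD(2)[of _ 0]) auto
  have 2: "eventually (\<lambda>n. measure_pmf.expectation (rooted P n) (\<lambda>(G, v). L (col n G v) 0) > Lbar - e / 4) sequentially"
    using e by (intro order_tendstoD(1)[OF Lbar]) auto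
  from 1 2 eventually_gt_at_top[of 0] show ?thesis
  proof eventually_elim
    case (elim n)
    have "- 1 * (F - E) \<le> X + C \<Longrightarrow> C < e / 4 \<Longrightarrow> Lbar - e / 4 < E \<Longrightarrow> X \<le> e / 2 \<Longrightarrow> Lbar - e \<le> F"
      for F E C X unfolding mult_minus1 by linarith
    from this[OF bnd[OF elim(3)] elim(1,2) small2] show ?case .
  qed
qed

lemma free_energy_upper:
  assumes sym: "\<And>c. a (\<not> c) = g c" and odd: "\<And>c y. 0 \<le> y \<Longrightarrow> adm (\<not> c) y \<Longrightarrow> - A (\<not> c) y \<le> A c (- y)"
    and st: "\<And>t. 0 \<le> t \<Longrightarrow> t \<le> T \<Longrightarrow> expanding t" and e: "e > 0"
  shows "eventually (\<lambda>n. free_energy_seq \<psi> \<psi>b P n \<le> Lbar + (Phi T (Ulim T True) (Ulim T False) - (L True 0 + L False 0) / 2) + e) sequentially"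
proof -
  obtain N R where N: "N > 0" and R: "real d / 2 * (\<Sum>i<N. T / real N * inc N R i)
     \<le> Phi T (Ulim T True) (Ulim T False) - Phi 0 (Ulim 0 True) (Ulim 0 False) + e / 2"
    using ex_partition[OF st, of "e / 2"] e by auto
  define K where "K = real d / 2 * (\<Sum>i<N. T / real N * inc N (Suc R) i)"
  \<comment> \<open>The partition was obtained for depth \<open>R\<close> while the graph estimate
    works at depth \<open>Suc R\<close>; messages from a deeper boundary are smaller.\<close>
  have inc_le: "inc N (Suc R) i \<le> inc N R i" if i: "i < N" for i
  proof -
    have t: "0 \<le> T * real (Suc i) / real N" "T * real (Suc i) / real N \<le> T"
      using T0 N i by (auto simp: pos_divide_le_eq mult_left_mono simp del: of_nat_Suc)
    have "U (T * real (Suc i) / real N) (Suc R) True * U (T * real (Suc i) / real N) (Suc R) False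
        \<le> U (T * real (Suc i) / real N) R True * U (T * real (Suc i) / real N) R False"
      using U_antimono[OF t] U_box[OF t] by (intro mult_mono) blast+
    moreover have "0 \<le> U (T * real (Suc i) / real N) (Suc R) True * U (T * real (Suc i) / real N) (Suc R) False"
      using U_box[OF t] by (intro mult_nonneg_nonneg) blast+
    ultimately show ?thesis unfolding inc_def Let_def using T0 by (intro mobius_mono) auto
  qed
  have KR: "K \<le> Phi T (Ulim T True) (Ulim T False) - (L True 0 + L False 0) / 2 + e / 2"
  proof -
    have "K \<le> real d / 2 * (\<Sum>i<N. T / real N * inc N R i)"
      unfolding K_def using inc_le T0 by (intro mult_left_mono sum_mono) auto
    thus ?thesis using R unfolding Phi_0 by linarith
  qed
  let ?B = "\<lambda>n. measure_pmf.expectation (rooted P n) (\<lambda>(G, v). (real (degree G v) + 1) * (if good_ball d bip G (col n G) (R + 3) v then 0 else 1))"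
  have bnd: "1 * (free_energy_seq \<psi> \<psi>b P n - measure_pmf.expectation (rooted P n) (\<lambda>(G, v). L (col n G v) 0))
     \<le> K + Ctot * ?B n" if n: "n > 0" for n
  proof (rule free_energy_bound[OF n])
    fix G assume "simple_graph_on n G"
    then interpret gg: graph_gauge d T a g p q \<psi> \<psi>b w f fs bip M \<delta> \<kappa> Zm n G "col n G" by (rule graph_gauge_at)
    show "1 * (ln (partition_fn \<psi> \<psi>b n G) - (\<Sum>v\<in>{0..<n}. L (col n G v) 0))
      \<le> real n * K + Ctot * (\<Sum>v\<in>{v\<in>{0..<n}. \<not> good_ball d bip G (col n G) (R + 3) v}. real (degree G v) + 1)"
      using gg.ln_partition_fn_upper[OF sym odd N, of R] unfolding gg.bad_def K_def by (simp add: mult_ac)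
  qed
  have "(\<lambda>n. Ctot * ?B n) \<longlonglongrightarrow> Ctot * 0"
    by (intro tendsto_mult_left expectation_bad_tendsto_0[OF rg sparse good])
  hence 1: "eventually (\<lambda>n. Ctot * ?B n < e / 4) sequentially" using e by (intro order_tendstoD(2)[of _ 0]) auto
  have 2: "eventually (\<lambda>n. measure_pmf.expectation (rooted P n) (\<lambda>(G, v). L (col n G v) 0) < Lbar + e / 4) sequentially"
    using e by (intro order_tendstoD(2)[OF Lbar]) auto
  from 1 2 eventually_gt_at_top[of 0] show ?thesis
  proof eventually_elim
    case (elim n)
    have "1 * (F - E) \<le> K + C \<Longrightarrow> C < e / 4 \<Longrightarrow> E < Lbar + e / 4 \<Longrightarrow> K \<le> X + e / 2 \<Longrightarrow> F \<le> Lbar + X + e"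
      for F E C X unfolding mult_1_left by linarith
    from this[OF bnd[OF elim(3)] elim(1,2) KR] show ?case .
  qed
qed

end
end

section \<open>Gauge coordinates of messages\<close>

context spin_gauge begin

definition W :: "bool \<Rightarrow> (bool \<Rightarrow> real) \<Rightarrow> real" where "W c h = (\<Sum>s\<in>UNIV. w c s * h s)"

text \<open>The mean of the spin coordinate under the weights \<open>w c s * h s\<close>. It is a
  fractional linear parametrisation of \<open>Delta\<close> that increases with
  \<open>h (f c)\<close>.\<close>

definition coord :: "bool \<Rightarrow> (bool \<Rightarrow> real) \<Rightarrow> real" where
  "coord c h = (\<Sum>s\<in>UNIV. w c s * \<zeta> c s * h s) / W c h"

text \<open>The message produced from incoming messages of coordinate \<open>z\<close>. After
  normalisation, \<open>BP\<close> depends on its argument only through this number.\<close>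

definition msg :: "bool \<Rightarrow> real \<Rightarrow> bool \<Rightarrow> real" where
  "msg c z s = \<psi>b s * (w c s * (1 + T * (\<zeta> c s * z))) ^ (d - 1) /
     (\<Sum>r\<in>UNIV. \<psi>b r * (w c r * (1 + T * (\<zeta> c r * z))) ^ (d - 1))"

lemma \<zeta>_simps: "\<zeta> c (f c) = a c" "\<zeta> c (\<not> f c) = - g c" by (auto simp: spin_coord_def)

lemma Delta_favoured: "h \<in> Delta \<Longrightarrow> h (\<not> f c) = 1 - h (f c) \<and> 0 \<le> h (f c) \<and> h (f c) \<le> 1"
proof -
  assume "h \<in> Delta"
  hence "h True \<ge> 0" "h False \<ge> 0" "h True + h False = 1" by (auto simp: Delta_def)
  thus ?thesis by (cases "f c") auto
qed

lemma W_pos: assumes "h \<in> Delta" shows "W c h > 0"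
proof -
  have h: "h True \<ge> 0" "h False \<ge> 0" "h True + h False = 1" using assms by (auto simp: Delta_def)
  hence "h True > 0 \<or> h False > 0" by linarith
  thus ?thesis using h w0[of c True] w0[of c False]
    by (auto simp: W_def UNIV_bool intro: add_pos_nonneg add_nonneg_pos)
qed

lemma coord_favoured: "coord c h = (a c * (w c (f c) * h (f c)) - g c * (w c (\<not> f c) * h (\<not> f c))) / (w c (f c) * h (f c) + w c (\<not> f c) * h (\<not> f c))"
  unfolding coord_def W_def sum_favoured[of _ c] \<zeta>_simps by (simp add: mult_ac)

lemma coord_mono:
  assumes "h \<in> Delta" "h' \<in> Delta" "h (f c) \<le> h' (f c)" shows "coord c h \<le> coord c h'"
proof -
  have h: "h (\<not> f c) = 1 - h (f c)" "0 \<le> h (f c)" "h (f c) \<le> 1" using Delta_favoured[OF assms(1), of c] by auto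
  have h': "h' (\<not> f c) = 1 - h' (f c)" "0 \<le> h' (f c)" "h' (f c) \<le> 1" using Delta_favoured[OF assms(2), of c] by auto
  show ?thesis unfolding coord_favoured
  proof (rule weighted_mean_mono)
    show "w c (f c) * h (f c) + w c (\<not> f c) * h (\<not> f c) > 0" "w c (f c) * h' (f c) + w c (\<not> f c) * h' (\<not> f c) > 0"
      using W_pos[of _ c] assms unfolding W_def sum_favoured[of _ c] by auto
  qed (use h h' assms w0[of c "f c"] w0[of c "\<not> f c"] a0[of c] g0[of c] in \<open>auto intro!: mult_left_mono\<close>)
qed

lemma coord_inj_le:
  assumes "h \<in> Delta" "h' \<in> Delta" "coord c h \<le> coord c h'" shows "h (f c) \<le> h' (f c)"
proof (rule ccontr)
  assume "\<not> ?thesis"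
  hence lt: "h' (f c) < h (f c)" by simp
  have h: "h (\<not> f c) = 1 - h (f c)" using Delta_favoured[OF assms(1), of c] by auto
  have h': "h' (\<not> f c) = 1 - h' (f c)" using Delta_favoured[OF assms(2), of c] by auto
  have W: "w c (f c) * h (f c) + w c (\<not> f c) * h (\<not> f c) > 0" "w c (f c) * h' (f c) + w c (\<not> f c) * h' (\<not> f c) > 0"
    using W_pos[of _ c] assms unfolding W_def sum_favoured[of _ c] by auto
  have "(a c * (w c (f c) * h (f c)) - g c * (w c (\<not> f c) * h (\<not> f c))) * (w c (f c) * h' (f c) + w c (\<not> f c) * h' (\<not> f c))
      \<le> (a c * (w c (f c) * h' (f c)) - g c * (w c (\<not> f c) * h' (\<not> f c))) * (w c (f c) * h (f c) + w c (\<not> f c) * h (\<not> f c))"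
    using assms(3) W unfolding coord_favoured by (simp add: divide_le_eq pos_le_divide_eq field_simps)
  hence "(a c + g c) * (w c (f c) * w c (\<not> f c)) * (h (f c) - h' (f c)) \<le> 0"
    unfolding h h' by (simp add: algebra_simps)
  moreover have "(a c + g c) * (w c (f c) * w c (\<not> f c)) * (h (f c) - h' (f c)) > 0"
    using lt a0[of c] g0[of c] w0[of c "f c"] w0[of c "\<not> f c"] by (intro mult_pos_pos) auto
  ultimately show False by simp
qed

lemma coord_box: assumes "h \<in> Delta" shows "- g c \<le> coord c h" "coord c h \<le> a c"
proof -
  have h: "h (f c) \<ge> 0" "h (\<not> f c) \<ge> 0" using assms by (auto simp: Delta_def)
  have W: "w c (f c) * h (f c) + w c (\<not> f c) * h (\<not> f c) > 0"
    using W_pos[OF assms, of c] unfolding W_def sum_favoured[of _ c] by simp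
  have n: "(a c + g c) * (w c (f c) * h (f c)) \<ge> 0" "(a c + g c) * (w c (\<not> f c) * h (\<not> f c)) \<ge> 0"
    using h w0[of c "f c"] w0[of c "\<not> f c"] a0[of c] g0[of c] by auto
  show "- g c \<le> coord c h" "coord c h \<le> a c"
    unfolding coord_favoured using W n by (simp_all add: le_divide_eq divide_le_eq algebra_simps)
qed

lemma compat_not: "colour_compat bip c c' \<Longrightarrow> a c' = a (\<not> c) \<and> g c' = g (\<not> c)"
  using uncoloured by (cases c; cases c') (auto simp: colour_compat_def split: if_splits)

lemma adm_coord: assumes "colour_compat bip c c'" "h \<in> Delta" shows "adm c (T * coord c' h)"
  using compat_not[OF assms(1)] coord_box[OF assms(2), of c'] T0 by (intro adm_box) auto

text \<open>In the gauge, \<open>\<psi>\<close> sees a measure only through its total weight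
  \<open>W\<close> and its coordinate.\<close>

lemma \<psi>_sum:
  assumes "colour_compat bip c c'" "h \<in> Delta"
  shows "(\<Sum>s'\<in>UNIV. \<psi> s s' * h s') = w c s * (1 + T * (\<zeta> c s * coord c' h)) * W c' h"
proof -
  have "(\<Sum>s'\<in>UNIV. \<psi> s s' * h s') = (\<Sum>s'\<in>UNIV. w c s * (w c' s' * h s' + T * (\<zeta> c s * (w c' s' * \<zeta> c' s' * h s'))))"
    unfolding \<psi>_eq[OF assms(1)] by (intro sum.cong refl) (simp add: algebra_simps)
  also have "\<dots> = w c s * (W c' h + T * (\<zeta> c s * (\<Sum>s'\<in>UNIV. w c' s' * \<zeta> c' s' * h s')))"
    unfolding W_def UNIV_bool by (simp add: algebra_simps)
  also have "(\<Sum>s'\<in>UNIV. w c' s' * \<zeta> c' s' * h s') = coord c' h * W c' h"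
    using W_pos[OF assms(2), of c'] by (simp add: coord_def)
  finally show ?thesis by (simp add: algebra_simps)
qed

lemma BP_msg:
  assumes "colour_compat bip c c'" "h \<in> Delta"
  shows "BP \<psi> \<psi>b d h = msg c (coord c' h)"
proof
  fix s
  have W: "W c' h > 0" by (rule W_pos[OF assms(2)])
  show "BP \<psi> \<psi>b d h s = msg c (coord c' h) s"
    unfolding BP_def \<psi>_sum[OF assms] msg_def power_mult_distrib[of _ "W c' h"]
    using W by (simp add: sum_distrib_right[symmetric] mult.assoc[symmetric])
qed

lemma msg_props:
  assumes ad: "adm c (T * z)"
  shows "msg c z \<in> Delta" "coord c (msg c z) = A c (T * z)"
proof -
  define k where "k = (\<Sum>r\<in>UNIV. \<psi>b r * (w c r * (1 + T * (\<zeta> c r * z))) ^ (d - 1))"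
  have n: "0 \<le> 1 + T * (\<zeta> c s * z)" for s
    using ad unfolding adm_def spin_coord_def by (auto simp: mult_ac)
  have tm: "0 \<le> \<psi>b s * (w c s * (1 + T * (\<zeta> c s * z))) ^ (d - 1)" for s
    using n \<psi>b0[of s] w0[of c s] by (simp add: less_imp_le)
  \<comment> \<open>One more factor \<open>w\<close> turns the exponent \<open>d - 1\<close> of a
    message into the exponent \<open>d\<close> that occurs in \<open>p\<close> and
    \<open>q\<close>.\<close>
  have e: "w c s * (\<psi>b s * (w c s * (1 + T * (\<zeta> c s * z))) ^ (d - 1)) = \<omega> c s * (1 + T * (\<zeta> c s * z)) ^ (d - 1)" for s
  proof -
    have "w c s ^ d = w c s * w c s ^ (d - 1)" using d3 by (metis Suc_diff_1 power_Suc less_le_trans zero_less_numeral)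
    thus ?thesis by (simp add: \<omega>_def power_mult_distrib)
  qed
  have o: "\<omega> c (f c) = p c" "\<omega> c (\<not> f c) = q c" by (simp_all add: \<omega>_def p_eq q_eq)
  have dn: "(\<Sum>s\<in>UNIV. w c s * (\<psi>b s * (w c s * (1 + T * (\<zeta> c s * z))) ^ (d - 1))) = den c (T * z)"
    unfolding e sum_favoured[of _ c] \<zeta>_simps o den_def by (simp add: mult_ac)
  have k0: "k > 0"
  proof (rule ccontr)
    assume "\<not> k > 0"
    hence "k = 0" using tm unfolding k_def by (meson antisym_conv1 sum_nonneg not_less)
    hence "\<psi>b s * (w c s * (1 + T * (\<zeta> c s * z))) ^ (d - 1) = 0" for s
      using tm unfolding k_def by (subst (asm) sum_nonneg_eq_0_iff) auto
    hence "den c (T * z) = 0" unfolding dn[symmetric] by (simp only: mult_zero_right sum.neutral_const)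
    thus False using den_pos[OF ad] by simp
  qed
  have m: "msg c z s = \<psi>b s * (w c s * (1 + T * (\<zeta> c s * z))) ^ (d - 1) / k" for s unfolding msg_def k_def ..
  have "msg c z True + msg c z False = (\<Sum>s\<in>UNIV. \<psi>b s * (w c s * (1 + T * (\<zeta> c s * z))) ^ (d - 1)) / k"
    unfolding m UNIV_bool by (simp add: add_divide_distrib)
  also have "\<dots> = 1" using k0 unfolding k_def[symmetric] by simp
  finally show "msg c z \<in> Delta" using tm k0 unfolding Delta_def m by (auto intro: divide_nonneg_pos)
  have "W c (msg c z) = den c (T * z) / k" unfolding W_def m dn[symmetric] by (simp add: sum_divide_distrib)
  moreover have "(\<Sum>s\<in>UNIV. w c s * \<zeta> c s * msg c z s)
      = (a c * (p c * (1 + a c * (T * z)) ^ (d - 1)) - g c * (q c * (1 - g c * (T * z)) ^ (d - 1))) / k"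
  proof -
    have e2: "w c s * \<zeta> c s * msg c z s = \<zeta> c s * (\<omega> c s * (1 + T * (\<zeta> c s * z)) ^ (d - 1)) / k" for s
      unfolding m e[symmetric] by simp
    show ?thesis unfolding e2 sum_favoured[of _ c] \<zeta>_simps o by (simp add: diff_divide_distrib mult_ac)
  qed
  ultimately show "coord c (msg c z) = A c (T * z)" using k0 unfolding coord_def A_def by simp
qed

lemma ln_vertex_sum:
  assumes cc: "colour_compat bip c c'" and h: "h \<in> Delta"
  shows "ln (\<Sum>s\<in>UNIV. \<psi>b s * (\<Sum>s'\<in>UNIV. \<psi> s s' * h s') ^ d) = L c (T * coord c' h) + real d * ln (W c' h)"
proof -
  have W: "W c' h > 0" by (rule W_pos[OF h])
  have "(\<Sum>s\<in>UNIV. \<psi>b s * (\<Sum>s'\<in>UNIV. \<psi> s s' * h s') ^ d)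
     = (p c * (1 + a c * (T * coord c' h)) ^ d + q c * (1 - g c * (T * coord c' h)) ^ d) * W c' h ^ d"
    unfolding \<psi>_sum[OF assms] sum_favoured[of _ c] \<zeta>_simps p_eq q_eq power_mult_distrib by (simp add: algebra_simps)
  thus ?thesis using powsum_pos[OF adm_coord[OF assms], of d] W by (simp add: L_def ln_mult_pos ln_realpow)
qed

lemma edge_sum:
  assumes cc: "colour_compat bip c c'" and h: "h \<in> Delta" "h' \<in> Delta"
  shows "(\<Sum>s\<in>UNIV. \<Sum>s'\<in>UNIV. h s * \<psi> s s' * h' s') = W c h * W c' h' * (1 + T * (coord c h * coord c' h'))"
proof -
  have "(\<Sum>s\<in>UNIV. \<Sum>s'\<in>UNIV. h s * \<psi> s s' * h' s') = (\<Sum>s\<in>UNIV. h s * (\<Sum>s'\<in>UNIV. \<psi> s s' * h' s'))"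
    by (simp add: sum_distrib_left mult.assoc)
  also have "\<dots> = (\<Sum>s\<in>UNIV. w c s * h s) * W c' h' + T * coord c' h' * W c' h' * (\<Sum>s\<in>UNIV. w c s * \<zeta> c s * h s)"
    unfolding \<psi>_sum[OF cc h(2)] unfolding UNIV_bool by (simp add: algebra_simps)
  also have "(\<Sum>s\<in>UNIV. w c s * \<zeta> c s * h s) = coord c h * W c h"
    using W_pos[OF h(1), of c] by (simp add: coord_def)
  finally show ?thesis unfolding W_def[of c h, symmetric] by (simp add: algebra_simps)
qed

text \<open>The weights \<open>W\<close> cancel: the two vertex terms carry \<open>d / 2\<close>
  times their logarithms, and so does the edge term.\<close>

lemma Bethe_functional:
  assumes cc: "colour_compat bip c c'" and h: "h \<in> Delta" "h' \<in> Delta" and pos: "1 + T * (coord c h * coord c' h') > 0"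
  shows "Phi2 \<psi> \<psi>b d h h' = L c (T * coord c' h') / 2 + L c' (T * coord c h) / 2
     - real d / 2 * ln (1 + T * (coord c h * coord c' h'))"
proof -
  have W: "W c h > 0" "W c' h' > 0" using h W_pos by auto
  have e: "ln (W c h * W c' h' * (1 + T * (coord c h * coord c' h'))) = ln (W c h) + ln (W c' h') + ln (1 + T * (coord c h * coord c' h'))"
    using W pos by (simp add: ln_mult_pos)
  have "(x + D * u) / 2 + (y + D * v) / 2 - D / 2 * (v + u + z) = x / 2 + y / 2 - D / 2 * z" for x y z u v D :: real
    by (simp add: field_simps)
  thus ?thesis unfolding Phi2_def ln_vertex_sum[OF cc h(2)] ln_vertex_sum[OF colour_compat_sym[OF cc] h(1)] edge_sum[OF cc h] e .
qed

end

section \<open>Fixed pairs are positive and define a gauge\<close>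

lemma Phi1_eq_Phi2: "Phi1 \<psi> \<psi>b d h = Phi2 \<psi> \<psi>b d h h"
  by (simp add: Phi1_def Phi2_def)

lemma Phi2_commute: "(\<And>s s'. \<psi> s s' = \<psi> s' s) \<Longrightarrow> Phi2 \<psi> \<psi>b d h h' = Phi2 \<psi> \<psi>b d h' h"
  unfolding Phi2_def UNIV_bool by (simp add: mult_ac add_ac)

lemma free_spin:
  assumes "two_spin_spec \<psi> \<psi>b" "non_degenerate \<psi>"
  obtains fs where "\<And>s. \<psi> fs s > 0"
proof -
  have pm: "\<psi> True False > 0" "\<psi> False True > 0" using assms by (auto simp: two_spin_spec_def non_degenerate_def)
  show ?thesis
  proof (cases "\<psi> True True > 0")
    case True
    have "\<psi> True s > 0" for s using True pm by (cases s) auto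
    thus ?thesis by (rule that)
  next
    case False
    hence "\<psi> False False > 0" using assms by (auto simp: non_degenerate_def max_def split: if_splits)
    hence "\<psi> False s > 0" for s using pm by (cases s) auto
    thus ?thesis by (rule that)
  qed
qed

text \<open>The free spin receives positive mass from any measure. Every spin is compatible with the
  free spin, so all spins then receive positive mass.\<close>

lemma fixed_pair_pos:
  assumes spec: "two_spin_spec \<psi> \<psi>b" and fs: "\<And>s. \<psi> fs s > 0"
    and h: "\<And>c. h c \<in> Delta" "\<And>c. h c = BP \<psi> \<psi>b d (h (\<not> c))"
  shows "(\<Sum>s'\<in>UNIV. \<psi> s s' * h c s') > 0" "h c s > 0"
    "(\<Sum>r\<in>UNIV. \<psi>b r * (\<Sum>s'\<in>UNIV. \<psi> r s' * h c s') ^ k) > 0"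
proof -
  have \<psi>0: "\<psi> s s' \<ge> 0" "\<psi> s s' = \<psi> s' s" "\<psi>b s > 0" for s s' using spec by (auto simp: two_spin_spec_def)
  have hn: "h c s \<ge> 0" for c s using h(1)[of c] by (auto simp: Delta_def)
  have ap0: "(\<Sum>s'\<in>UNIV. \<psi> s s' * h c s') \<ge> 0" for s c using \<psi>0 hn by (intro sum_nonneg) auto
  have apf: "(\<Sum>s'\<in>UNIV. \<psi> fs s' * h c s') > 0" for c
  proof -
    have "h c True + h c False = 1" using h(1)[of c] by (auto simp: Delta_def)
    hence "h c True > 0 \<or> h c False > 0" using hn[of c True] hn[of c False] by linarith
    thus ?thesis using fs hn[of c True] hn[of c False] unfolding UNIV_bool
      by (auto intro: add_pos_nonneg add_nonneg_pos simp: less_imp_le)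
  qed
  have den: "(\<Sum>r\<in>UNIV. \<psi>b r * (\<Sum>s'\<in>UNIV. \<psi> r s' * h c s') ^ k) > 0" for c k
  proof (rule sum_pos2[where i = fs])
    show "0 < \<psi>b fs * (\<Sum>s'\<in>UNIV. \<psi> fs s' * h c s') ^ k" using apf[of c] \<psi>0(3)[of fs] by simp
    show "0 \<le> \<psi>b i * (\<Sum>s'\<in>UNIV. \<psi> i s' * h c s') ^ k" for i using ap0[of i c] \<psi>0(3)[of i] by (simp add: less_imp_le)
  qed auto
  have hpos: "h c s > 0" if "(\<Sum>s'\<in>UNIV. \<psi> s s' * h (\<not> c) s') > 0" for c s
  proof -
    have "h c s = \<psi>b s * (\<Sum>s'\<in>UNIV. \<psi> s s' * h (\<not> c) s') ^ (d - 1) / (\<Sum>r\<in>UNIV. \<psi>b r * (\<Sum>s'\<in>UNIV. \<psi> r s' * h (\<not> c) s') ^ (d - 1))"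
      using fun_cong[OF h(2)[of c], of s] by (simp only: BP_def)
    also have "\<dots> > 0" using that den[of "\<not> c" "d - 1"] \<psi>0(3)[of s] by (intro divide_pos_pos mult_pos_pos zero_less_power)
    finally show ?thesis .
  qed
  have hf: "h c fs > 0" for c by (rule hpos[OF apf])
  show ap: "(\<Sum>s'\<in>UNIV. \<psi> s s' * h c s') > 0" for s c
  proof (rule sum_pos2[where i = fs])
    show "0 < \<psi> s fs * h c fs" using fs[of s] \<psi>0(2)[of s fs] hf[of c] by simp
    show "0 \<le> \<psi> s i * h c i" for i using \<psi>0(1) hn by simp
  qed auto
  show "h c s > 0" by (rule hpos[OF ap])
  show "(\<Sum>r\<in>UNIV. \<psi>b r * (\<Sum>s'\<in>UNIV. \<psi> r s' * h c s') ^ k) > 0" by (rule den)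
qed

text \<open>In the gauge at a fixed pair \<open>h\<close> the matrix \<open>\<psi>\<close> is a rank-one matrix plus a multiple of the product
  of the vectors orthogonal to \<open>h True\<close> and \<open>h False\<close>; the fixed pair gets the coordinates \<open>(0, 0)\<close>.\<close>

lemma fixed_pair_gauge:
  fixes h :: "bool \<Rightarrow> bool \<Rightarrow> real"
  assumes spec: "two_spin_spec \<psi> \<psi>b" and nondeg: "non_degenerate \<psi>" and d3: "d \<ge> 3" and fs: "\<And>s. \<psi> fs s > 0"
    and h: "\<And>c. h c \<in> Delta" "\<And>c. h c = BP \<psi> \<psi>b d (h (\<not> c))"
    and sgn: "(\<psi> True True * \<psi> False False \<ge> (\<psi> True False)\<^sup>2 \<and> f True = f False) \<or>
       (\<psi> True True * \<psi> False False < (\<psi> True False)\<^sup>2 \<and> f True \<noteq> f False)"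
    and mono: "\<not> bip \<Longrightarrow> h True = h False \<and> f True = f False"
  obtains T a g p q w where "spin_gauge d T a g p q \<psi> \<psi>b w f fs bip"
    "\<And>c. a c * (w c (f c) * h c (f c)) = g c * (w c (\<not> f c) * h c (\<not> f c))"
    "\<And>c. g c * q c = a c * p c"
    "h True = h False \<Longrightarrow> f True \<noteq> f False \<Longrightarrow> a False = g True \<and> g False = a True \<and> p False = q True \<and> q False = p True \<and> w False = w True"
proof -
  have \<psi>0: "\<psi> s s' \<ge> 0" "\<psi> s s' = \<psi> s' s" "\<psi>b s > 0" for s s' using spec by (auto simp: two_spin_spec_def)
  note pos = fixed_pair_pos[where h = h and fs = fs and d = d, OF spec fs h]
  define ap where "ap c s = (\<Sum>s'\<in>UNIV. \<psi> s s' * h c s')" for c s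
  have ap0: "ap c s > 0" for c s using pos(1) by (simp add: ap_def)
  have apx: "ap c s = \<psi> s True * h c True + \<psi> s False * h c False" for c s by (simp add: ap_def UNIV_bool add.commute)
  have \<psi>FT: "\<psi> False True = \<psi> True False" by (rule \<psi>0(2))
  \<comment> \<open>The edge sum of the pair, \<open>h True\<close> against \<open>h False\<close>.
    Dividing by its square root in \<open>w\<close> shares it between the two colours.\<close>
  define N where "N = h True True * ap False True + h True False * ap False False"
  have N0: "N > 0" using pos(2) ap0 by (simp add: N_def add_pos_pos)
  define det where "det = \<psi> True True * \<psi> False False - (\<psi> True False)\<^sup>2"
  define T where "T = \<bar>det\<bar> / N"
  define w where "w c s = ap (\<not> c) s / sqrt N" for c s
  define a where "a c = h c (\<not> f c) / w c (f c)" for c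
  define g where "g c = h c (f c) / w c (\<not> f c)" for c
  define p where "p c = \<psi>b (f c) * w c (f c) ^ d" for c
  define q where "q c = \<psi>b (\<not> f c) * w c (\<not> f c) ^ d" for c
  have w0: "w c s > 0" for c s using ap0 N0 by (simp add: w_def)
  have ag0: "a c > 0" "g c > 0" for c using pos(2) w0 by (auto simp: a_def g_def)
  have pq0: "p c > 0" "q c > 0" for c using \<psi>0(3) w0 by (auto simp: p_def q_def)
  define \<rho> where "\<rho> c s = (if s = f c then h c (\<not> s) else - h c (\<not> s))" for c s
  have w\<zeta>: "w c s * spin_coord f a g c s = \<rho> c s" for c s
    using w0[of c "f c"] w0[of c "\<not> f c"] by (cases "s = f c") (auto simp: spin_coord_def \<rho>_def a_def g_def)
  define \<rho>0 where "\<rho>0 c s = (if s then h c False else - h c True)" for c s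
  \<comment> \<open>The sign of the determinant is absorbed by the favoured spins: equal ones for a
    nonnegative determinant, opposite ones for a negative one. This is how \<open>T\<close> becomes
    nonnegative in both cases.\<close>
  have \<rho>\<rho>: "\<bar>det\<bar> * (\<rho> True s * \<rho> False s') = det * (\<rho>0 True s * \<rho>0 False s')" for s s'
  proof -
    have "(det \<ge> 0 \<and> f True = f False) \<or> (det < 0 \<and> f True \<noteq> f False)" using sgn by (simp add: det_def)
    thus ?thesis unfolding \<rho>_def \<rho>0_def
      by (cases "f True"; cases "f False"; cases s; cases s') auto
  qed
  \<comment> \<open>After subtraction of the rank-one part, the matrix annihilates
    \<open>h True\<close> from the left and \<open>h False\<close> from the right, so it is a
    multiple of the product of the orthogonal vectors; the multiple is the determinant.\<close>
  have key: "N * \<psi> s s' = ap False s * ap True s' + det * (\<rho>0 True s * \<rho>0 False s')" for s s'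
    unfolding N_def apx det_def \<rho>0_def \<psi>FT by (cases s; cases s') (simp_all add: \<psi>FT algebra_simps power2_eq_square)
  have main: "\<psi> s s' = w True s * w False s' * (1 + T * (spin_coord f a g True s * spin_coord f a g False s'))" for s s'
  proof -
    have "w True s * w False s' * (1 + T * (spin_coord f a g True s * spin_coord f a g False s'))
       = w True s * w False s' + T * ((w True s * spin_coord f a g True s) * (w False s' * spin_coord f a g False s'))"
      by (simp add: algebra_simps)
    also have "\<dots> = ap False s * ap True s' / N + (\<bar>det\<bar> * (\<rho> True s * \<rho> False s')) / N"
      unfolding w\<zeta> T_def using N0 by (simp add: w_def)
    also have "\<dots> = (N * \<psi> s s') / N" unfolding \<rho>\<rho> key by (simp add: add_divide_distrib)
    finally show ?thesis using N0 by simp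
  qed
  have main': "\<psi> s s' = w c s * w (\<not> c) s' * (1 + T * (spin_coord f a g c s * spin_coord f a g (\<not> c) s'))" for c s s'
    using main[of s s'] main[of s' s] \<psi>0(2)[of s s'] by (cases c) (simp_all add: mult_ac)
  have colind: "w False = w True \<and> a False = a True \<and> g False = g True \<and> p False = p True \<and> q False = q True" if "\<not> bip"
  proof -
    have w: "w False = w True" using mono[OF that] by (auto simp: w_def ap_def fun_eq_iff)
    thus ?thesis using mono[OF that] by (simp add: a_def g_def p_def q_def)
  qed
  \<comment> \<open>The fixed point equation makes \<open>\<psi>b s * w c s ^ (d - 1)\<close>
    proportional to \<open>h c s\<close>. The resulting balance is \<open>A c 0 = 0\<close>.\<close>
  have gqap: "g c * q c = a c * p c" for c
  proof -
    define K where "K = (\<Sum>r\<in>UNIV. \<psi>b r * ap (\<not> c) r ^ (d - 1)) / sqrt N ^ (d - 1)"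
    have D0: "(\<Sum>r\<in>UNIV. \<psi>b r * ap (\<not> c) r ^ (d - 1)) > 0" unfolding ap_def by (rule pos(3))
    have K: "\<psi>b s * w c s ^ (d - 1) = h c s * K" for s
    proof -
      have "h c s = \<psi>b s * ap (\<not> c) s ^ (d - 1) / (\<Sum>r\<in>UNIV. \<psi>b r * ap (\<not> c) r ^ (d - 1))"
        unfolding ap_def using fun_cong[OF h(2)[of c], of s] by (simp only: BP_def)
      thus ?thesis using D0 by (simp add: K_def w_def power_divide)
    qed
    have wd: "w c s ^ d = w c s * w c s ^ (d - 1)" for s using d3 by (metis Suc_diff_1 power_Suc less_le_trans zero_less_numeral)
    have "a c * p c = h c (\<not> f c) * (\<psi>b (f c) * w c (f c) ^ (d - 1))"
      unfolding a_def p_def wd using w0[of c "f c"] by simp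
    moreover have "g c * q c = h c (f c) * (\<psi>b (\<not> f c) * w c (\<not> f c) ^ (d - 1))"
      unfolding g_def q_def wd using w0[of c "\<not> f c"] by simp
    ultimately show ?thesis unfolding K by simp
  qed
  have one: "T * a c * g (\<not> c) \<le> 1" "\<psi> (f c) (\<not> f (\<not> c)) > 0 \<Longrightarrow> T * a c * g (\<not> c) < 1" for c
  proof -
    define X where "X = w c (f c) * w (\<not> c) (\<not> f (\<not> c))"
    have X0: "X > 0" using w0 by (simp add: X_def)
    have e: "\<psi> (f c) (\<not> f (\<not> c)) = X * (1 - T * a c * g (\<not> c))"
      using main'[of "f c" "\<not> f (\<not> c)" c] by (simp add: spin_coord_def X_def mult.assoc)
    have "X * (1 - T * a c * g (\<not> c)) \<ge> 0" using e \<psi>0(1) by metis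
    thus "T * a c * g (\<not> c) \<le> 1" using X0 by (simp add: zero_le_mult_iff)
    assume "\<psi> (f c) (\<not> f (\<not> c)) > 0"
    thus "T * a c * g (\<not> c) < 1" using X0 unfolding e by (simp add: zero_less_mult_iff)
  qed
  have "\<psi> (f True) (\<not> f False) > 0 \<or> \<psi> (f False) (\<not> f True) > 0"
    using nondeg \<psi>FT sgn unfolding non_degenerate_def by (cases "f True"; cases "f False") auto
  hence strict: "T * a True * g False < 1 \<or> T * a False * g True < 1" using one(2)[of True] one(2)[of False] by auto
  have gauge: "spin_gauge d T a g p q \<psi> \<psi>b w f fs bip"
  proof
    show "d \<ge> 3" by (rule d3)
    show "T \<ge> 0" using N0 by (simp add: T_def)
    show "g c * q c \<le> a c * p c" for c using gqap[of c] by simp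
    show "\<psi> s s' = w c s * w c' s' * (1 + T * (spin_coord f a g c s * spin_coord f a g c' s'))" if "colour_compat bip c c'" for c c' s s'
    proof (cases bip)
      case True thus ?thesis using that main'[of s s' c] by (simp add: colour_compat_def)
    next
      case False
      hence c: "c" "c'" using that by (auto simp: colour_compat_def)
      have "spin_coord f a g False s' = spin_coord f a g True s'"
        using colind[OF False] mono[OF False] by (simp add: spin_coord_def)
      thus ?thesis using main[of s s'] colind[OF False] c by simp
    qed
    show "a False = a True \<and> g False = g True \<and> p False = p True \<and> q False = q True" if "\<not> bip" using colind[OF that] by simp
  qed (use ag0 pq0 w0 \<psi>0 one strict fs in \<open>auto simp: p_def q_def\<close>)
  show ?thesis
  proof (rule that[OF gauge])
    show "a c * (w c (f c) * h c (f c)) = g c * (w c (\<not> f c) * h c (\<not> f c))" for c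
      using w0[of c "f c"] w0[of c "\<not> f c"] by (simp add: a_def g_def)
    show "g c * q c = a c * p c" for c by (rule gqap)
    assume hh: "h True = h False" and ff: "f True \<noteq> f False"
    have w: "w False = w True" using hh by (auto simp: w_def ap_def fun_eq_iff)
    have f: "f False = (\<not> f True)" using ff by auto
    show "a False = g True \<and> g False = a True \<and> p False = q True \<and> q False = p True \<and> w False = w True"
      using w hh f by (simp add: a_def g_def p_def q_def)
  qed
qed

section \<open>Local limits\<close>

lemma spin_gauge_bounded:
  assumes "spin_gauge d T a g p q \<psi> \<psi>b w f fs bip"
  obtains M \<delta> \<kappa> Zm where "bounded_spin_gauge d T a g p q \<psi> \<psi>b w f fs bip M \<delta> \<kappa> Zm"
proof -
  interpret spin_gauge d T a g p q \<psi> \<psi>b w f fs bip by (rule assms)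
  show ?thesis
  proof (rule ex_uniform_bounds)
    fix M \<delta> \<kappa> Zm :: real
    assume *: "M \<ge> 1" "0 < \<delta>" "\<delta> \<le> 1" "\<kappa> \<ge> 1" "Zm \<ge> 0"
      "\<And>c s c' s'. \<bar>\<zeta> c s * \<zeta> c' s'\<bar> \<le> Zm"
      "\<And>s s'. \<psi> s s' \<le> M" "\<And>s. \<delta> \<le> \<psi> fs s" "\<And>s. \<psi>b s \<le> \<kappa> * \<psi>b fs"
      "\<And>t c c' s s'. colour_compat bip c c' \<Longrightarrow> 0 \<le> t \<Longrightarrow> t \<le> T \<Longrightarrow> 1 + t * (\<zeta> c s * \<zeta> c' s') \<le> M"
      "\<And>t c c' s. colour_compat bip c c' \<Longrightarrow> 0 \<le> t \<Longrightarrow> t \<le> T \<Longrightarrow> \<delta> \<le> 1 + t * (\<zeta> c fs * \<zeta> c' s)"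
      "\<And>c s k. k \<le> d \<Longrightarrow> \<psi>b s * w c s ^ k \<le> \<kappa> * (\<psi>b fs * w c fs ^ k)"
    show ?thesis by (rule that[of M \<delta> \<kappa> Zm], unfold_locales) (fact *)+
  qed
qed

lemma good_ball_uncoloured_tendsto:
  assumes "converges_locally P d"
  shows "(\<lambda>n. measure_pmf.prob (rooted P n) {(G, v). good_ball d False G (\<lambda>_. True) R v}) \<longlonglongrightarrow> 1"
  using assms unfolding converges_locally_def good_ball_def ball_is_tree_def by simp

lemma root_in_ball: "v \<in> ball G t v"
  using dist_le_mono[of G 0 v v t] by (simp add: ball_def)

lemma Tplus_root: "ball_is_Tplus d t G c v \<Longrightarrow> c v"
  using root_in_ball by (fastforce simp: ball_is_Tplus_def ball_iso_def)

lemma Tminus_root: "ball_is_Tminus d t G c v \<Longrightarrow> \<not> c v"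
  using root_in_ball by (fastforce simp: ball_is_Tminus_def ball_iso_def)

lemma good_ball_Tplus: "ball_is_Tplus d t G c v \<Longrightarrow> good_ball d True G c t v"
  using Tplus_root[of d t G c v] unfolding ball_is_Tplus_def good_ball_def by auto

lemma good_ball_Tminus: "ball_is_Tminus d t G c v \<Longrightarrow> good_ball d True G c t v"
  using Tminus_root[of d t G c v] unfolding ball_is_Tminus_def good_ball_def by auto

text \<open>The root has different colours in the two events, so they are disjoint and their
  probabilities add up.\<close>

lemma good_ball_coloured_tendsto:
  assumes "(\<lambda>n. measure_pmf.prob (rooted P n) {(G, v). ball_is_Tplus d R G (\<tau> n G) v}) \<longlonglongrightarrow> 1/2"
    "(\<lambda>n. measure_pmf.prob (rooted P n) {(G, v). ball_is_Tminus d R G (\<tau> n G) v}) \<longlonglongrightarrow> 1/2"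
  shows "(\<lambda>n. measure_pmf.prob (rooted P n) {(G, v). good_ball d True G (\<tau> n G) R v}) \<longlonglongrightarrow> 1"
proof (rule tendsto_sandwich[OF always_eventually always_eventually _ tendsto_const])
  show "\<forall>n. measure_pmf.prob (rooted P n) {(G, v). ball_is_Tplus d R G (\<tau> n G) v}
      + measure_pmf.prob (rooted P n) {(G, v). ball_is_Tminus d R G (\<tau> n G) v}
      \<le> measure_pmf.prob (rooted P n) {(G, v). good_ball d True G (\<tau> n G) R v}"
  proof
    fix n
    have "measure_pmf.prob (rooted P n) {(G, v). ball_is_Tplus d R G (\<tau> n G) v}
      + measure_pmf.prob (rooted P n) {(G, v). ball_is_Tminus d R G (\<tau> n G) v}
      = measure_pmf.prob (rooted P n) ({(G, v). ball_is_Tplus d R G (\<tau> n G) v} \<union> {(G, v). ball_is_Tminus d R G (\<tau> n G) v})"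
      by (rule measure_pmf.finite_measure_Union[symmetric]) (auto dest: Tplus_root Tminus_root)
    also have "\<dots> \<le> measure_pmf.prob (rooted P n) {(G, v). good_ball d True G (\<tau> n G) R v}"
      by (intro measure_pmf.finite_measure_mono) (auto dest: good_ball_Tplus good_ball_Tminus)
    finally show "measure_pmf.prob (rooted P n) {(G, v). ball_is_Tplus d R G (\<tau> n G) v}
      + measure_pmf.prob (rooted P n) {(G, v). ball_is_Tminus d R G (\<tau> n G) v}
      \<le> measure_pmf.prob (rooted P n) {(G, v). good_ball d True G (\<tau> n G) R v}" .
  qed
  show "\<forall>n. measure_pmf.prob (rooted P n) {(G, v). good_ball d True G (\<tau> n G) R v} \<le> 1" by simp
  show "(\<lambda>n. measure_pmf.prob (rooted P n) {(G, v). ball_is_Tplus d R G (\<tau> n G) v}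
      + measure_pmf.prob (rooted P n) {(G, v). ball_is_Tminus d R G (\<tau> n G) v}) \<longlonglongrightarrow> 1"
    using tendsto_add[OF assms] by simp
qed

text \<open>Radius \<open>0\<close> suffices: the two events bound the frequency of the colour
  \<open>True\<close> from below and from above.\<close>

lemma colour_average_tendsto:
  fixes x :: "bool \<Rightarrow> real"
  assumes rg: "random_graph_seq P"
    and "(\<lambda>n. measure_pmf.prob (rooted P n) {(G, v). ball_is_Tplus d 0 G (\<tau> n G) v}) \<longlonglongrightarrow> 1/2"
    "(\<lambda>n. measure_pmf.prob (rooted P n) {(G, v). ball_is_Tminus d 0 G (\<tau> n G) v}) \<longlonglongrightarrow> 1/2"
  shows "(\<lambda>n. measure_pmf.expectation (rooted P n) (\<lambda>(G, v). x (\<tau> n G v))) \<longlonglongrightarrow> (x True + x False) / 2"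
proof -
  let ?p = "\<lambda>n. measure_pmf.prob (rooted P n) {(G, v). \<tau> n G v}"
  have p: "?p \<longlonglongrightarrow> 1/2"
  proof (rule tendsto_sandwich[OF always_eventually always_eventually assms(2)])
    show "\<forall>n. measure_pmf.prob (rooted P n) {(G, v). ball_is_Tplus d 0 G (\<tau> n G) v} \<le> ?p n"
      by (intro allI measure_pmf.finite_measure_mono) (auto dest: Tplus_root)
    show "\<forall>n. ?p n \<le> 1 - measure_pmf.prob (rooted P n) {(G, v). ball_is_Tminus d 0 G (\<tau> n G) v}"
    proof
      fix n
      have "?p n \<le> measure_pmf.prob (rooted P n) (UNIV - {(G, v). ball_is_Tminus d 0 G (\<tau> n G) v})"
        by (intro measure_pmf.finite_measure_mono) (auto dest: Tminus_root)
      also have "\<dots> = 1 - measure_pmf.prob (rooted P n) {(G, v). ball_is_Tminus d 0 G (\<tau> n G) v}"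
        using measure_pmf.prob_compl[of "{(G, v). ball_is_Tminus d 0 G (\<tau> n G) v}" "rooted P n"] by simp
      finally show "?p n \<le> 1 - measure_pmf.prob (rooted P n) {(G, v). ball_is_Tminus d 0 G (\<tau> n G) v}" .
    qed
    show "(\<lambda>n. 1 - measure_pmf.prob (rooted P n) {(G, v). ball_is_Tminus d 0 G (\<tau> n G) v}) \<longlonglongrightarrow> 1/2"
      using tendsto_diff[OF tendsto_const[of "1::real"] assms(3)] by simp
  qed
  have "(\<lambda>n. x False + (x True - x False) * ?p n) \<longlonglongrightarrow> x False + (x True - x False) * (1/2)"
    by (intro tendsto_intros p)
  also have "x False + (x True - x False) * (1/2) = (x True + x False) / 2" by (simp add: field_simps)
  finally have "(\<lambda>n. x False + (x True - x False) * ?p n) \<longlonglongrightarrow> (x True + x False) / 2" .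
  moreover have "eventually (\<lambda>n. x False + (x True - x False) * ?p n = measure_pmf.expectation (rooted P n) (\<lambda>(G, v). x (\<tau> n G v))) sequentially"
    using eventually_gt_at_top[of 0]
  proof eventually_elim
    case (elim n)
    note int = integrable_measure_pmf_finite[OF finite_set_rooted[OF rg elim]]
    have "measure_pmf.expectation (rooted P n) (\<lambda>(G, v). x (\<tau> n G v))
       = measure_pmf.expectation (rooted P n) (\<lambda>y. x False + (x True - x False) * indicator {(G, v). \<tau> n G v} y)"
      by (intro Bochner_Integration.integral_cong) (auto split: split_indicator)
    also have "\<dots> = x False + (x True - x False) * ?p n"
      by (subst Bochner_Integration.integral_add[OF int int]) simp
    finally show ?case by simp
  qed
  ultimately show ?thesis by (rule Lim_transform_eventually)
qed

section \<open>The extremal coordinates as a pair of measures, and the lower bound\<close>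

context spin_gauge begin

lemma coord_BP:
  assumes "colour_compat bip c c'" "h \<in> Delta"
  shows "coord c (BP \<psi> \<psi>b d h) = A c (T * coord c' h)"
  unfolding BP_msg[OF assms] by (rule msg_props(2)[OF adm_coord[OF assms]])

lemma Ulim_uncoloured: "\<not> bip \<Longrightarrow> Ulim t False = Ulim t True"
proof -
  assume b: "\<not> bip"
  have AF: "A False = A True" using uncoloured[OF b] by (auto simp: A_def den_def fun_eq_iff)
  have "U t k False = U t k True" for k by (induction k) (use uncoloured[OF b] AF in auto)
  thus ?thesis by (simp add: Ulim_def)
qed

lemma Ulim_message:
  shows "msg c (Ulim T (\<not> c)) \<in> Delta" "coord c (msg c (Ulim T (\<not> c))) = Ulim T c"
  using msg_props[OF Ulim_adm[OF T0 order_refl, of c]] Ulim_fixed[OF T0 order_refl, of c] by auto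

lemma Ulim_fixed_pair:
  assumes bip shows "msg c (Ulim T (\<not> c)) = BP \<psi> \<psi>b d (msg (\<not> c) (Ulim T c))"
proof -
  have "colour_compat bip c (\<not> c)" using assms by (simp add: colour_compat_def)
  from BP_msg[OF this Ulim_message(1)[of "\<not> c"]] show ?thesis using Ulim_message(2)[of "\<not> c"] by simp
qed

lemma Ulim_fixed_point:
  assumes "\<not> bip" shows "msg True (Ulim T True) = BP \<psi> \<psi>b d (msg True (Ulim T True))"
    "msg True (Ulim T True) \<in> Delta" "coord True (msg True (Ulim T True)) = Ulim T True"
proof -
  have u: "Ulim T False = Ulim T True" by (rule Ulim_uncoloured[OF assms])
  show m: "msg True (Ulim T True) \<in> Delta" "coord True (msg True (Ulim T True)) = Ulim T True"
    using Ulim_message[of True] u by auto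
  have "colour_compat bip True True" using assms by (simp add: colour_compat_def)
  from BP_msg[OF this m(1)] show "msg True (Ulim T True) = BP \<psi> \<psi>b d (msg True (Ulim T True))" using m(2) by simp
qed

end

text \<open>In the gauge at \<open>h\<close> the pair has coordinates \<open>0\<close>. The extremal
  coordinates \<open>Ulim T\<close> are nonnegative and belong to a fixed pair, whose coordinates
  are nonpositive by the maximality of \<open>h\<close>; so they vanish and
  \<open>free_energy_lower\<close> applies.\<close>

lemma free_energy_ge:
  fixes h :: "bool \<Rightarrow> bool \<Rightarrow> real"
  assumes spec: "two_spin_spec \<psi> \<psi>b" and nondeg: "non_degenerate \<psi>" and d3: "d \<ge> 3"
    and rg: "random_graph_seq P" and sparse: "uniformly_sparse P"
    and h: "\<And>c. h c \<in> Delta" "\<And>c. h c = BP \<psi> \<psi>b d (h (\<not> c))"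
    and sgn: "(\<psi> True True * \<psi> False False \<ge> (\<psi> True False)\<^sup>2 \<and> f True = f False) \<or>
       (\<psi> True True * \<psi> False False < (\<psi> True False)\<^sup>2 \<and> f True \<noteq> f False)"
    and mono: "\<not> bip \<Longrightarrow> h True = h False \<and> f True = f False"
    and max: "\<And>h' c. (\<And>c. h' c \<in> Delta) \<Longrightarrow> (\<And>c. h' c = BP \<psi> \<psi>b d (h' (\<not> c))) \<Longrightarrow> (\<not> bip \<Longrightarrow> h' True = h' False) \<Longrightarrow>
       h' c (f c) \<le> h c (f c)"
    and uncol: "\<And>n G. \<not> bip \<Longrightarrow> col n G = (\<lambda>_. True)"
    and good: "\<And>R. (\<lambda>n. measure_pmf.prob (rooted P n) {(G, v). good_ball d bip G (col n G) R v}) \<longlonglongrightarrow> 1"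
    and average: "\<And>x :: bool \<Rightarrow> real. (\<not> bip \<Longrightarrow> x True = x False) \<Longrightarrow>
      (\<lambda>n. measure_pmf.expectation (rooted P n) (\<lambda>(G, v). x (col n G v))) \<longlonglongrightarrow> (x True + x False) / 2"
    and e: "e > 0"
  shows "eventually (\<lambda>n. free_energy_seq \<psi> \<psi>b P n \<ge> Phi2 \<psi> \<psi>b d (h True) (h False) - e) sequentially"
proof -
  obtain fs where fs: "\<And>s. \<psi> fs s > 0" using free_spin[OF spec nondeg] by blast
  obtain T a g p q w where gg: "spin_gauge d T a g p q \<psi> \<psi>b w f fs bip"
    and zero: "\<And>c. a c * (w c (f c) * h c (f c)) = g c * (w c (\<not> f c) * h c (\<not> f c))"
    using fixed_pair_gauge[where h = h and f = f and bip = bip, OF spec nondeg d3 fs h sgn mono] by metis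
  obtain M \<delta> \<kappa> Zm where "bounded_spin_gauge d T a g p q \<psi> \<psi>b w f fs bip M \<delta> \<kappa> Zm"
    using spin_gauge_bounded[OF gg] .
  then interpret bounded_spin_gauge d T a g p q \<psi> \<psi>b w f fs bip M \<delta> \<kappa> Zm .
  have c0: "coord c (h c) = 0" for c unfolding coord_favoured zero by simp
  have le: "coord c (h' c) \<le> 0" if "\<And>c. h' c \<in> Delta" "\<And>c. h' c = BP \<psi> \<psi>b d (h' (\<not> c))" "\<not> bip \<Longrightarrow> h' True = h' False" for h' c
    using coord_mono[OF that(1) h(1) max[OF that], of c] c0[of c] by simp
  have U0: "Ulim T c = 0" for c
  proof (cases bip)
    case True
    have "coord c (msg c (Ulim T (\<not> c))) \<le> 0"
    proof (rule le[of "\<lambda>c. msg c (Ulim T (\<not> c))"])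
      show "msg c (Ulim T (\<not> c)) = BP \<psi> \<psi>b d (msg (\<not> c) (Ulim T (\<not> \<not> c)))" for c
        using Ulim_fixed_pair[OF True, of c] by simp
    qed (use True Ulim_message in auto)
    thus ?thesis using Ulim_message(2)[of c] Ulim_box(1)[OF T0 order_refl, of c] by simp
  next
    case False
    have "coord True (msg True (Ulim T True)) \<le> 0"
      by (rule le[of "\<lambda>_. msg True (Ulim T True)"]) (use Ulim_fixed_point[OF False] in auto)
    hence "Ulim T True = 0" using Ulim_fixed_point(3)[OF False] Ulim_box(1)[OF T0 order_refl, of True] by simp
    thus ?thesis using Ulim_uncoloured[OF False, of T] by (cases c) auto
  qed
  have L: "L False 0 = L True 0" if "\<not> bip" using uncoloured[OF that] by (simp add: L_def)
  have Ph: "Phi2 \<psi> \<psi>b d (h True) (h False) = (L True 0 + L False 0) / 2"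
  proof (cases bip)
    case True
    hence "colour_compat bip True False" by (simp add: colour_compat_def)
    from Bethe_functional[OF this h(1) h(1)] show ?thesis using c0 by simp
  next
    case False
    hence "colour_compat bip True True" by (simp add: colour_compat_def)
    from Bethe_functional[OF this h(1)[of True] h(1)[of True]] have "Phi2 \<psi> \<psi>b d (h True) (h True) = L True 0"
      using c0[of True] by simp
    moreover have "h False = h True" using mono[OF False] by simp
    ultimately show ?thesis using L[OF False] by simp
  qed
  have "(\<lambda>n. measure_pmf.expectation (rooted P n) (\<lambda>(G, v). L (col n G v) 0)) \<longlonglongrightarrow> (L True 0 + L False 0) / 2"
    by (rule average[of "\<lambda>c. L c 0"]) (use L in simp)
  from free_energy_lower[OF rg sparse uncol good this U0 e] show ?thesis unfolding Ph .
qed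

section \<open>The ferromagnetic case\<close>

context pos_gauge begin

text \<open>The derivative has the sign of \<open>A True (T * x) - x\<close>. This ranks the fixed
  points against each other at the final parameter and thereby identifies the supremum.\<close>

lemma diagonal_mono:
  assumes st: "\<And>x. 0 < x \<Longrightarrow> x \<le> T * z \<Longrightarrow> x \<le> T * A True x"
    and u: "0 \<le> u" "u \<le> v" "v \<le> z" and z: "z \<le> a False"
  shows "L True (T * u) - real d / 2 * ln (1 + T * (u * u)) \<le> L True (T * v) - real d / 2 * ln (1 + T * (v * v))"
proof (rule DERIV_nonneg_imp_nondecreasing[OF u(2)])
  fix x assume x: "u \<le> x" "x \<le> v"
  have x0: "0 \<le> x" "x \<le> z" using x u by auto
  have ad: "adm True (T * x)" using x0 z T0 by (intro adm_nonneg) auto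
  have A0: "A True (T * x) \<ge> 0" using x0 T0 by (intro A_nonneg ad) auto
  have pos: "1 + T * (x * x) > 0" using T0 x0 by (simp add: add_pos_nonneg)
  have "((\<lambda>x. L True (T * x) - real d / 2 * ln (1 + T * (x * x))) has_real_derivative
      real d * A True (T * x) / (1 + T * x * A True (T * x)) * T - real d / 2 * ((T * (x + x)) / (1 + T * (x * x)))) (at x)"
  proof (rule DERIV_diff)
    show "((\<lambda>x. L True (T * x)) has_real_derivative real d * A True (T * x) / (1 + T * x * A True (T * x)) * T) (at x)"
      by (rule DERIV_chain2[where f = "L True" and g = "\<lambda>x. T * x" and x = x, OF L_deriv[OF ad] DERIV_cmult_Id])
    show "((\<lambda>x. real d / 2 * ln (1 + T * (x * x))) has_real_derivative real d / 2 * ((T * (x + x)) / (1 + T * (x * x)))) (at x)"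
    proof (rule DERIV_cmult)
      show "((\<lambda>x. ln (1 + T * (x * x))) has_real_derivative (T * (x + x)) / (1 + T * (x * x))) (at x)"
        using pos by (auto intro!: derivative_eq_intros)
    qed
  qed
  also have "real d * A True (T * x) / (1 + T * x * A True (T * x)) * T - real d / 2 * ((T * (x + x)) / (1 + T * (x * x)))
     = real d * T * (A True (T * x) / (1 + T * x * A True (T * x)) - x / (1 + T * (x * x)))"
    by (simp add: algebra_simps)
  finally have der: "((\<lambda>x. L True (T * x) - real d / 2 * ln (1 + T * (x * x))) has_real_derivative
     real d * T * (A True (T * x) / (1 + T * x * A True (T * x)) - x / (1 + T * (x * x)))) (at x)" .
  have "0 \<le> real d * T * (A True (T * x) / (1 + T * x * A True (T * x)) - x / (1 + T * (x * x)))"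
  proof (cases "T = 0 \<or> x = 0")
    case True thus ?thesis using A0 T0 by auto
  next
    case False
    hence "T * x \<le> T * A True (T * x)" using x0 T0 by (intro st mult_left_mono) auto
    hence "x \<le> A True (T * x)" using False T0 by simp
    hence "x / (1 + T * x * x) \<le> A True (T * x) / (1 + T * x * A True (T * x))"
      using x0 T0 by (intro mobius_mono) auto
    thus ?thesis using T0 by (simp add: mult.assoc)
  qed
  thus "\<exists>y. ((\<lambda>x. L True (T * x) - real d / 2 * ln (1 + T * (x * x))) has_real_derivative y) (at x) \<and> 0 \<le> y"
    using der by blast
qed

text \<open>The field pushes towards the favoured spin, so the answer to \<open>- y\<close> is at
  most as negative as the answer to \<open>y\<close> is positive. Cross-multiplied, this is
  \<open>q True * q True \<le> p True * p True\<close>.\<close>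

lemma sym_odd:
  assumes sym: "\<And>c. a c = 1" "\<And>c. g c = 1" "p False = p True" "q False = q True" and y: "0 \<le> y" "adm c y"
  shows "- A c y \<le> A c' (- y)"
proof -
  have y1: "y \<le> 1" using y(2) sym by (simp add: adm_def)
  have pq: "p c' = p True" "q c' = q True" "p c = p True" "q c = q True" using sym by (cases c; cases c'; simp)+
  define u v where "u = (1 + y) ^ (d - 1)" and "v = (1 - y) ^ (d - 1)"
  have uv: "u > 0" "v \<ge> 0" using y y1 by (auto simp: u_def v_def)
  have P0: "p True > 0" "q True > 0" "q True \<le> p True" using p0 q0 gq_ap[of True] sym by auto
  have d1: "p True * u + q True * v > 0" "p True * v + q True * u > 0" using uv P0 by (auto intro: add_pos_nonneg add_nonneg_pos)
  have e: "A c y = (p True * u - q True * v) / (p True * u + q True * v)"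
    "A c' (- y) = (p True * v - q True * u) / (p True * v + q True * u)"
    unfolding A_def den_def sym pq u_def v_def by simp_all
  have "q True * q True \<le> p True * p True" using P0 by (intro mult_mono) auto
  hence "(q True * q True) * (u * v) \<le> (p True * p True) * (u * v)" using uv by (intro mult_right_mono) auto
  hence "- (p True * u - q True * v) * (p True * v + q True * u) \<le> (p True * v - q True * u) * (p True * u + q True * v)"
    by (simp add: algebra_simps)
  thus ?thesis unfolding e using d1 by (simp add: pos_le_divide_eq pos_divide_le_eq minus_divide_left[symmetric] del: minus_divide_left) (simp add: field_simps)
qed

end

lemma tendsto_from_bounds:
  fixes F :: "nat \<Rightarrow> real"
  assumes "\<And>e. e > 0 \<Longrightarrow> eventually (\<lambda>n. F n \<le> x + e) sequentially"
    "\<And>e. e > 0 \<Longrightarrow> eventually (\<lambda>n. F n \<ge> x - e) sequentially"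
  shows "F \<longlonglongrightarrow> x"
proof (rule order_tendstoI)
  fix y assume "y < x"
  hence "eventually (\<lambda>n. F n \<ge> x - (x - y) / 2) sequentially" by (intro assms(2)) simp
  thus "eventually (\<lambda>n. y < F n) sequentially" by eventually_elim (use \<open>y < x\<close> in \<open>simp add: field_simps\<close>)
next
  fix y assume "x < y"
  hence "eventually (\<lambda>n. F n \<le> x + (y - x) / 2) sequentially" by (intro assms(1)) simp
  thus "eventually (\<lambda>n. F n < y) sequentially" by eventually_elim (use \<open>x < y\<close> in \<open>simp add: field_simps\<close>)
qed

text \<open>\<open>k\<close> is the off-diagonal entry divided by the geometric mean of the diagonal
  ones; with \<open>k = exp (- 2 * \<beta>)\<close> the parameter \<open>T\<close> is
  \<open>tanh \<beta>\<close>. The hypothesis \<open>field\<close>, raised to the power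
  \<open>d / 2\<close>, is \<open>q \<le> p\<close>.\<close>

lemma Ising_gauge:
  assumes spec: "two_spin_spec \<psi> \<psi>b" and nondeg: "non_degenerate \<psi>" and d3: "d \<ge> 3" and ferro: "ferromagnetic \<psi>"
    and field: "\<psi> (\<not> f0) (\<not> f0) * \<psi>b (\<not> f0) powr (2 / real d) \<le> \<psi> f0 f0 * \<psi>b f0 powr (2 / real d)"
  obtains T p q w where "spin_gauge d T (\<lambda>_. 1) (\<lambda>_. 1) (\<lambda>_. p) (\<lambda>_. q) \<psi> \<psi>b w (\<lambda>_. f0) True False" "T < 1"
proof -
  have \<psi>0: "\<psi> s s' \<ge> 0" "\<psi> s s' = \<psi> s' s" "\<psi>b s > 0" for s s' using spec by (auto simp: two_spin_spec_def)
  have TF: "\<psi> True False > 0" using nondeg by (simp add: non_degenerate_def)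
  have "\<psi> True True * \<psi> False False > 0" using ferro TF zero_less_power[OF TF, of 2] unfolding ferromagnetic_def by linarith
  hence diag: "\<psi> s s > 0" for s using \<psi>0(1)[of True True] \<psi>0(1)[of False False] by (cases s) (auto simp: zero_less_mult_iff)
  define R where "R = sqrt (\<psi> True True * \<psi> False False)"
  have R0: "R > 0" using diag by (simp add: R_def)
  have RTF: "\<psi> True False \<le> R" unfolding R_def using ferro TF by (intro real_le_rsqrt) (simp add: ferromagnetic_def)
  define k where "k = \<psi> True False / R"
  have k: "0 < k" "k \<le> 1" using TF R0 RTF by (auto simp: k_def)
  define T where "T = (1 - k) / (1 + k)"
  have T: "0 \<le> T" "T < 1" using k by (auto simp: T_def)
  have T1: "1 + T = 2 / (1 + k)" "1 - T = 2 * k / (1 + k)" using k by (auto simp: T_def field_simps)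
  define w where "w s = sqrt (\<psi> s s / (1 + T))" for s
  have w0: "w s > 0" for s using diag T by (simp add: w_def)
  have ww: "w s * w s * (1 + T) = \<psi> s s" for s using diag[of s] T by (simp add: w_def)
  have wTF: "w True * w False * (1 - T) = \<psi> True False"
  proof -
    have "w True * w False = R / (1 + T)"
      using T by (simp add: w_def R_def real_sqrt_mult[symmetric] real_sqrt_divide)
    hence "w True * w False * (1 - T) = R / (2 / (1 + k)) * (2 * k / (1 + k))" unfolding T1(1)[symmetric] T1(2)[symmetric] by simp
    also have "\<dots> = R * k" using k by simp
    finally have "w True * w False * (1 - T) = R * k" .
    thus ?thesis using R0 by (simp add: k_def)
  qed
  define p where "p = \<psi>b f0 * w f0 ^ d"
  define q where "q = \<psi>b (\<not> f0) * w (\<not> f0) ^ d"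
  have qp: "q \<le> p"
  proof -
    have e: "\<psi>b s * w s ^ d = (\<psi> s s * \<psi>b s powr (2 / real d)) powr (real d / 2) / (1 + T) powr (real d / 2)" for s
    proof -
      have "w s ^ d = (\<psi> s s / (1 + T)) powr (real d / 2)"
        using diag[of s] T w0[of s] by (simp add: w_def powr_half_sqrt[symmetric] powr_powr powr_realpow[symmetric])
      moreover have "(\<psi>b s powr (2 / real d)) powr (real d / 2) = \<psi>b s"
        using \<psi>0(3)[of s] d3 by (simp add: powr_powr)
      ultimately show ?thesis using diag[of s] T \<psi>0(3)[of s] by (simp add: powr_divide powr_mult)
    qed
    show ?thesis unfolding p_def q_def e using field diag[of "\<not> f0"] \<psi>0(3)[of "\<not> f0"] T
      by (intro divide_right_mono powr_mono2) (auto simp: less_imp_le)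
  qed
  have "spin_gauge d T (\<lambda>_. 1) (\<lambda>_. 1) (\<lambda>_. p) (\<lambda>_. q) \<psi> \<psi>b (\<lambda>_. w) (\<lambda>_. f0) True False"
  proof
    show "\<psi> s s' = w s * w s' * (1 + T * (spin_coord (\<lambda>_. f0) (\<lambda>_. 1) (\<lambda>_. 1) c s * spin_coord (\<lambda>_. f0) (\<lambda>_. 1) (\<lambda>_. 1) c' s'))" for c c' s s'
      using ww[of s] wTF \<psi>0(2)[of True False] unfolding spin_coord_def
      by (cases s; cases s'; cases f0) (auto simp: mult_ac)
    show "0 < \<psi> True s" for s using diag[of True] TF by (cases s) auto
  qed (use d3 T qp w0 \<psi>0 in \<open>auto simp: p_def q_def\<close>)
  thus ?thesis using T(2) by (rule that)
qed

text \<open>The spin \<open>f0\<close> favoured by the field is a parameter, so both alternatives in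
  the theorem are instances.\<close>

lemma ferromagnetic_limit:
  assumes spec: "two_spin_spec \<psi> \<psi>b" and nondeg: "non_degenerate \<psi>" and d3: "d \<ge> 3"
    and rg: "random_graph_seq P" and sparse: "uniformly_sparse P" and loc: "converges_locally P d"
    and ferro: "ferromagnetic \<psi>"
    and field: "\<psi> (\<not> f0) (\<not> f0) * \<psi>b (\<not> f0) powr (2 / real d) \<le> \<psi> f0 f0 * \<psi>b f0 powr (2 / real d)"
  shows "\<exists>h\<in>fixed_points \<psi> \<psi>b d. (\<forall>h'\<in>fixed_points \<psi> \<psi>b d. h' f0 \<le> h f0) \<and>
    Phi_T \<psi> \<psi>b d = Phi1 \<psi> \<psi>b d h \<and> free_energy_seq \<psi> \<psi>b P \<longlonglongrightarrow> Phi1 \<psi> \<psi>b d h"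
proof -
  obtain T p q w where gg: "spin_gauge d T (\<lambda>_. 1) (\<lambda>_. 1) (\<lambda>_. p) (\<lambda>_. q) \<psi> \<psi>b w (\<lambda>_. f0) True False" and T1: "T < 1"
    using Ising_gauge[OF spec nondeg d3 ferro field] by metis
  obtain M \<delta> \<kappa> Zm where "bounded_spin_gauge d T (\<lambda>_. 1) (\<lambda>_. 1) (\<lambda>_. p) (\<lambda>_. q) \<psi> \<psi>b w (\<lambda>_. f0) True False M \<delta> \<kappa> Zm"
    using spin_gauge_bounded[OF gg] .
  then interpret bounded_spin_gauge d T "\<lambda>_. 1" "\<lambda>_. 1" "\<lambda>_. p" "\<lambda>_. q" \<psi> \<psi>b w "\<lambda>_. f0" True False M \<delta> \<kappa> Zm .
  have cc: "colour_compat False True True" by (simp add: colour_compat_def)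
  have AF: "A False = A True" by (auto simp: A_def den_def fun_eq_iff)
  have LF: "L False = L True" by (auto simp: L_def fun_eq_iff)
  have UF: "Ulim t False = Ulim t True" for t by (rule Ulim_uncoloured) simp
  have st: "expanding t" if "0 \<le> t" "t \<le> T" for t using that T1 by (intro expanding_sym(2)) auto
  define z where "z = Ulim T True"
  have zb: "0 \<le> z" "z \<le> 1" using Ulim_box[OF T0 order_refl, of True] by (auto simp: z_def)
  define h where "h = msg True z"
  have h: "h \<in> Delta" "h = BP \<psi> \<psi>b d h" "coord True h = z" using Ulim_fixed_point unfolding h_def z_def by auto
  have fixed: "coord True h' = A True (T * coord True h')" if "h' \<in> fixed_points \<psi> \<psi>b d" for h'
    using coord_BP[OF cc, of h'] that by (simp add: fixed_points_def)
  have top: "coord True h' \<le> z" if h': "h' \<in> fixed_points \<psi> \<psi>b d" for h'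
    unfolding z_def
  proof (rule Ulim_greatest[OF T0 order_refl, of "\<lambda>_. coord True h'"])
    show "coord True h' = A c (T * coord True h')" for c using fixed[OF h'] AF by (cases c) auto
  qed (use coord_box[of h' True] h' in \<open>auto simp: fixed_points_def\<close>)
  define F where "F u = L True (T * u) - real d / 2 * ln (1 + T * (u * u))" for u
  have PhiF: "Phi1 \<psi> \<psi>b d h' = F (coord True h')" if h': "h' \<in> fixed_points \<psi> \<psi>b d" for h'
  proof -
    have D: "h' \<in> Delta" using h' by (simp add: fixed_points_def)
    have "1 + T * coord True h' * A True (T * coord True h') > 0" by (rule one_plus_A_pos[OF adm_coord[OF cc D]])
    hence "1 + T * (coord True h' * coord True h') > 0" using fixed[OF h'] by (simp add: mult.assoc)
    from Bethe_functional[OF cc D D this] show ?thesis by (simp add: Phi1_eq_Phi2 F_def)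
  qed
  have hfix: "h \<in> fixed_points \<psi> \<psi>b d" using h by (simp add: fixed_points_def)
  have Fmono: "F u \<le> F v" if "0 \<le> u" "u \<le> v" "v \<le> z" for u v
    unfolding F_def
  proof (rule diagonal_mono[of z, OF _ that])
    show "x \<le> T * A True x" if "0 < x" "x \<le> T * z" for x
      using that T0 T1 unfolding z_def by (intro expanding_sym(1)[of T]) auto
  qed (use zb in simp)
  have le: "Phi1 \<psi> \<psi>b d h' \<le> Phi1 \<psi> \<psi>b d h" if h': "h' \<in> fixed_points \<psi> \<psi>b d" for h'
  proof -
    let ?u = "coord True h'"
    have D: "h' \<in> Delta" using h' by (simp add: fixed_points_def)
    have ub: "- 1 \<le> ?u" "?u \<le> 1" using coord_box[OF D, of True] by auto
    have "F ?u \<le> F z"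
    proof (cases "?u \<ge> 0")
      case True thus ?thesis using top[OF h'] by (intro Fmono) auto
    next
      case False
      \<comment> \<open>A fixed point on the unfavoured side is reflected. The recursion maps the
        reflected point upwards, so it lies below \<open>z\<close>, and the field makes the
        functional at least as large there.\<close>
      define v where "v = - ?u"
      have v: "0 \<le> v" "v \<le> 1" using False ub by (auto simp: v_def)
      have ad: "adm c (T * v)" for c using v T0 by (intro adm_nonneg) auto
      have "- A True (T * v) \<le> A True (- (T * v))" using v T0 ad by (intro sym_odd) auto
      also have "\<dots> = ?u" using fixed[OF h'] by (simp add: v_def)
      finally have vA: "v \<le> A True (T * v)" by (simp add: v_def)
      have "v \<le> U T k c" for k c
      proof (induction k arbitrary: c)
        case 0 show ?case using v by simp
      next
        case (Suc k)
        have "A c (T * v) \<le> A c (T * U T k (\<not> c))"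
          using Suc[of "\<not> c"] T0 by (intro A_mono ad U_adm mult_left_mono) auto
        moreover have "A c (T * v) = A True (T * v)" using AF by (cases c) auto
        ultimately show ?case using vA by (simp add: U.simps(2))
      qed
      hence vz: "v \<le> z" unfolding z_def by (intro LIMSEQ_le_const[OF U_tendsto[OF T0 order_refl]]) auto
      have "F ?u \<le> F v"
      proof -
        define x where "x = T * v"
        have x: "0 \<le> x" "x \<le> 1" using v T0 T1 mult_mono[of T 1 v 1] by (auto simp: x_def)
        have "q \<le> p" using gq_ap by simp
        moreover have "(1 - x) ^ d \<le> (1 + x) ^ d" using x by (intro power_mono) auto
        ultimately have "0 \<le> (p - q) * ((1 + x) ^ d - (1 - x) ^ d)" by simp
        hence "p * (1 - x) ^ d + q * (1 + x) ^ d \<le> p * (1 + x) ^ d + q * (1 - x) ^ d" by (simp add: algebra_simps)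
        moreover have "adm True (- x)" using x by (simp add: adm_def)
        hence "p * (1 - x) ^ d + q * (1 + x) ^ d > 0" using powsum_pos[of True "- x" d] by simp
        ultimately have "L True (- x) \<le> L True x" unfolding L_def by simp
        thus ?thesis unfolding F_def by (simp add: v_def x_def)
      qed
      also have "F v \<le> F z" using v vz by (intro Fmono) auto
      finally show ?thesis .
    qed
    thus ?thesis unfolding PhiF[OF h'] PhiF[OF hfix] h(3) .
  qed
  have sup: "Phi_T \<psi> \<psi>b d = Phi1 \<psi> \<psi>b d h"
    unfolding Phi_T_def by (rule cSup_eq_maximum) (use hfix le in auto)
  have max: "h' f0 \<le> h f0" if h': "h' \<in> fixed_points \<psi> \<psi>b d" for h'
    using coord_inj_le[of h' h True] top[OF h'] h h' by (simp add: fixed_points_def)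
  have good: "\<And>R. (\<lambda>n. measure_pmf.prob (rooted P n) {(G, v). good_ball d False G ((\<lambda>n G _. True) n G) R v}) \<longlonglongrightarrow> 1"
    using good_ball_uncoloured_tendsto[OF loc] by simp
  have average: "(\<lambda>n. measure_pmf.expectation (rooted P n) (\<lambda>(G, v). x ((\<lambda>n G _. True) n G v))) \<longlonglongrightarrow> (x True + x False) / 2"
    if "x True = x False" for x :: "bool \<Rightarrow> real"
  proof -
    have "(\<lambda>(G :: graph, v :: nat). x ((\<lambda>n G _. True) n G v)) = (\<lambda>_. x True)" for n :: nat by auto
    thus ?thesis using that by simp
  qed
  have "free_energy_seq \<psi> \<psi>b P \<longlonglongrightarrow> Phi1 \<psi> \<psi>b d h"
  proof (rule tendsto_from_bounds)
    fix e :: real assume e: "e > 0"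
    have odd: "- A (\<not> c) y \<le> A c (- y)" if "0 \<le> y" "adm (\<not> c) y" for c y using that by (intro sym_odd) auto
    have "eventually (\<lambda>n. free_energy_seq \<psi> \<psi>b P n \<le> (L True 0 + L False 0) / 2
       + (Phi T (Ulim T True) (Ulim T False) - (L True 0 + L False 0) / 2) + e) sequentially"
      using LF by (intro free_energy_upper[OF rg sparse _ good average[of "\<lambda>c. L c 0"] _ odd st e]) auto
    moreover have "Phi T (Ulim T True) (Ulim T False) = Phi1 \<psi> \<psi>b d h"
      unfolding PhiF[OF hfix] h(3) F_def Phi_def UF LF z_def[symmetric] by (simp add: mult.assoc)
    ultimately show "eventually (\<lambda>n. free_energy_seq \<psi> \<psi>b P n \<le> Phi1 \<psi> \<psi>b d h + e) sequentially" by simp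
    have "eventually (\<lambda>n. free_energy_seq \<psi> \<psi>b P n \<ge> Phi2 \<psi> \<psi>b d ((\<lambda>_. h) True) ((\<lambda>_. h) False) - e) sequentially"
    proof (rule free_energy_ge[where bip = False and f = "\<lambda>_. f0" and col = "\<lambda>n G _. True", OF spec nondeg d3 rg sparse])
      show "(\<psi> True False)\<^sup>2 \<le> \<psi> True True * \<psi> False False \<and> f0 = f0 \<or> \<psi> True True * \<psi> False False < (\<psi> True False)\<^sup>2 \<and> f0 \<noteq> f0"
        using ferro by (simp add: ferromagnetic_def)
      fix h' :: "bool \<Rightarrow> bool \<Rightarrow> real" and c
      assume h': "\<And>c. h' c \<in> Delta" "\<And>c. h' c = BP \<psi> \<psi>b d (h' (\<not> c))" "\<not> False \<Longrightarrow> h' True = h' False"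
      hence "h' c \<in> fixed_points \<psi> \<psi>b d" unfolding fixed_points_def by (cases c) (metis (mono_tags, lifting) mem_Collect_eq)+
      thus "h' c f0 \<le> h f0" by (rule max)
    qed (use h e good average in auto)
    thus "eventually (\<lambda>n. free_energy_seq \<psi> \<psi>b P n \<ge> Phi1 \<psi> \<psi>b d h - e) sequentially" by (simp add: Phi1_eq_Phi2)
  qed
  thus ?thesis using hfix max sup by blast
qed

section \<open>The anti-ferromagnetic case\<close>

lemma BP_Delta:
  assumes spec: "two_spin_spec \<psi> \<psi>b" and fs: "\<And>s. \<psi> fs s > 0" and h: "h \<in> Delta"
  shows "(\<Sum>r\<in>UNIV. \<psi>b r * (\<Sum>s'\<in>UNIV. \<psi> r s' * h s') ^ k) > 0" "BP \<psi> \<psi>b d h \<in> Delta"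
proof -
  have \<psi>0: "\<psi> s s' \<ge> 0" "\<psi>b s > 0" for s s' using spec by (auto simp: two_spin_spec_def)
  have hn: "h s \<ge> 0" for s using h by (auto simp: Delta_def)
  have ap0: "(\<Sum>s'\<in>UNIV. \<psi> s s' * h s') \<ge> 0" for s using \<psi>0 hn by (intro sum_nonneg) auto
  have "h True + h False = 1" using h by (auto simp: Delta_def)
  hence "h True > 0 \<or> h False > 0" using hn[of True] hn[of False] by linarith
  hence apf: "(\<Sum>s'\<in>UNIV. \<psi> fs s' * h s') > 0" using fs hn[of True] hn[of False] unfolding UNIV_bool
    by (auto intro: add_pos_nonneg add_nonneg_pos simp: less_imp_le)
  show den: "(\<Sum>r\<in>UNIV. \<psi>b r * (\<Sum>s'\<in>UNIV. \<psi> r s' * h s') ^ k) > 0" for k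
  proof (rule sum_pos2[where i = fs])
    show "0 < \<psi>b fs * (\<Sum>s'\<in>UNIV. \<psi> fs s' * h s') ^ k" using apf \<psi>0(2)[of fs] by simp
    show "0 \<le> \<psi>b i * (\<Sum>s'\<in>UNIV. \<psi> i s' * h s') ^ k" for i using ap0[of i] \<psi>0(2)[of i] by (simp add: less_imp_le)
  qed auto
  define D where "D = (\<Sum>r\<in>UNIV. \<psi>b r * (\<Sum>s'\<in>UNIV. \<psi> r s' * h s') ^ (d - 1))"
  have D0: "D > 0" unfolding D_def by (rule den)
  have b: "BP \<psi> \<psi>b d h s = \<psi>b s * (\<Sum>s'\<in>UNIV. \<psi> s s' * h s') ^ (d - 1) / D" for s by (simp only: BP_def D_def)
  have "BP \<psi> \<psi>b d h s \<ge> 0" for s unfolding b using ap0[of s] \<psi>0(2)[of s] D0 by (simp add: less_imp_le)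
  moreover have "BP \<psi> \<psi>b d h True + BP \<psi> \<psi>b d h False = D / D"
    unfolding b add_divide_distrib[symmetric] D_def UNIV_bool by (simp add: add.commute)
  ultimately show "BP \<psi> \<psi>b d h \<in> Delta" using D0 by (simp add: Delta_def)
qed

text \<open>\<open>Delta\<close> is a segment, so the intermediate value theorem gives a fixed
  point. The symmetric gauge of the anti-ferromagnetic case is built at it.\<close>

lemma BP_fixed_point_exists:
  assumes spec: "two_spin_spec \<psi> \<psi>b" and fs: "\<And>s. \<psi> fs s > 0"
  obtains h where "h \<in> Delta" "BP \<psi> \<psi>b d h = h"
proof -
  define m where "m x = (\<lambda>s::bool. if s then x else 1 - x)" for x :: real
  have mD: "m x \<in> Delta" if "0 \<le> x" "x \<le> 1" for x using that by (auto simp: m_def Delta_def)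
  define F where "F x = BP \<psi> \<psi>b d (m x) True - x" for x
  have "continuous_on {0..1} F"
    unfolding F_def BP_def
  proof (intro continuous_intros ballI)
    fix x :: real assume "x \<in> {0..1}"
    hence "m x \<in> Delta" by (intro mD) auto
    from BP_Delta(1)[OF spec fs this, of "d - 1"]
    show "(\<Sum>r\<in>UNIV. \<psi>b r * (\<Sum>s'\<in>UNIV. \<psi> r s' * m x s') ^ (d - 1)) \<noteq> 0" by simp
  next
    have c: "continuous_on {0..1} (\<lambda>x. m x s)" for s unfolding m_def by (cases s) (auto intro!: continuous_intros)
    show "continuous_on {0..1} (\<lambda>x. m x s)" "continuous_on {0..1} (\<lambda>x. m x s)" for s by (rule c)+
  qed
  moreover have "F 1 \<le> 0" "0 \<le> F 0"
    using BP_Delta(2)[OF spec fs mD[of 1], of d] BP_Delta(2)[OF spec fs mD[of 0], of d]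
    by (auto simp: F_def Delta_def) (metis add_increasing2 order_refl)
  ultimately obtain x where x: "0 \<le> x" "x \<le> 1" "F x = 0"
    using IVT2'[of F 1 0 0] by auto
  have D: "BP \<psi> \<psi>b d (m x) \<in> Delta" by (rule BP_Delta(2)[OF spec fs mD[OF x(1,2)]])
  have t: "BP \<psi> \<psi>b d (m x) True = x" using x(3) by (simp add: F_def)
  hence "BP \<psi> \<psi>b d (m x) False = 1 - x" using D by (simp add: Delta_def)
  hence "BP \<psi> \<psi>b d (m x) = m x" using t by (auto simp: fun_eq_iff m_def)
  thus ?thesis using that mD[OF x(1,2)] by blast
qed

lemma antiferromagnetic_limit:
  assumes spec: "two_spin_spec \<psi> \<psi>b" and nondeg: "non_degenerate \<psi>" and d3: "d \<ge> 3"
    and rg: "random_graph_seq P" and sparse: "uniformly_sparse P"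
    and anti: "antiferromagnetic \<psi>" and nb: "nearly_bipartite P d"
  shows "\<exists>h\<in>fixed_pairs \<psi> \<psi>b d. (\<forall>h'\<in>fixed_pairs \<psi> \<psi>b d. fst h' True \<le> fst h True) \<and>
    Phi_Tpm \<psi> \<psi>b d = Phi2 \<psi> \<psi>b d (fst h) (snd h) \<and> free_energy_seq \<psi> \<psi>b P \<longlonglongrightarrow> Phi2 \<psi> \<psi>b d (fst h) (snd h)"
proof -
  obtain \<tau> where tau: "\<And>t. (\<lambda>n. measure_pmf.prob (rooted P n) {(G, v). ball_is_Tplus d t G (\<tau> n G) v}) \<longlonglongrightarrow> 1/2"
    "\<And>t. (\<lambda>n. measure_pmf.prob (rooted P n) {(G, v). ball_is_Tminus d t G (\<tau> n G) v}) \<longlonglongrightarrow> 1/2"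
    using nb unfolding nearly_bipartite_def by blast
  have \<psi>sym: "\<psi> s s' = \<psi> s' s" for s s' using spec by (auto simp: two_spin_spec_def)
  obtain fs where fs: "\<And>s. \<psi> fs s > 0" using free_spin[OF spec nondeg] by blast
  obtain hs where hs: "hs \<in> Delta" "BP \<psi> \<psi>b d hs = hs" using BP_fixed_point_exists[where \<psi> = \<psi> and fs = fs and d = d, OF spec fs] by blast
  \<comment> \<open>Vertices of colour \<open>+\<close> favour the spin \<open>+\<close> and those
    of colour \<open>-\<close> the spin \<open>-\<close>, so that repulsion between equal spins
    becomes attraction between favoured ones.\<close>
  define f where "f = (\<lambda>c::bool. c)"
  have sgn: "(\<psi> True True * \<psi> False False \<ge> (\<psi> True False)\<^sup>2 \<and> f True = f False) \<or>
       (\<psi> True True * \<psi> False False < (\<psi> True False)\<^sup>2 \<and> f True \<noteq> f False)"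
    using anti by (auto simp: f_def antiferromagnetic_def)
  obtain T a g p q w where gg: "spin_gauge d T a g p q \<psi> \<psi>b w f fs True"
    and gqap: "\<And>c. g c * q c = a c * p c"
    and as: "a False = g True" "g False = a True" "p False = q True" "q False = p True" "w False = w True"
  proof (rule fixed_pair_gauge[where h = "\<lambda>_. hs" and f = f and bip = True and d = d and fs = fs, OF spec nondeg d3 fs _ _ sgn])
    fix T a g p q w
    assume 1: "spin_gauge d T a g p q \<psi> \<psi>b w f fs True" and 2: "\<And>c. g c * q c = a c * p c"
      and 3: "hs = hs \<Longrightarrow> f True \<noteq> f False \<Longrightarrow> a False = g True \<and> g False = a True \<and> p False = q True \<and> q False = p True \<and> w False = w True"
    have "f True \<noteq> f False" by (simp add: f_def)
    note 3 = 3[OF refl this]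
    show thesis using 3 by (intro that[OF 1 2]) auto
  qed (use hs in auto)
  obtain M \<delta> \<kappa> Zm where "bounded_spin_gauge d T a g p q \<psi> \<psi>b w f fs True M \<delta> \<kappa> Zm"
    using spin_gauge_bounded[OF gg] .
  then interpret bounded_spin_gauge d T a g p q \<psi> \<psi>b w f fs True M \<delta> \<kappa> Zm .
  have cc: "colour_compat True c (\<not> c)" for c by (simp add: colour_compat_def)
  have ccTF: "colour_compat True True False" by (simp add: colour_compat_def)
  have sym: "a (\<not> c) = g c" for c using as by (cases c) auto
  have oddA: "A (\<not> c) y = - A c (- y)" for c y
  proof -
    have "p (\<not> c) = q c" "q (\<not> c) = p c" "a (\<not> c) = g c" "g (\<not> c) = a c" using as by (cases c; simp)+
    thus ?thesis unfolding A_def den_def by (simp add: minus_divide_left add.commute)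
  qed
  have st: "expanding t" if "0 \<le> t" "t \<le> T" for t
    using strict that as by (intro expanding_antisym) (auto simp: mult_ac)
  define h where "h c = msg c (Ulim T (\<not> c))" for c
  have h: "h c \<in> Delta" "coord c (h c) = Ulim T c" "h c = BP \<psi> \<psi>b d (h (\<not> c))" for c
    using Ulim_message[of c] Ulim_fixed_pair[of c] by (auto simp: h_def)
  have fixed: "coord c (h' c) = A c (T * coord (\<not> c) (h' (\<not> c)))" if "\<And>c. h' c \<in> Delta" "\<And>c. h' c = BP \<psi> \<psi>b d (h' (\<not> c))" for h' c
    using coord_BP[OF cc[of c] that(1)[of "\<not> c"]] that(2)[of c] by simp
  have top: "coord c (h' c) \<le> Ulim T c" if h': "\<And>c. h' c \<in> Delta" "\<And>c. h' c = BP \<psi> \<psi>b d (h' (\<not> c))" for h' c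
    by (rule Ulim_greatest[OF T0 order_refl, of "\<lambda>c. coord c (h' c)"]) (fact fixed[where h' = h', OF h'], (fact coord_box[OF h'(1)])+)
  have max: "h' c (f c) \<le> h c (f c)" if h': "\<And>c. h' c \<in> Delta" "\<And>c. h' c = BP \<psi> \<psi>b d (h' (\<not> c))" for h' c
    using coord_inj_le[OF h'(1)[of c] h(1)[of c]] top[where h' = h' and c = c, OF h'] h(2)[of c] by simp
  have PhiP: "Phi2 \<psi> \<psi>b d (h' True) (h' False) = Phi T (coord True (h' True)) (coord False (h' False))"
    if h': "\<And>c. h' c \<in> Delta" "\<And>c. h' c = BP \<psi> \<psi>b d (h' (\<not> c))" for h'
  proof -
    have "1 + T * coord False (h' False) * A True (T * coord False (h' False)) > 0"
      by (rule one_plus_A_pos[OF adm_coord[OF ccTF h'(1)]])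
    hence "1 + T * (coord True (h' True) * coord False (h' False)) > 0"
      using fixed[where h' = h' and c = True, OF h'] by (simp add: mult_ac)
    from Bethe_functional[OF ccTF h'(1) h'(1) this] show ?thesis by (simp add: Phi_def mult.assoc)
  qed
  have Phi_le_nonneg: "Phi2 \<psi> \<psi>b d (h' True) (h' False) \<le> Phi2 \<psi> \<psi>b d (h True) (h False)"
    if h': "\<And>c. h' c \<in> Delta" "\<And>c. h' c = BP \<psi> \<psi>b d (h' (\<not> c))" and nn: "coord True (h' True) \<ge> 0" for h'
  proof -
    have "Phi2 \<psi> \<psi>b d (h' True) (h' False) = phi T (T * coord True (h' True))"
      unfolding PhiP[where h' = h', OF h'] using fixed[where h' = h' and c = True, OF h'] fixed[where h' = h' and c = False, OF h'] by (intro phi_fixed[symmetric]) simp_all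
    also have "\<dots> \<le> phi T (T * coord True (h True))"
      using top[where h' = h' and c = True, OF h'] h(2) nn T0 by (intro phi_mono st) (auto intro!: mult_left_mono)
    also have "\<dots> = Phi2 \<psi> \<psi>b d (h True) (h False)"
      unfolding PhiP[where h' = h, OF h(1,3)] using fixed[where h' = h and c = True, OF h(1,3)] fixed[where h' = h and c = False, OF h(1,3)] by (intro phi_fixed) simp_all
    finally show ?thesis .
  qed
  have Phi_le: "Phi2 \<psi> \<psi>b d (h' True) (h' False) \<le> Phi2 \<psi> \<psi>b d (h True) (h False)"
    if h': "\<And>c. h' c \<in> Delta" "\<And>c. h' c = BP \<psi> \<psi>b d (h' (\<not> c))" for h'
  proof (cases "coord True (h' True) \<ge> 0")
    case True thus ?thesis by (rule Phi_le_nonneg[where h' = h', OF h'])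
  next
    case False
    \<comment> \<open>In the symmetric gauge the two colours measure the same message with opposite
      signs. A pair with negative first coordinate therefore becomes one with nonnegative first
      coordinate when its members are exchanged.\<close>
    have flip: "coord True x = - coord False x" for x
      unfolding coord_favoured unfolding as by (simp add: f_def minus_divide_left add.commute)
    have "coord False (h' False) = A False (T * coord True (h' True))" using fixed[where h' = h' and c = False, OF h'] by simp
    also have "\<dots> \<le> A False 0"
      using False T0 adm_coord[OF cc[of False] h'(1)[of True]] by (intro A_mono adm_0) (auto simp: mult_nonneg_nonpos)
    also have "A False 0 = 0" using gqap[of False] by (simp add: A_def)
    finally have "coord True (h' False) \<ge> 0" using flip[of "h' False"] by simp
    hence "Phi2 \<psi> \<psi>b d ((\<lambda>c. h' (\<not> c)) True) ((\<lambda>c. h' (\<not> c)) False) \<le> Phi2 \<psi> \<psi>b d (h True) (h False)"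
      by (intro Phi_le_nonneg[where h' = "\<lambda>c. h' (\<not> c)"] h') simp_all
    thus ?thesis using Phi2_commute[of \<psi> \<psi>b d "h' True" "h' False", OF \<psi>sym] by simp
  qed
  let ?h = "(h True, h False)"
  have pair: thesis
    if x: "x \<in> fixed_pairs \<psi> \<psi>b d"
      and step: "\<And>h'. (\<And>c. h' c \<in> Delta) \<Longrightarrow> (\<And>c. h' c = BP \<psi> \<psi>b d (h' (\<not> c))) \<Longrightarrow> fst x = h' True \<Longrightarrow> snd x = h' False \<Longrightarrow> thesis"
    for x thesis
  proof (rule step)
    let ?k = "\<lambda>c. if c then fst x else snd x"
    show "?k c \<in> Delta" "?k c = BP \<psi> \<psi>b d (?k (\<not> c))" for c using x by (auto simp: fixed_pairs_def)
  qed simp_all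
  have hfix: "?h \<in> fixed_pairs \<psi> \<psi>b d" 
  proof -
    have "h True = BP \<psi> \<psi>b d (h False)" "h False = BP \<psi> \<psi>b d (h True)"
      using h(3)[of True] h(3)[of False] by (simp_all only: not_True_eq_False not_False_eq_True)
    thus ?thesis unfolding fixed_pairs_def using h(1) by blast
  qed
  have max': "fst x True \<le> fst ?h True" if x: "x \<in> fixed_pairs \<psi> \<psi>b d" for x
  proof (rule pair[OF x])
    fix h' assume h': "\<And>c. h' c \<in> Delta" "\<And>c. h' c = BP \<psi> \<psi>b d (h' (\<not> c))" and eq: "fst x = h' True"
    show ?thesis unfolding eq fst_conv using max[where h' = h' and c = True, OF h'] by (simp only: f_def)
  qed
  have sup: "Phi_Tpm \<psi> \<psi>b d = Phi2 \<psi> \<psi>b d (fst ?h) (snd ?h)"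
    unfolding Phi_Tpm_def
  proof (rule cSup_eq_maximum)
    show "Phi2 \<psi> \<psi>b d (fst ?h) (snd ?h) \<in> (\<lambda>(hp, hm). Phi2 \<psi> \<psi>b d hp hm) ` fixed_pairs \<psi> \<psi>b d"
      using hfix by (intro image_eqI[where x = ?h]) auto
    fix y assume "y \<in> (\<lambda>(hp, hm). Phi2 \<psi> \<psi>b d hp hm) ` fixed_pairs \<psi> \<psi>b d"
    then obtain x where x: "x \<in> fixed_pairs \<psi> \<psi>b d" "y = Phi2 \<psi> \<psi>b d (fst x) (snd x)" by auto
    show "y \<le> Phi2 \<psi> \<psi>b d (fst ?h) (snd ?h)"
    proof (rule pair[OF x(1)])
      fix h' assume h': "\<And>c. h' c \<in> Delta" "\<And>c. h' c = BP \<psi> \<psi>b d (h' (\<not> c))" and eq: "fst x = h' True" "snd x = h' False"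
      show ?thesis unfolding x(2) eq fst_conv snd_conv by (rule Phi_le[where h' = h', OF h'])
    qed
  qed
  have good: "\<And>R. (\<lambda>n. measure_pmf.prob (rooted P n) {(G, v). good_ball d True G (\<tau> n G) R v}) \<longlonglongrightarrow> 1"
    by (rule good_ball_coloured_tendsto[OF tau])
  have average: "(\<lambda>n. measure_pmf.expectation (rooted P n) (\<lambda>(G, v). x (\<tau> n G v))) \<longlonglongrightarrow> (x True + x False) / 2" for x :: "bool \<Rightarrow> real"
    by (rule colour_average_tendsto[OF rg tau])
  have "free_energy_seq \<psi> \<psi>b P \<longlonglongrightarrow> Phi2 \<psi> \<psi>b d (h True) (h False)"
  proof (rule tendsto_from_bounds)
    fix e :: real assume e: "e > 0"
    have odd: "- A (\<not> c) y \<le> A c (- y)" for c y using oddA[of c y] by simp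
    have "eventually (\<lambda>n. free_energy_seq \<psi> \<psi>b P n \<le> (L True 0 + L False 0) / 2
       + (Phi T (Ulim T True) (Ulim T False) - (L True 0 + L False 0) / 2) + e) sequentially"
      by (rule free_energy_upper[OF rg sparse _ good average[of "\<lambda>c. L c 0"] sym odd st e]) simp
    moreover have "Phi T (Ulim T True) (Ulim T False) = Phi2 \<psi> \<psi>b d (h True) (h False)"
      unfolding PhiP[where h' = h, OF h(1,3)] h(2) ..
    ultimately show "eventually (\<lambda>n. free_energy_seq \<psi> \<psi>b P n \<le> Phi2 \<psi> \<psi>b d (h True) (h False) + e) sequentially" by simp
    show "eventually (\<lambda>n. free_energy_seq \<psi> \<psi>b P n \<ge> Phi2 \<psi> \<psi>b d (h True) (h False) - e) sequentially"
    proof (rule free_energy_ge[where bip = True and f = f and col = \<tau> and h = h, OF spec nondeg d3 rg sparse h(1,3) sgn _ _ _ _ _ e])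
      fix h' c assume h': "\<And>c. h' c \<in> Delta" "\<And>c. h' c = BP \<psi> \<psi>b d (h' (\<not> c))"
      show "h' c (f c) \<le> h c (f c)" by (rule max[where h' = h', OF h'])
    qed (use good average in simp_all)
  qed
  thus ?thesis using hfix max' sup by (intro bexI[of _ ?h]) auto
qed

theorem theorem1p7:
  fixes \<psi> :: "bool \<Rightarrow> bool \<Rightarrow> real" and \<psi>b :: "bool \<Rightarrow> real"
    and P :: "nat \<Rightarrow> graph pmf" and d :: nat
  assumes spec: "two_spin_spec \<psi> \<psi>b"
    and nondeg: "non_degenerate \<psi>"
    and d3: "d \<ge> 3"
    and rg: "random_graph_seq P"
    and sparse: "uniformly_sparse P"
    and loc: "converges_locally P d"
  shows
    "(ferromagnetic \<psi> \<longrightarrow>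
        free_energy_seq \<psi> \<psi>b P \<longlonglongrightarrow> Phi_T \<psi> \<psi>b d
      \<and> (\<psi> True True * \<psi>b True powr (2 / real d) \<ge> \<psi> False False * \<psi>b False powr (2 / real d) \<longrightarrow>
           (\<exists>hplus \<in> fixed_points \<psi> \<psi>b d.
              (\<forall>h\<in>fixed_points \<psi> \<psi>b d. h True \<le> hplus True) \<and>
              Phi_T \<psi> \<psi>b d = Phi1 \<psi> \<psi>b d hplus))
      \<and> (\<psi> True True * \<psi>b True powr (2 / real d) < \<psi> False False * \<psi>b False powr (2 / real d) \<longrightarrow>
           (\<exists>hminus \<in> fixed_points \<psi> \<psi>b d.
              (\<forall>h\<in>fixed_points \<psi> \<psi>b d. hminus True \<le> h True) \<and>
              Phi_T \<psi> \<psi>b d = Phi1 \<psi> \<psi>b d hminus)))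
     \<and>
     (antiferromagnetic \<psi> \<and> nearly_bipartite P d \<longrightarrow>
        free_energy_seq \<psi> \<psi>b P \<longlonglongrightarrow> Phi_Tpm \<psi> \<psi>b d
      \<and> (\<exists>hplus \<in> fixed_pairs \<psi> \<psi>b d.
            (\<forall>h\<in>fixed_pairs \<psi> \<psi>b d. fst h True \<le> fst hplus True) \<and>
            Phi_Tpm \<psi> \<psi>b d = Phi2 \<psi> \<psi>b d (fst hplus) (snd hplus))
      \<and> (\<exists>hminus \<in> fixed_pairs \<psi> \<psi>b d.
            (\<forall>h\<in>fixed_pairs \<psi> \<psi>b d. snd h True \<le> snd hminus True) \<and>
            Phi_Tpm \<psi> \<psi>b d = Phi2 \<psi> \<psi>b d (fst hminus) (snd hminus)))"
proof (rule conjI; rule impI)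
  assume ferro: "ferromagnetic \<psi>"
  note lim = ferromagnetic_limit[OF spec nondeg d3 rg sparse loc ferro]
  let ?plus = "\<psi> True True * \<psi>b True powr (2 / real d)"
  let ?minus = "\<psi> False False * \<psi>b False powr (2 / real d)"
  have plus: "\<exists>hplus \<in> fixed_points \<psi> \<psi>b d. (\<forall>h\<in>fixed_points \<psi> \<psi>b d. h True \<le> hplus True) \<and>
      Phi_T \<psi> \<psi>b d = Phi1 \<psi> \<psi>b d hplus \<and> free_energy_seq \<psi> \<psi>b P \<longlonglongrightarrow> Phi1 \<psi> \<psi>b d hplus" if "?plus \<ge> ?minus"
    using lim[of True] that by simp
  have minus: "\<exists>hminus \<in> fixed_points \<psi> \<psi>b d. (\<forall>h\<in>fixed_points \<psi> \<psi>b d. hminus True \<le> h True) \<and>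
      Phi_T \<psi> \<psi>b d = Phi1 \<psi> \<psi>b d hminus \<and> free_energy_seq \<psi> \<psi>b P \<longlonglongrightarrow> Phi1 \<psi> \<psi>b d hminus" if lt: "?plus < ?minus"
  proof -
    \<comment> \<open>Favoured spin \<open>False\<close>: since the masses add up to
      \<open>1\<close>, maximal \<open>h False\<close> means minimal \<open>h True\<close>.\<close>
    have "\<exists>h\<in>fixed_points \<psi> \<psi>b d. (\<forall>h'\<in>fixed_points \<psi> \<psi>b d. h' False \<le> h False) \<and>
      Phi_T \<psi> \<psi>b d = Phi1 \<psi> \<psi>b d h \<and> free_energy_seq \<psi> \<psi>b P \<longlonglongrightarrow> Phi1 \<psi> \<psi>b d h"
      using lim[of False] lt by simp
    then obtain h where h: "h \<in> fixed_points \<psi> \<psi>b d" "\<And>h'. h' \<in> fixed_points \<psi> \<psi>b d \<Longrightarrow> h' False \<le> h False"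
      "Phi_T \<psi> \<psi>b d = Phi1 \<psi> \<psi>b d h" "free_energy_seq \<psi> \<psi>b P \<longlonglongrightarrow> Phi1 \<psi> \<psi>b d h"
      by blast
    have "h True \<le> h' True" if h': "h' \<in> fixed_points \<psi> \<psi>b d" for h'
    proof -
      have "h True + h False = 1" "h' True + h' False = 1" using h(1) h' by (auto simp: fixed_points_def Delta_def)
      thus ?thesis using h(2)[OF h'] by linarith
    qed
    thus ?thesis using h by blast
  qed
  have "free_energy_seq \<psi> \<psi>b P \<longlonglongrightarrow> Phi_T \<psi> \<psi>b d"
    using plus minus by (cases "?plus \<ge> ?minus") auto
  thus "free_energy_seq \<psi> \<psi>b P \<longlonglongrightarrow> Phi_T \<psi> \<psi>b d
      \<and> (?plus \<ge> ?minus \<longrightarrow> (\<exists>hplus \<in> fixed_points \<psi> \<psi>b d.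
              (\<forall>h\<in>fixed_points \<psi> \<psi>b d. h True \<le> hplus True) \<and> Phi_T \<psi> \<psi>b d = Phi1 \<psi> \<psi>b d hplus))
      \<and> (?plus < ?minus \<longrightarrow> (\<exists>hminus \<in> fixed_points \<psi> \<psi>b d.
              (\<forall>h\<in>fixed_points \<psi> \<psi>b d. hminus True \<le> h True) \<and> Phi_T \<psi> \<psi>b d = Phi1 \<psi> \<psi>b d hminus))"
    using plus minus by blast
next
  assume "antiferromagnetic \<psi> \<and> nearly_bipartite P d"
  then obtain h where h: "h \<in> fixed_pairs \<psi> \<psi>b d" "\<And>h'. h' \<in> fixed_pairs \<psi> \<psi>b d \<Longrightarrow> fst h' True \<le> fst h True"
    "Phi_Tpm \<psi> \<psi>b d = Phi2 \<psi> \<psi>b d (fst h) (snd h)" "free_energy_seq \<psi> \<psi>b P \<longlonglongrightarrow> Phi2 \<psi> \<psi>b d (fst h) (snd h)"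
    using antiferromagnetic_limit[OF spec nondeg d3 rg sparse] by blast
  \<comment> \<open>Exchanging the members turns a pair with maximal first member into one with
    maximal second member, and \<open>Phi2\<close> is symmetric.\<close>
  have swap: "(snd h', fst h') \<in> fixed_pairs \<psi> \<psi>b d" if "h' \<in> fixed_pairs \<psi> \<psi>b d" for h'
    using that by (auto simp: fixed_pairs_def)
  have "Phi2 \<psi> \<psi>b d (fst h) (snd h) = Phi2 \<psi> \<psi>b d (snd h) (fst h)"
    using spec by (intro Phi2_commute) (simp add: two_spin_spec_def)
  moreover have "snd h' True \<le> snd (snd h, fst h) True" if "h' \<in> fixed_pairs \<psi> \<psi>b d" for h'
    using h(2)[OF swap[OF that]] by simp
  ultimately have "\<exists>hminus \<in> fixed_pairs \<psi> \<psi>b d. (\<forall>h\<in>fixed_pairs \<psi> \<psi>b d. snd h True \<le> snd hminus True) \<and>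
            Phi_Tpm \<psi> \<psi>b d = Phi2 \<psi> \<psi>b d (fst hminus) (snd hminus)"
    using swap[OF h(1)] h(3) by (intro bexI[of _ "(snd h, fst h)"]) auto
  thus "free_energy_seq \<psi> \<psi>b P \<longlonglongrightarrow> Phi_Tpm \<psi> \<psi>b d
      \<and> (\<exists>hplus \<in> fixed_pairs \<psi> \<psi>b d. (\<forall>h\<in>fixed_pairs \<psi> \<psi>b d. fst h True \<le> fst hplus True) \<and>
            Phi_Tpm \<psi> \<psi>b d = Phi2 \<psi> \<psi>b d (fst hplus) (snd hplus))
      \<and> (\<exists>hminus \<in> fixed_pairs \<psi> \<psi>b d. (\<forall>h\<in>fixed_pairs \<psi> \<psi>b d. snd h True \<le> snd hminus True) \<and>
            Phi_Tpm \<psi> \<psi>b d = Phi2 \<psi> \<psi>b d (fst hminus) (snd hminus))"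
    using h(3,4) bexI[OF _ h(1), of "\<lambda>x. (\<forall>h\<in>fixed_pairs \<psi> \<psi>b d. fst h True \<le> fst x True) \<and>
            Phi_Tpm \<psi> \<psi>b d = Phi2 \<psi> \<psi>b d (fst x) (snd x)"] h(2) by auto
qed

end
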